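(* Consider the cyclic polling system with simultaneous batch arrivals and globally-gated service (reference queue $Q_1$) described in the context, with $\rho<1$. The LST $\widetilde{T}(\cdot)$ of the steady-state batch sojourn-time distribution of an arbitrary batch is $$\widetilde{T}(\omega)=\sum_{\boldsymbol{k}\in\mathcal{K}}\pi(\boldsymbol{k})\,\widetilde{T}_{\boldsymbol{k}}(\omega),$$ where, for $\boldsymbol{k}\in\mathcal{K}$ with $i$ the largest index such that $k_i>0$, the LST of the batch sojourn-time of batch $\boldsymbol{k}$ is $$\widetilde{T}_{\boldsymbol{k}}(\omega)=\frac{1}{E(C)}\left[\frac{\widetilde{C}\bigl(\lambda-\lambda\widetilde{K}(\boldsymbol{B}_{1,i})\bigr)-\widetilde{C}\bigl(\lambda-\lambda\widetilde{K}(\boldsymbol{B}_{1,i-1})+\omega\bigr)}{\omega-\lambda\bigl(1-\widetilde{K}(\boldsymbol{B}_{i,i})\bigr)}\right]\prod_{j=1}^{i-1}\widetilde{S}_j(\omega)\prod_{j=1}^{i}\widetilde{B}_j(\omega)^{k_j}.$$ Alternatively, $$\widetilde{T}(\omega)=\frac{1}{E(C)}\sum_{i=1}^{N}\left[\frac{\widetilde{C}\bigl(\lambda-\lambda\widetilde{K}(\boldsymbol{B}_{1,i})\bigr)-\widetilde{C}\bigl(\lambda-\lambda\widetilde{K}(\boldsymbol{B}_{1,i-1})+\omega\bigr)}{\omega-\lambda\bigl(1-\widetilde{K}(\boldsymbol{B}_{i,i})\bigr)}\right]\prod_{j=1}^{i-1}\widetilde{S}_j(\omega)\ \pi(\ma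thcal{K}_{1,i})\,\widetilde{K}(\boldsymbol{B}_{1,i}\,|\,\mathcal{K}_{1,i}).$$
   Context: Model. A polling system has $N\ge 2$ infinite-buffer queues $Q_1,\dots,Q_N$ served by one server in fixed cyclic order. Batches arrive according to a Poisson process with rate $\lambda$. Each batch has size $\boldsymbol{K}=(K_1,\dots,K_N)$, where $K_i$ is the number of customers joining $Q_i$; $\boldsymbol{K}$ has an arbitrary joint distribution $\pi(\boldsymbol{k})=\mathbb{P}(\boldsymbol{K}=\boldsymbol{k})$ with support $\mathcal{K}$, at least one component of $\boldsymbol{K}$ is positive, and $\boldsymbol{K}$ is independent of past and future arrival epochs. $\widetilde{K}(\boldsymbol{z})=E(z_1^{K_1}\cdots z_N^{K_N})$ and $\lambda_i=\lambda E(K_i)$. Service times at $Q_i$ are distributed as $B_i$ (general, Laplace-Stieltjes transform (LST) $\widetilde{B}_i$); moving from $Q_i$ to $Q_{i+1}$ (from $Q_N$ to $Q_1$) takes a general switch-over time $S_i$ (LST $\widetilde{S}_i$). Service times, switch-over times and arrivals are independent. $\rho_i=\lambda_iE(B_i)$, $\rho=\sum_i\rho_i<1$ (stability), and the system is in steady state. Customers within a queue are served in order of arrival. Globally-gated service: a cycle starts at each visit beginning of the reference queue $Q_1$; during a cycle the server serves, in the order $Q_1,\dots,Q_N$, exactly the customers present in all queues at the start of the cycle; customers arriving during a cycle are served in the next cycle. Batch sojourn-time: the time from the arrival epoch of a batch until the service completion of the last served customer of the batch. Notation. $C$ is the steady-state cycle length, $E(C)=\sum_iE(S_i)/(1-\rho)$,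 and $\widetilde{C}(\omega)=E(e^{-\omega C})$. For $j\le i$, $\boldsymbol{B}_{j,i}$ is the $N$-vector whose $l$-th component is $\widetilde{B}_l(\omega)$ for $l=j,\dots,i$ and $1$ otherwise; $\boldsymbol{B}_{1,0}$ is the all-ones vector. $\mathcal{K}_{1,i}$ is the set of $\boldsymbol{k}\in\mathcal{K}$ with $k_i>0$ and $k_{i+1}=\dots=k_N=0$; $\pi(\mathcal{K}_{1,i})=\mathbb{P}(\boldsymbol{K}\in\mathcal{K}_{1,i})$; and $\widetilde{K}(\boldsymbol{z}|\mathcal{K}_{1,i})=\sum_{\boldsymbol{k}\in\mathcal{K}_{1,i}}\frac{\pi(\boldsymbol{k})}{\pi(\mathcal{K}_{1,i})}\prod_{l=1}^{i}z_l^{k_l}$ (terms with $\pi(\mathcal{K}_{1,i})=0$ are zero). Empty products equal $1$.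
   Formalization: The printed denominator ω−λ(1−K̃(B_{i,i})) fails when a batch can join several queues; the formal one is ω−λ(K̃(B_{1,i−1})−K̃(B_{1,i})), equal to it for single-queue batches. Also assumed: Re ω ≥ 0, ω ≠ 0, finite means, ΣE(S_i) > 0. *)

theory Defs
  imports "HOL-Probability.Probability"
begin

section \<open>Polling systems with simultaneous batch arrivals and globally-gated service\<close>

text \<open>
  The primitive data.  Queues are numbered from 1 to \<open>nq\<close>.  Batches are numbered by
  \<open>n = 0, 1, 2, \<dots>\<close> in order of arrival, cycles by \<open>m = 0, 1, 2, \<dots>\<close>, and the customers
  of one batch (or of the initial content) in one queue by \<open>c = 0, 1, 2, \<dots>\<close> in order
  of service.  Time 0 is the start of cycle 0; the customers found in the queues at that moment
  are the initial content.  A batch size is a function from queues to numbers of customers that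
  vanishes outside of the existing queues.
\<close>

record 'a polling =
  prob_sp :: "'a measure"
  nq :: nat
  rate :: real
  batch_pmf :: "(nat \<Rightarrow> nat) pmf"
  service_law :: "nat \<Rightarrow> real measure"
  switch_law :: "nat \<Rightarrow> real measure"
  init_content :: "'a \<Rightarrow> nat \<Rightarrow> nat"
  init_service :: "nat \<Rightarrow> nat \<Rightarrow> 'a \<Rightarrow> real"
    \<comment> \<open>queue, customer\<close>
  interarrival :: "nat \<Rightarrow> 'a \<Rightarrow> real"
  batch_size :: "nat \<Rightarrow> 'a \<Rightarrow> nat \<Rightarrow> nat"
  service :: "nat \<Rightarrow> nat \<Rightarrow> nat \<Rightarrow> 'a \<Rightarrow> real"
    \<comment> \<open>batch, queue, customer\<close>
  switchover :: "nat \<Rightarrow> nat \<Rightarrow> 'a \<Rightarrow> real"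
    \<comment> \<open>cycle, queue that is left\<close>


subsection \<open>Evolution of the system\<close>

definition arrival_epoch :: "'a polling \<Rightarrow> nat \<Rightarrow> 'a \<Rightarrow> real" where
  "arrival_epoch P n x = (\<Sum>j\<le>n. interarrival P j x)"

definition batches_in :: "'a polling \<Rightarrow> real \<Rightarrow> real \<Rightarrow> 'a \<Rightarrow> nat set" where
  "batches_in P s t x = {n. s < arrival_epoch P n x \<and> arrival_epoch P n x \<le> t}"

definition batch_work :: "'a polling \<Rightarrow> nat \<Rightarrow> nat \<Rightarrow> 'a \<Rightarrow> real" where
  "batch_work P n i x = (\<Sum>c<batch_size P n x i. service P n i c x)"

definition init_work :: "'a polling \<Rightarrow> nat \<Rightarrow> 'a \<Rightarrow> real" where
  "init_work P i x = (\<Sum>c<init_content P x i. init_service P i c x)"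

text \<open>
  The start of cycle \<open>m\<close>.  The batches that arrive during cycle \<open>m\<close> are
  exactly those that are served in cycle \<open>m + 1\<close>.
\<close>

fun gate :: "'a polling \<Rightarrow> nat \<Rightarrow> 'a \<Rightarrow> real" where
  "gate P 0 x = 0"
| "gate P (Suc 0) x = (\<Sum>i=1..nq P. init_work P i x + switchover P 0 i x)"
| "gate P (Suc (Suc m)) x = gate P (Suc m) x +
     (\<Sum>i=1..nq P. (\<Sum>n\<in>batches_in P (gate P m x) (gate P (Suc m) x) x. batch_work P n i x)
        + switchover P (Suc m) i x)"

definition cycle_length :: "'a polling \<Rightarrow> nat \<Rightarrow> 'a \<Rightarrow> real" where
  "cycle_length P m x = gate P (Suc m) x - gate P m x"

definition arrivals :: "'a polling \<Rightarrow> nat \<Rightarrow> 'a \<Rightarrow> nat set" where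
  "arrivals P m x = batches_in P (gate P m x) (gate P (Suc m) x) x"

definition queue_content :: "'a polling \<Rightarrow> nat \<Rightarrow> 'a \<Rightarrow> nat \<Rightarrow> nat" where
  "queue_content P m x i =
     (case m of 0 \<Rightarrow> init_content P x i
      | Suc m' \<Rightarrow> \<Sum>n\<in>arrivals P m' x. batch_size P n x i)"

definition gated_work :: "'a polling \<Rightarrow> nat \<Rightarrow> nat \<Rightarrow> 'a \<Rightarrow> real" where
  "gated_work P m i x =
     (case m of 0 \<Rightarrow> init_work P i x
      | Suc m' \<Rightarrow> \<Sum>n\<in>arrivals P m' x. batch_work P n i x)"

lemma cycle_length_eq:
  "cycle_length P m x = (\<Sum>i=1..nq P. gated_work P m i x + switchover P m i x)"
  by (cases m) (simp_all add: cycle_length_def gated_work_def arrivals_def)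

definition visit_start :: "'a polling \<Rightarrow> nat \<Rightarrow> nat \<Rightarrow> 'a \<Rightarrow> real" where
  "visit_start P m i x =
     gate P m x + (\<Sum>l\<in>{1..<i}. gated_work P m l x + switchover P m l x)"

text \<open>
  The service completion time of customer \<open>c\<close> of batch \<open>n\<close> in queue \<open>i\<close>,
  and the sojourn time of batch \<open>n\<close>, when batch \<open>n\<close> arrives during cycle \<open>m\<close>.
\<close>

definition completion :: "'a polling \<Rightarrow> nat \<Rightarrow> nat \<Rightarrow> nat \<Rightarrow> nat \<Rightarrow> 'a \<Rightarrow> real" where
  "completion P m n i c x =
     visit_start P (Suc m) i x + (\<Sum>n'\<in>{n' \<in> arrivals P m x. n' < n}. batch_work P n' i x)
     + (\<Sum>c'\<le>c. service P n i c' x)"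

definition sojourn :: "'a polling \<Rightarrow> nat \<Rightarrow> nat \<Rightarrow> 'a \<Rightarrow> real" where
  "sojourn P m n x =
     Max {completion P m n i c x | i c. i \<in> {1..nq P} \<and> c < batch_size P n x i}
     - arrival_epoch P n x"


subsection \<open>Stochastic assumptions\<close>

datatype source =
    Init_Content
  | Init_Service nat nat
  | Interarrival nat
  | Batch_Size nat
  | Service nat nat nat
  | Switchover nat nat

definition sources :: "nat \<Rightarrow> source set" where
  "sources N = {Init_Content} \<union> range Interarrival \<union> range Batch_Size
     \<union> {Init_Service i c | i c. i \<in> {1..N}}
     \<union> {Service n i c | n i c. i \<in> {1..N}}
     \<union> {Switchover m i | m i. i \<in> {1..N}}"

text \<open>The sigma-algebra generated by a primitive random variable, as a set of events.\<close>

fun source_events :: "'a polling \<Rightarrow> source \<Rightarrow> 'a set set" where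
  "source_events P Init_Content =
     {init_content P -` A \<inter> space (prob_sp P) | A. A \<in> UNIV}"
| "source_events P (Init_Service i c) =
     {init_service P i c -` A \<inter> space (prob_sp P) | A. A \<in> sets borel}"
| "source_events P (Interarrival n) =
     {interarrival P n -` A \<inter> space (prob_sp P) | A. A \<in> sets borel}"
| "source_events P (Batch_Size n) =
     {batch_size P n -` A \<inter> space (prob_sp P) | A. A \<in> UNIV}"
| "source_events P (Service n i c) =
     {service P n i c -` A \<inter> space (prob_sp P) | A. A \<in> sets borel}"
| "source_events P (Switchover m i) =
     {switchover P m i -` A \<inter> space (prob_sp P) | A. A \<in> sets borel}"

definition mean_batch_size :: "'a polling \<Rightarrow> nat \<Rightarrow> real" where
  "mean_batch_size P i = measure_pmf.expectation (batch_pmf P) (\<lambda>k. real (k i))"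

definition load :: "'a polling \<Rightarrow> real" where
  "load P = (\<Sum>i=1..nq P. (rate P * mean_batch_size P i) * (LINT t|service_law P i. t))"

definition nonneg_law :: "real measure \<Rightarrow> bool" where
  "nonneg_law \<mu> \<longleftrightarrow> prob_space \<mu> \<and> sets \<mu> = sets borel \<and> (AE t in \<mu>. 0 \<le> t) \<and> integrable \<mu> (\<lambda>t. t)"

text \<open>
  The queue contents at the cycle starts form a Markov chain, so the system is in steady state,
  as seen from the cycle starts, when their distribution does not depend on the cycle.
  At least one mean switch-over time has to be positive, since otherwise the mean cycle length is 0
  and infinitely many empty cycles take place in zero time.
\<close>

locale stationary_globally_gated = prob_space "prob_sp P" for P :: "'a polling" +
  assumes queues: "nq P \<ge> 2"
    and rate_pos: "rate P > 0"
    and batch_support: "\<And>k i. k \<in> set_pmf (batch_pmf P) \<Longrightarrow> i \<notin> {1..nq P} \<Longrightarrow> k i = 0"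
    and batch_nonempty: "\<And>k. k \<in> set_pmf (batch_pmf P) \<Longrightarrow> \<exists>i\<in>{1..nq P}. k i > 0"
    and batch_integrable: "\<And>i. i \<in> {1..nq P} \<Longrightarrow> integrable (batch_pmf P) (\<lambda>k. real (k i))"
    and service_law: "\<And>i. i \<in> {1..nq P} \<Longrightarrow> nonneg_law (service_law P i)"
    and switch_law: "\<And>i. i \<in> {1..nq P} \<Longrightarrow> nonneg_law (switch_law P i)"
    and switch_pos: "(\<Sum>i=1..nq P. LINT t|switch_law P i. t) > 0"
    and stable: "load P < 1"
    and independent: "indep_sets (source_events P) (sources (nq P))"
    and interarrival_distr:
      "\<And>n. distributed (prob_sp P) lborel (interarrival P n) (exponential_density (rate P))"
    and batch_size_distr:
      "\<And>n. distr (prob_sp P) (count_space UNIV) (batch_size P n) = measure_pmf (batch_pmf P)"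
    and service_distr:
      "\<And>n i c. i \<in> {1..nq P} \<Longrightarrow> distr (prob_sp P) borel (service P n i c) = service_law P i"
    and init_service_distr:
      "\<And>i c. i \<in> {1..nq P} \<Longrightarrow> distr (prob_sp P) borel (init_service P i c) = service_law P i"
    and switchover_distr:
      "\<And>m i. i \<in> {1..nq P} \<Longrightarrow> distr (prob_sp P) borel (switchover P m i) = switch_law P i"
    and stationary:
      "\<And>m k. prob {x \<in> space (prob_sp P). queue_content P m x = k}
            = prob {x \<in> space (prob_sp P). queue_content P 0 x = k}"


subsection \<open>Sojourn time of an arbitrary batch\<close>

text \<open>
  An arbitrary batch with size in \<open>Q\<close> is a pair of an outcome and a batch index
  that is distributed according to the Palm measure: the measure
  of a set of pairs is the expected number of batches of cycle \<open>m\<close> with size in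
  \<open>Q\<close> that belong to it, divided by the expected number of all batches of cycle \<open>m\<close>
  with size in \<open>Q\<close>.  In steady state this does not depend on \<open>m\<close>.
\<close>

definition arbitrary_batch :: "'a polling \<Rightarrow> nat \<Rightarrow> (nat \<Rightarrow> nat) set \<Rightarrow> ('a \<times> nat) measure" where
  "arbitrary_batch P m Q = uniform_measure (prob_sp P \<Otimes>\<^sub>M count_space UNIV)
     {(x, n). x \<in> space (prob_sp P) \<and> n \<in> arrivals P m x \<and> batch_size P n x \<in> Q}"

definition sojourn_law :: "'a polling \<Rightarrow> nat \<Rightarrow> (nat \<Rightarrow> nat) set \<Rightarrow> real measure" where
  "sojourn_law P m Q = distr (arbitrary_batch P m Q) borel (\<lambda>(x, n). sojourn P m n x)"


subsection \<open>Transforms\<close>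

definition lst :: "real measure \<Rightarrow> complex \<Rightarrow> complex" where
  "lst \<mu> s = (LINT t|\<mu>. exp (- s * complex_of_real t))"

definition cycle_lst :: "'a polling \<Rightarrow> complex \<Rightarrow> complex" where
  "cycle_lst P = lst (distr (prob_sp P) borel (cycle_length P 0))"

definition mean_cycle :: "'a polling \<Rightarrow> real" where
  "mean_cycle P = (LINT x|prob_sp P. cycle_length P 0 x)"

definition batch_pgf :: "'a polling \<Rightarrow> (nat \<Rightarrow> complex) \<Rightarrow> complex" where
  "batch_pgf P z = measure_pmf.expectation (batch_pmf P) (\<lambda>k. \<Prod>i=1..nq P. z i ^ k i)"

definition service_vec :: "'a polling \<Rightarrow> complex \<Rightarrow> nat \<Rightarrow> nat \<Rightarrow> nat \<Rightarrow> complex" where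
  "service_vec P \<omega> j i l = (if j \<le> l \<and> l \<le> i then lst (service_law P l) \<omega> else 1)"

definition batches_up_to :: "'a polling \<Rightarrow> nat \<Rightarrow> (nat \<Rightarrow> nat) set" where
  "batches_up_to P i = {k \<in> set_pmf (batch_pmf P). k i > 0 \<and> (\<forall>l\<in>{i<..nq P}. k l = 0)}"

definition cond_batch_pgf :: "'a polling \<Rightarrow> nat \<Rightarrow> (nat \<Rightarrow> complex) \<Rightarrow> complex" where
  "cond_batch_pgf P i z =
     (\<Sum>\<^sub>\<infinity>k\<in>batches_up_to P i.
        complex_of_real (pmf (batch_pmf P) k / measure_pmf.prob (batch_pmf P) (batches_up_to P i))
        * (\<Prod>l=1..i. z l ^ k l))"

text \<open>
  The transform, up to the switch-over times and the batch's own service times, of the sojourn time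
  of a batch whose last customers are in queue \<open>i\<close>.  It is the joint transform
  \<open>(C(a) - C(b)) / (E C * (b - a))\<close> of the elapsed and the residual part of the
  cycle in which the batch arrives (\<open>C\<close> being the transform of the cycle length), taken at
  \<open>a = \<lambda> - \<lambda> K(B_{1,i})\<close> and \<open>b = \<lambda> - \<lambda> K(B_{1,i-1}) + \<omega>\<close>.
  The denominator \<open>b - a\<close> is
  \<open>\<omega> - \<lambda> (K(B_{1,i-1}) - K(B_{1,i}))\<close>.  The shorter form
  \<open>\<omega> - \<lambda> (1 - K(B_{i,i}))\<close> of it is correct if every batch joins a single
  queue (see the lemmas below), but not if the components of a batch are dependent in general: when
  every batch brings one customer to each of the queues 1 and 2, the first form contains
  \<open>B_1 (1 - B_2)\<close> and the second one \<open>1 - B_2\<close>.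
\<close>

definition cycle_term :: "'a polling \<Rightarrow> complex \<Rightarrow> nat \<Rightarrow> complex" where
  "cycle_term P \<omega> i =
     (let lam = complex_of_real (rate P);
          K = (\<lambda>j i. batch_pgf P (service_vec P \<omega> j i))
      in (cycle_lst P (lam - lam * K 1 i) - cycle_lst P (lam - lam * K 1 (i - 1) + \<omega>))
         / (\<omega> - lam * (K 1 (i - 1) - K 1 i)))"

lemma batch_pgf_diff_single_queue:
  assumes single: "\<And>k. k \<in> set_pmf (batch_pmf P) \<Longrightarrow> \<exists>l. \<forall>j. j \<noteq> l \<longrightarrow> k j = 0"
    and i: "i \<in> {1..nq P}"
    and bounded: "\<And>l. l \<in> {1..nq P} \<Longrightarrow> norm (lst (service_law P l) \<omega>) \<le> 1"
  shows "batch_pgf P (service_vec P \<omega> 1 (i - 1)) - batch_pgf P (service_vec P \<omega> 1 i)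
         = 1 - batch_pgf P (service_vec P \<omega> i i)"
proof -
  define f where "f j i' k = (\<Prod>l=1..nq P. service_vec P \<omega> j i' l ^ k l)" for j i' and k :: "nat \<Rightarrow> nat"
  have "norm (f j i' k) \<le> 1" for j i' k
    unfolding f_def prod_norm[symmetric]
    by (rule prod_le_1) (auto simp: norm_power service_vec_def bounded intro!: power_le_one)
  then have int: "integrable (measure_pmf (batch_pmf P)) (f j i')" for j i'
    by (intro measure_pmf.integrable_const_bound[where B = 1]) auto
  have eq: "f 1 (i - 1) k - f 1 i k = 1 - f i i k" if k: "k \<in> set_pmf (batch_pmf P)" for k
  proof -
    obtain l where l: "\<And>j. j \<noteq> l \<Longrightarrow> k j = 0"
      using single[OF k] by blast
    have f: "f j i' k = (if l \<in> {1..nq P} then service_vec P \<omega> j i' l ^ k l else 1)" for j i'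
    proof -
      have "f j i' k = (\<Prod>a=1..nq P. if a = l then service_vec P \<omega> j i' l ^ k l else 1)"
        unfolding f_def by (rule prod.cong) (auto simp: l)
      then show ?thesis
        by simp
    qed
    show ?thesis
      using i unfolding f by (cases l i rule: linorder_cases) (auto simp: service_vec_def)
  qed
  have "measure_pmf.expectation (batch_pmf P) (\<lambda>k. f 1 (i - 1) k - f 1 i k)
      = measure_pmf.expectation (batch_pmf P) (\<lambda>k. 1 - f i i k)"
    by (intro integral_cong_AE) (use eq in \<open>auto simp: AE_measure_pmf_iff\<close>)
  then show ?thesis
    using int by (simp add: batch_pgf_def f_def[abs_def])
qed

lemma batch_pgf_diff_two_queues:
  assumes "nq P = 2" and "batch_pmf P = return_pmf (\<lambda>l. if l \<in> {1, 2} then 1 else 0)"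
  shows "batch_pgf P (service_vec P \<omega> 1 1) - batch_pgf P (service_vec P \<omega> 1 2)
         = lst (service_law P 1) \<omega> * (1 - lst (service_law P 2) \<omega>)"
    and "1 - batch_pgf P (service_vec P \<omega> 2 2) = 1 - lst (service_law P 2) \<omega>"
  using assms by (simp_all add: batch_pgf_def service_vec_def numeral_2_eq_2 algebra_simps)

end

theory Submission
  imports Defs
begin

text \<open>
  Fix a batch whose last customers are in queue \<open>i\<close>, and let \<open>C\<close> be the length of the
  cycle in which it arrives. If it arrives \<open>u\<close> time units after the start of that cycle, then its
  sojourn time is the residual cycle \<open>C - u\<close>, plus the work that the earlier batches of the cycle
  bring to the queues \<open>1, \<dots>, i\<close>, plus the work that the later batches bring to the queues
  \<open>1, \<dots>, i - 1\<close>, plus its own work and \<open>i - 1\<close> switch-over times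
  (\<open>sojourn_window\<close>). The length of a cycle is determined by the customers found at its start and by
  its switch-over times, so that, given \<open>C\<close>, the arrivals in the cycle are a Poisson process on an
  interval of length \<open>C\<close>. The numbers of earlier and of later batches are therefore independent
  Poisson variables with means \<open>\<lambda> u\<close> and \<open>\<lambda> (C - u)\<close>. Every earlier
  batch contributes a factor \<open>K(B_{1,i})\<close> and every later one a factor \<open>K(B_{1,i-1})\<close>.
  With \<open>a = \<lambda> - \<lambda> K(B_{1,i})\<close> and \<open>b = \<lambda> - \<lambda> K(B_{1,i-1}) +
  \<omega>\<close>, the integral of \<open>\<lambda> exp (- a u) exp (- b (C - u))\<close> over \<open>0 \<le> u
  \<le> C\<close> is \<open>\<lambda> (exp (- a C) - exp (- b C)) / (b - a)\<close>. Its mean, divided by the mean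
  number \<open>\<lambda> E(C)\<close> of batches in a cycle and multiplied by the transforms of the batch's own
  work and of the switch-over times, is the transform of the sojourn time.

  The cycle starts depend on the arrivals, so that "the arrivals after the start of cycle \<open>m\<close>" are
  not simply a shifted copy of the arrival process. The way out is to fix the number \<open>p\<close> of batches
  that arrive up to that moment. As long as batch \<open>p\<close> has not arrived, the cycle starts agree with
  those of a system that never receives the batches \<open>p, p + 1, \<dots>\<close>
  (\<open>truncated_gate_eq\<close>), and those are independent of the later batches and interarrival times. The
  current interarrival time is handled by the memoryless property (\<open>integral_residual_window\<close>). A
  \<open>window\<close> fixes \<open>p\<close> and the number of arrivals in the cycle; given the window, the
  batches are independent marks (\<open>integral_marks\<close>), and the sum over all windows yields the Palm
  formula \<open>integral_palm\<close>.

  Stationarity is assumed for the queue contents only. The transform of a cycle length is a function of the law of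
  the queue contents (\<open>transform_next_cycle\<close>), so that all cycle lengths have the same law
  (\<open>distr_cycle_length\<close>). That their common mean is finite has to be derived from \<open>\<rho> <
  1\<close>: the transform satisfies \<open>\<phi>(s) = \<phi>(\<lambda> (1 - K(B(s)))) * S(s)\<close>
  (\<open>cycle_transform_functional_equation\<close>), whence \<open>1 - \<phi>(s) \<le> (1 - \<phi>(\<rho> s)) +
  s E(S)\<close>, and iteration gives \<open>1 - \<phi>(s) \<le> s E(S) / (1 - \<rho>)\<close>. Stability also
  keeps the denominators \<open>b - a\<close> away from 0 (\<open>cycle_term_denominator_nonzero\<close>).
\<close>

section \<open>Sigma-algebras generated by primitive variables\<close>

abbreviation damp :: "complex \<Rightarrow> real \<Rightarrow> complex" where
  "damp \<omega> t \<equiv> exp (- \<omega> * complex_of_real t)"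

text \<open>
  Independence is used between groups of primitive variables, not between single ones: two groups without a common
  member generate independent sigma-algebras, whatever is computed from them.
\<close>

definition source_algebra :: "'a polling \<Rightarrow> source set \<Rightarrow> 'a measure" where
  "source_algebra P J = sigma (space (prob_sp P)) (\<Union>s\<in>J. source_events P s)"

lemma source_events_subset: "source_events P s \<subseteq> Pow (space (prob_sp P))"
  by (cases s) auto

lemma Int_stable_preimages:
  assumes "\<And>A B. A \<in> \<A> \<Longrightarrow> B \<in> \<A> \<Longrightarrow> A \<inter> B \<in> \<A>"
  shows "Int_stable {f -` A \<inter> \<Omega> | A. A \<in> \<A>}"
proof (rule Int_stableI)
  fix a b assume "a \<in> {f -` A \<inter> \<Omega> | A. A \<in> \<A>}" "b \<in> {f -` A \<inter> \<Omega> | A. A \<in> \<A>}"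
  then obtain A B where "a = f -` A \<inter> \<Omega>" "A \<in> \<A>" "b = f -` B \<inter> \<Omega>" "B \<in> \<A>"
    by auto
  then have "a \<inter> b = f -` (A \<inter> B) \<inter> \<Omega> \<and> A \<inter> B \<in> \<A>"
    using assms by auto
  then show "a \<inter> b \<in> {f -` A \<inter> \<Omega> | A. A \<in> \<A>}"
    by blast
qed

lemma Int_stable_source_events: "Int_stable (source_events P s)"
  by (cases s) (simp_all only: source_events.simps, (rule Int_stable_preimages; simp)+)

lemma space_source_algebra [simp]: "space (source_algebra P J) = space (prob_sp P)"
  unfolding source_algebra_def using source_events_subset by (intro space_measure_of) blast

lemma sets_source_algebra:
  "sets (source_algebra P J) = sigma_sets (space (prob_sp P)) (\<Union>s\<in>J. source_events P s)"
  unfolding source_algebra_def using source_events_subset by (intro sets_measure_of) blast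

lemma source_event_in_algebra:
  "s \<in> J \<Longrightarrow> a \<in> source_events P s \<Longrightarrow> a \<in> sets (source_algebra P J)"
  by (auto simp: sets_source_algebra)

lemma measurable_source:
  assumes "s \<in> J" and eq: "source_events P s = {f -` A \<inter> space (prob_sp P) | A. A \<in> sets A'}"
    and "\<And>x. f x \<in> space A'"
  shows "f \<in> measurable (source_algebra P J) A'"
proof (rule measurableI)
  fix A assume "A \<in> sets A'"
  then have "f -` A \<inter> space (prob_sp P) \<in> source_events P s"
    unfolding eq by blast
  then show "f -` A \<inter> space (source_algebra P J) \<in> sets (source_algebra P J)"
    using source_event_in_algebra[OF assms(1)] by simp
qed (use assms in auto)

lemma measurable_init_content_source:
  "Init_Content \<in> J \<Longrightarrow> init_content P \<in> measurable (source_algebra P J) (count_space UNIV)"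
  by (rule measurable_source[where s = Init_Content]) auto

lemma measurable_init_service_source:
  "Init_Service i c \<in> J \<Longrightarrow> init_service P i c \<in> borel_measurable (source_algebra P J)"
  by (rule measurable_source[where s = "Init_Service i c"]) auto

lemma measurable_interarrival_source:
  "Interarrival n \<in> J \<Longrightarrow> interarrival P n \<in> borel_measurable (source_algebra P J)"
  by (rule measurable_source[where s = "Interarrival n"]) auto

lemma measurable_batch_size_source:
  "Batch_Size n \<in> J \<Longrightarrow> batch_size P n \<in> measurable (source_algebra P J) (count_space UNIV)"
  by (rule measurable_source[where s = "Batch_Size n"]) auto

lemma measurable_service_source:
  "Service n i c \<in> J \<Longrightarrow> service P n i c \<in> borel_measurable (source_algebra P J)"
  by (rule measurable_source[where s = "Service n i c"]) auto

lemma measurable_switchover_source: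
  "Switchover m i \<in> J \<Longrightarrow> switchover P m i \<in> borel_measurable (source_algebra P J)"
  by (rule measurable_source[where s = "Switchover m i"]) auto

text \<open>
  The set of summation indices is random and may be infinite, in which case the sum is 0 by convention. This
  happens on a measurable set of outcomes; off this set the sum is a convergent series.
\<close>

lemma borel_measurable_random_sum:
  fixes f :: "nat \<Rightarrow> 'a \<Rightarrow> real"
  assumes f [measurable]: "\<And>n. f n \<in> borel_measurable A"
    and D [measurable]: "\<And>n. Measurable.pred A (\<lambda>x. n \<in> D x)"
  shows "(\<lambda>x. \<Sum>n\<in>D x. f n x) \<in> borel_measurable A"
proof -
  have "(\<Sum>n\<in>D x. f n x)
    = (if \<exists>K. \<forall>n\<ge>K. n \<notin> D x then (\<Sum>n. if n \<in> D x then f n x else 0) else 0)" for x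
  proof (cases "finite (D x)")
    case True
    then obtain K where "\<forall>n\<in>D x. n < K"
      using finite_nat_set_iff_bounded by blast
    then have ex: "\<exists>K. \<forall>n\<ge>K. n \<notin> D x"
      by (meson linorder_not_le)
    have "(\<Sum>n. if n \<in> D x then f n x else 0) = (\<Sum>n\<in>D x. if n \<in> D x then f n x else 0)"
      using True by (intro suminf_finite) auto
    also have "\<dots> = (\<Sum>n\<in>D x. f n x)"
      by (rule sum.cong) auto
    finally show ?thesis
      unfolding if_P[OF ex] ..
  next
    case False
    have "\<nexists>K. \<forall>n\<ge>K. n \<notin> D x"
    proof
      assume "\<exists>K. \<forall>n\<ge>K. n \<notin> D x"
      then obtain K where "\<forall>n\<ge>K. n \<notin> D x" ..
      then have "D x \<subseteq> {..<K}"
        by (meson lessThan_iff linorder_not_le subsetI)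
      then show False
        using False finite_subset by blast
    qed
    then show ?thesis
      using False by (simp only: if_False) simp
  qed
  then show ?thesis
    by simp
qed

section \<open>Arrival epochs and truncated cycle starts\<close>

text \<open>
  Batch \<open>n\<close> arrives at \<open>epoch P (Suc n)\<close>. Because of the shift, "exactly
  \<open>p\<close> batches have arrived by time \<open>t\<close>" is \<open>epoch P p x \<le> t \<and> t < epoch P
  (Suc p) x\<close> also for \<open>p = 0\<close>.
\<close>

definition epoch :: "'a polling \<Rightarrow> nat \<Rightarrow> 'a \<Rightarrow> real" where
  "epoch P p x = (\<Sum>j<p. interarrival P j x)"

lemma arrival_epoch_eq: "arrival_epoch P n x = epoch P (Suc n) x"
  by (simp add: arrival_epoch_def epoch_def lessThan_Suc_atMost)

lemma epoch_0 [simp]: "epoch P 0 x = 0"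
  by (simp add: epoch_def)

lemma epoch_Suc: "epoch P (Suc p) x = epoch P p x + interarrival P p x"
  by (simp add: epoch_def)

lemma epoch_add: "epoch P (p + k) x = epoch P p x + (\<Sum>j=p..<p+k. interarrival P j x)"
  by (induction k) (simp_all add: epoch_Suc)

text \<open>
  The cycle starts of a system that never receives the batches \<open>p, p + 1, \<dots>\<close>. They are
  independent of these batches, and they agree with the true cycle starts as long as batch \<open>p\<close> has
  not arrived.
\<close>

fun truncated_gate :: "'a polling \<Rightarrow> nat \<Rightarrow> nat \<Rightarrow> 'a \<Rightarrow> real" where
  "truncated_gate P p 0 x = 0"
| "truncated_gate P p (Suc 0) x = (\<Sum>i=1..nq P. init_work P i x + switchover P 0 i x)"
| "truncated_gate P p (Suc (Suc m)) x = truncated_gate P p (Suc m) x +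
     (\<Sum>i=1..nq P. (\<Sum>n\<in>{n\<in>{..<p}. truncated_gate P p m x < epoch P (Suc n) x
          \<and> epoch P (Suc n) x \<le> truncated_gate P p (Suc m) x}. batch_work P n i x)
        + switchover P (Suc m) i x)"

lemma truncated_gate_0: "truncated_gate P p 0 = (\<lambda>_. 0)"
  by (rule ext) simp

lemma gate_0: "gate P 0 = (\<lambda>_. 0)"
  by (rule ext) simp

definition past_sources :: "'a polling \<Rightarrow> nat \<Rightarrow> nat \<Rightarrow> source set" where
  "past_sources P p m = {Init_Content} \<union> {Init_Service i c | i c. i \<in> {1..nq P}}
     \<union> Interarrival ` {..<p} \<union> Batch_Size ` {..<p}
     \<union> {Service n i c | n i c. n < p \<and> i \<in> {1..nq P}}
     \<union> {Switchover j i | j i. j \<le> m \<and> i \<in> {1..nq P}}"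

definition batch_sources :: "'a polling \<Rightarrow> nat \<Rightarrow> source set" where
  "batch_sources P n = {Batch_Size n} \<union> {Service n i c | i c. i \<in> {1..nq P}}"

lemma measurable_random_length_sum:
  fixes f :: "nat \<Rightarrow> 'a \<Rightarrow> real"
  assumes "\<And>c. f c \<in> borel_measurable A" "g \<in> measurable A (count_space UNIV)"
  shows "(\<lambda>x. \<Sum>c<g x. f c x) \<in> borel_measurable A"
  by (rule measurable_compose_countable[where f = "\<lambda>l x. \<Sum>c<l. f c x"]) (use assms in simp_all)

lemma measurable_batch_work_source:
  assumes "batch_sources P n \<subseteq> J" "i \<in> {1..nq P}"
  shows "batch_work P n i \<in> borel_measurable (source_algebra P J)"
  unfolding batch_work_def[abs_def]
proof (rule measurable_random_length_sum)
  show "service P n i c \<in> borel_measurable (source_algebra P J)" for c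
    using assms by (intro measurable_service_source) (auto simp: batch_sources_def)
  have "batch_size P n \<in> measurable (source_algebra P J) (count_space UNIV)"
    using assms by (intro measurable_batch_size_source) (auto simp: batch_sources_def)
  then show "(\<lambda>x. batch_size P n x i) \<in> measurable (source_algebra P J) (count_space UNIV)"
    by (rule measurable_compose[where g = "\<lambda>k. k i"]) simp
qed

lemma measurable_init_work_source:
  assumes "Init_Content \<in> J" "\<And>c. Init_Service i c \<in> J"
  shows "init_work P i \<in> borel_measurable (source_algebra P J)"
  unfolding init_work_def[abs_def]
proof (rule measurable_random_length_sum)
  show "init_service P i c \<in> borel_measurable (source_algebra P J)" for c
    using assms by (intro measurable_init_service_source)
  have "init_content P \<in> measurable (source_algebra P J) (count_space UNIV)"
    using assms by (intro measurable_init_content_source)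
  then show "(\<lambda>x. init_content P x i) \<in> measurable (source_algebra P J) (count_space UNIV)"
    by (rule measurable_compose[where g = "\<lambda>k. k i"]) simp
qed

lemma measurable_epoch_source:
  assumes "Interarrival ` {..<p} \<subseteq> J"
  shows "epoch P p \<in> borel_measurable (source_algebra P J)"
  unfolding epoch_def[abs_def]
  using assms by (intro borel_measurable_sum measurable_interarrival_source) auto

lemma past_sources_mono: "p \<le> p' \<Longrightarrow> m \<le> m' \<Longrightarrow> past_sources P p m \<subseteq> past_sources P p' m'"
  unfolding past_sources_def by fastforce

lemma measurable_truncated_gate_source:
  "past_sources P p m \<subseteq> J \<Longrightarrow> truncated_gate P p (Suc m) \<in> borel_measurable (source_algebra P J)"
proof (induction m rule: less_induct)
  case (less m)
  have sw: "switchover P m i \<in> borel_measurable (source_algebra P J)" if "i \<in> {1..nq P}" for i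
    using less.prems that by (intro measurable_switchover_source) (auto simp: past_sources_def)
  show ?case
  proof (cases m)
    case 0
    have "init_work P i \<in> borel_measurable (source_algebra P J)" if "i \<in> {1..nq P}" for i
      using less.prems that by (intro measurable_init_work_source) (auto simp: past_sources_def)
    with sw 0 show ?thesis
      by (simp add: borel_measurable_sum borel_measurable_add)
  next
    case (Suc k)
    have [measurable]: "truncated_gate P p (Suc k) \<in> borel_measurable (source_algebra P J)"
      using less.prems Suc past_sources_mono[of p p k m P] by (intro less.IH) auto
    have [measurable]: "truncated_gate P p k \<in> borel_measurable (source_algebra P J)"
    proof (cases k)
      case (Suc k')
      then show ?thesis
        using less.prems \<open>m = Suc k\<close> past_sources_mono[of p p k' m P]
        by (simp only:) (intro less.IH, auto)
    qed (simp add: truncated_gate_0)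
    have [measurable]: "epoch P (Suc n) \<in> borel_measurable (source_algebra P J)" if "n < p" for n
      using less.prems that by (intro measurable_epoch_source) (auto simp: past_sources_def)
    define D where "D n x \<longleftrightarrow> n < p \<and> truncated_gate P p k x < epoch P (Suc n) x
        \<and> epoch P (Suc n) x \<le> truncated_gate P p (Suc k) x" for n x
    have D: "Measurable.pred (source_algebra P J) (D n)" for n
      unfolding D_def[abs_def] by (cases "n < p") simp_all
    then have D': "{x \<in> space (source_algebra P J). D n x} \<in> sets (source_algebra P J)" for n
      unfolding pred_def by blast
    have bw: "batch_work P n i \<in> borel_measurable (source_algebra P J)"
      if "n < p" "i \<in> {1..nq P}" for n i
      using less.prems that
      by (intro measurable_batch_work_source) (auto simp: past_sources_def batch_sources_def)
    have "(\<lambda>x. \<Sum>n\<in>{n\<in>{..<p}. truncated_gate P p k x < epoch P (Suc n) x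
        \<and> epoch P (Suc n) x \<le> truncated_gate P p (Suc k) x}. batch_work P n i x)
        \<in> borel_measurable (source_algebra P J)" (is "?f \<in> _") if "i \<in> {1..nq P}" for i
    proof -
      have "?f = (\<lambda>x. \<Sum>n<p. if D n x then batch_work P n i x else 0)"
        by (auto simp: D_def sum.If_cases intro!: ext sum.cong)
      also have "\<dots> \<in> borel_measurable (source_algebra P J)"
        using D' bw that by (intro borel_measurable_sum measurable_If) auto
      finally show ?thesis .
    qed
    with sw Suc show ?thesis
      by (simp add: borel_measurable_sum borel_measurable_add)
  qed
qed

lemma measurable_truncated_gate_source':
  "past_sources P p m \<subseteq> J \<Longrightarrow> truncated_gate P p m \<in> borel_measurable (source_algebra P J)"
  using measurable_truncated_gate_source[of P p "m - 1" J] past_sources_mono[of p p "m - 1" m P]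
  by (cases m) (auto simp: truncated_gate_0)

lemma past_sources_subset: "past_sources P p m \<subseteq> sources (nq P)"
  by (auto simp: past_sources_def sources_def)

lemma batch_sources_subset: "batch_sources P n \<subseteq> sources (nq P)"
  by (auto simp: batch_sources_def sources_def)

lemma measurable_gate_source:
  "gate P m \<in> borel_measurable (source_algebra P (sources (nq P)))"
proof (induction m rule: less_induct)
  case (less m)
  let ?A = "source_algebra P (sources (nq P))"
  have sw: "switchover P j i \<in> borel_measurable ?A" if "i \<in> {1..nq P}" for i j
    using that by (intro measurable_switchover_source) (auto simp: sources_def)
  consider "m = 0" | "m = Suc 0" | k where "m = Suc (Suc k)"
    by (metis not0_implies_Suc)
  then show ?case
  proof cases
    case 1
    then show ?thesis by (simp add: gate_0)
  next
    case 2
    have "init_work P i \<in> borel_measurable ?A" if "i \<in> {1..nq P}" for i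
      using that by (intro measurable_init_work_source) (auto simp: sources_def)
    with sw 2 show ?thesis
      by (simp add: borel_measurable_sum borel_measurable_add)
  next
    case (3 k)
    have [measurable]: "gate P (Suc k) \<in> borel_measurable ?A" "gate P k \<in> borel_measurable ?A"
      using 3 by (auto intro!: less.IH)
    have [measurable]: "arrival_epoch P n \<in> borel_measurable ?A" for n
      unfolding arrival_epoch_eq[abs_def] by (rule measurable_epoch_source) (auto simp: sources_def)
    have "(\<lambda>x. \<Sum>n\<in>batches_in P (gate P k x) (gate P (Suc k) x) x. batch_work P n i x)
        \<in> borel_measurable ?A" if "i \<in> {1..nq P}" for i
      using that batch_sources_subset
      by (intro borel_measurable_random_sum measurable_batch_work_source)
         (auto simp: batches_in_def)
    with sw 3 show ?thesis
      by (simp add: borel_measurable_sum borel_measurable_add)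
  qed
qed

section \<open>Independence of disjoint sets of primitive variables\<close>

context stationary_globally_gated
begin

abbreviation M where "M \<equiv> prob_sp P"

lemma source_algebra_subset:
  assumes "J \<subseteq> sources (nq P)"
  shows "sets (source_algebra P J) \<subseteq> events"
proof -
  have "source_events P s \<subseteq> events" if "s \<in> J" for s
    using independent that assms by (auto simp: indep_sets_def)
  then show ?thesis
    unfolding sets_source_algebra by (intro sets.sigma_sets_subset) blast
qed

lemma measurable_source_algebra_imp:
  assumes "J \<subseteq> sources (nq P)" "f \<in> measurable (source_algebra P J) A"
  shows "f \<in> measurable M A"
  using source_algebra_subset[OF assms(1)] assms(2) by (auto simp: measurable_def)

text \<open>
  The identity map, read as a random variable with values in the space equipped with a smaller sigma-algebra,
  represents a whole group of variables; independence of groups becomes independence of random variables without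
  any product space.
\<close>

lemma indep_source_algebras:
  assumes "\<And>j. j \<in> I \<Longrightarrow> J j \<subseteq> sources (nq P)" and "disjoint_family_on J I"
  shows "indep_vars (\<lambda>j. source_algebra P (J j)) (\<lambda>_ x. x) I"
proof -
  have ind: "indep_sets (\<lambda>j. sigma_sets (space M) (\<Union>s\<in>J j. source_events P s)) I"
    using assms independent Int_stable_source_events
    by (intro indep_sets_collect_sigma) (auto intro: indep_sets_mono_index)
  have "{(\<lambda>x. x) -` A \<inter> space M |A. A \<in> sets (source_algebra P (J j))}
      = sigma_sets (space M) (\<Union>s\<in>J j. source_events P s)" if "j \<in> I" for j
  proof -
    have "A \<inter> space M = A" if "A \<in> sets (source_algebra P (J j))" for A
      using sets.sets_into_space[OF that] by auto
    then have "{(\<lambda>x. x) -` A \<inter> space M |A. A \<in> sets (source_algebra P (J j))}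
        = sets (source_algebra P (J j))"
      unfolding vimage_ident by (smt (verit) Collect_cong Collect_mem_eq)
    then show ?thesis
      by (simp only: sets_source_algebra)
  qed
  then have "indep_sets (\<lambda>j. {(\<lambda>x. x) -` A \<inter> space M |A. A \<in> sets (source_algebra P (J j))}) I"
    using ind by (simp cong: indep_sets_cong)
  then show ?thesis
    unfolding indep_vars_def2
    using assms(1) by (auto intro!: measurable_source_algebra_imp[OF assms(1)])
qed

lemma indep_vars_of_sources:
  assumes "\<And>j. j \<in> I \<Longrightarrow> J j \<subseteq> sources (nq P)" and "disjoint_family_on J I"
    and "\<And>j. j \<in> I \<Longrightarrow> Y j \<in> measurable (source_algebra P (J j)) (N j)"
  shows "indep_vars N Y I"
  using indep_vars_compose2[OF indep_source_algebras[OF assms(1,2)] assms(3)] by simp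

text \<open>
  Fubini's theorem on the original probability space: the law of \<open>(x, x)\<close> on the product of two
  independent sigma-algebras is the product measure, so that variables of one group can be frozen while those of
  the other group are averaged.
\<close>

lemma integral_indep_sources:
  fixes f :: "'a \<Rightarrow> 'a \<Rightarrow> 'b::{banach, second_countable_topology}"
  assumes J: "J1 \<subseteq> sources (nq P)" "J2 \<subseteq> sources (nq P)" "J1 \<inter> J2 = {}"
    and f [measurable]: "case_prod f \<in> borel_measurable (source_algebra P J1 \<Otimes>\<^sub>M source_algebra P J2)"
    and bound: "\<And>x y. norm (f x y) \<le> b"
  shows "(\<integral>x. f x x \<partial>M) = (\<integral>x. (\<integral>y. f x y \<partial>M) \<partial>M)"
    and "(\<lambda>x. \<integral>y. f x y \<partial>M) \<in> borel_measurable (source_algebra P J1)"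
proof -
  let ?A = "source_algebra P J1" and ?B = "source_algebra P J2"
  have id [measurable]: "(\<lambda>x. x) \<in> measurable M ?A" "(\<lambda>x. x) \<in> measurable M ?B"
    using J by (auto intro: measurable_source_algebra_imp)
  let ?J = "case_bool J1 J2"
  have "indep_vars (\<lambda>j. source_algebra P (?J j)) (\<lambda>_ x. x) UNIV"
    using J by (intro indep_source_algebras) (auto simp: disjoint_family_on_def split: bool.splits)
  then have "indep_var ?A (\<lambda>x. x) ?B (\<lambda>x. x)"
    unfolding indep_var_def
    by (rule indep_vars_cong[THEN iffD1, rotated -1]) (auto split: bool.splits)
  then have eq: "distr M ?A (\<lambda>x. x) \<Otimes>\<^sub>M distr M ?B (\<lambda>x. x) = distr M (?A \<Otimes>\<^sub>M ?B) (\<lambda>x. (x, x))"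
    by (simp add: indep_var_distribution_eq)
  interpret A: prob_space "distr M ?A (\<lambda>x. x)" by (rule prob_space_distr) simp
  interpret B: prob_space "distr M ?B (\<lambda>x. x)" by (rule prob_space_distr) simp
  interpret AB: pair_prob_space "distr M ?A (\<lambda>x. x)" "distr M ?B (\<lambda>x. x)" ..
  have int: "integrable (distr M ?A (\<lambda>x. x) \<Otimes>\<^sub>M distr M ?B (\<lambda>x. x)) (case_prod f)"
    by (rule AB.integrable_const_bound[where B = b]) (auto simp: bound)
  have inner: "(\<integral>y. f x y \<partial>distr M ?B (\<lambda>x. x)) = (\<integral>y. f x y \<partial>M)" if "x \<in> space ?A" for x
  proof -
    have "f x \<in> borel_measurable ?B"
      using measurable_Pair2[OF f that] by simp
    then show ?thesis
      by (subst integral_distr) simp_all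
  qed
  have outer: "(\<lambda>x. \<integral>y. f x y \<partial>distr M ?B (\<lambda>x. x)) \<in> borel_measurable ?A"
    by (rule B.borel_measurable_lebesgue_integral) simp
  have "(\<integral>x. f x x \<partial>M) = (\<integral>z. case_prod f z \<partial>distr M (?A \<Otimes>\<^sub>M ?B) (\<lambda>x. (x, x)))"
    by (subst integral_distr) simp_all
  also have "\<dots> = (\<integral>x. (\<integral>y. f x y \<partial>distr M ?B (\<lambda>x. x)) \<partial>distr M ?A (\<lambda>x. x))"
    unfolding eq[symmetric] by (rule AB.integral_fst'[OF int, symmetric, unfolded split_conv])
  also have "\<dots> = (\<integral>x. (\<integral>y. f x y \<partial>distr M ?B (\<lambda>x. x)) \<partial>M)"
    using outer by (subst integral_distr) auto
  also have "\<dots> = (\<integral>x. (\<integral>y. f x y \<partial>M) \<partial>M)"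
    by (intro Bochner_Integration.integral_cong refl inner) simp
  finally show "(\<integral>x. f x x \<partial>M) = (\<integral>x. (\<integral>y. f x y \<partial>M) \<partial>M)" .
  show "(\<lambda>x. \<integral>y. f x y \<partial>M) \<in> borel_measurable ?A"
    using outer inner measurable_cong by (metis (no_types, lifting))
qed

end

section \<open>Sample paths\<close>

text \<open>
  The properties of a sample path that hold almost surely and under which the dynamics behave as intended:
  finitely many arrivals in bounded time, nonnegative durations, possible batch sizes.
\<close>

definition regular_path :: "'a polling \<Rightarrow> 'a \<Rightarrow> bool" where
  "regular_path P x \<longleftrightarrow> (\<forall>n. 0 < interarrival P n x) \<and> (\<forall>t. \<exists>p. t < epoch P p x)
     \<and> (\<forall>i\<in>{1..nq P}. (\<forall>m. 0 \<le> switchover P m i x) \<and> (\<forall>c. 0 \<le> init_service P i c x)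
          \<and> (\<forall>n c. 0 \<le> service P n i c x))
     \<and> (\<forall>n. batch_size P n x \<in> set_pmf (batch_pmf P))"

text \<open>
  Exactly \<open>p\<close> batches arrive up to the start of cycle \<open>m\<close>, and \<open>r\<close> further
  ones during cycle \<open>m\<close>. The truncated cycle starts make this event a function of the interarrival
  times and of the first \<open>p\<close> batches only.
\<close>

definition window :: "'a polling \<Rightarrow> nat \<Rightarrow> nat \<Rightarrow> nat \<Rightarrow> 'a \<Rightarrow> bool" where
  "window P m p r x \<longleftrightarrow>
     epoch P p x \<le> truncated_gate P p m x \<and> truncated_gate P p m x < epoch P (Suc p) x \<and>
     epoch P (p + r) x \<le> truncated_gate P p (Suc m) x \<and>
     truncated_gate P p (Suc m) x < epoch P (Suc (p + r)) x"

lemma gated_work_0: "gated_work P 0 i x = init_work P i x"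
  by (simp add: gated_work_def)

lemma gated_work_Suc: "gated_work P (Suc m) i x = (\<Sum>n\<in>arrivals P m x. batch_work P n i x)"
  by (simp add: gated_work_def)

context
  fixes P :: "'a polling" and x :: 'a
  assumes regular: "regular_path P x"
begin

lemma epoch_less: "p < q \<Longrightarrow> epoch P p x < epoch P q x"
  by (rule lift_Suc_mono_less[of "\<lambda>p. epoch P p x"]) (use regular in \<open>auto simp: regular_path_def epoch_Suc\<close>)

lemma epoch_le_iff: "epoch P p x \<le> epoch P q x \<longleftrightarrow> p \<le> q"
  by (metis epoch_less le_less linorder_not_less)

lemma finite_batches_in: "finite (batches_in P s t x)"
proof -
  obtain p where p: "t < epoch P p x"
    using regular unfolding regular_path_def by blast
  have "batches_in P s t x \<subseteq> {..<p}"
  proof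
    fix n assume "n \<in> batches_in P s t x"
    then have "\<not> epoch P p x \<le> epoch P (Suc n) x"
      using p by (simp add: batches_in_def arrival_epoch_eq)
    then show "n \<in> {..<p}"
      by (simp add: epoch_le_iff)
  qed
  then show ?thesis
    using finite_subset by blast
qed

lemma switchover_nonneg: "i \<in> {1..nq P} \<Longrightarrow> 0 \<le> switchover P m i x"
  using regular by (auto simp: regular_path_def)

lemma service_nonneg: "i \<in> {1..nq P} \<Longrightarrow> 0 \<le> service P n i c x"
  using regular by (auto simp: regular_path_def)

lemma batch_work_nonneg: "i \<in> {1..nq P} \<Longrightarrow> 0 \<le> batch_work P n i x"
  using service_nonneg by (auto simp: batch_work_def intro!: sum_nonneg)

lemma init_work_nonneg: "i \<in> {1..nq P} \<Longrightarrow> 0 \<le> init_work P i x"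
  using regular by (auto simp: init_work_def regular_path_def intro!: sum_nonneg)

lemma gated_work_nonneg: "i \<in> {1..nq P} \<Longrightarrow> 0 \<le> gated_work P m i x"
  by (cases m) (auto simp: gated_work_0 gated_work_Suc init_work_nonneg batch_work_nonneg intro!: sum_nonneg)

lemma cycle_length_nonneg: "0 \<le> cycle_length P m x"
  unfolding cycle_length_eq
  by (intro sum_nonneg add_nonneg_nonneg gated_work_nonneg switchover_nonneg)

lemma gate_mono: "m \<le> m' \<Longrightarrow> gate P m x \<le> gate P m' x"
  by (rule lift_Suc_mono_le[of "\<lambda>m. gate P m x"])
    (use cycle_length_nonneg in \<open>auto simp: cycle_length_def\<close>)

lemma truncated_gate_mono: "m \<le> m' \<Longrightarrow> truncated_gate P p m x \<le> truncated_gate P p m' x"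
proof (rule lift_Suc_mono_le[of "\<lambda>m. truncated_gate P p m x"])
  show "truncated_gate P p m x \<le> truncated_gate P p (Suc m) x" for m
    by (cases m) (simp_all only: truncated_gate.simps le_add_same_cancel1,
      (intro sum_nonneg add_nonneg_nonneg init_work_nonneg batch_work_nonneg switchover_nonneg; assumption)+)
qed

text \<open>
  A cycle start depends on the batches that arrived before the preceding cycle start. If batch \<open>p\<close>
  arrives after the start of cycle \<open>m\<close>, then leaving it and its successors out has no effect on the
  start of cycle \<open>m + 1\<close>. It may be checked in either of the two systems that batch \<open>p\<close>
  is late enough, because both of them have the same cycle starts up to that point.
\<close>

lemma truncated_gate_eq:
  assumes "gate P m x < epoch P (Suc p) x \<or> truncated_gate P p m x < epoch P (Suc p) x"
  shows "j \<le> Suc m \<Longrightarrow> truncated_gate P p j x = gate P j x"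
proof (induction j rule: less_induct)
  case (less j)
  consider "j = 0" | "j = Suc 0" | k where "j = Suc (Suc k)"
    by (metis not0_implies_Suc)
  then show ?case
  proof cases
    case (3 k)
    then have eq: "truncated_gate P p k x = gate P k x"
        "truncated_gate P p (Suc k) x = gate P (Suc k) x" and k: "Suc k \<le> m"
      using less by auto
    have lt: "gate P (Suc k) x < epoch P (Suc p) x"
      using assms gate_mono[OF k] truncated_gate_mono[OF k, of p] eq by linarith
    have "n < p" if "epoch P (Suc n) x \<le> gate P (Suc k) x" for n
      using epoch_le_iff[of "Suc p" "Suc n"] lt that by linarith
    then have "{n \<in> {..<p}. truncated_gate P p k x < epoch P (Suc n) x \<and>
        epoch P (Suc n) x \<le> truncated_gate P p (Suc k) x} = batches_in P (gate P k x) (gate P (Suc k) x) x"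
      by (auto simp: eq batches_in_def arrival_epoch_eq)
    then show ?thesis
      unfolding 3 by (simp only: truncated_gate.simps gate.simps eq(2))
  qed simp_all
qed

lemma window_iff:
  "window P m p r x \<longleftrightarrow> epoch P p x \<le> gate P m x \<and> gate P m x < epoch P (Suc p) x \<and>
     epoch P (p + r) x \<le> gate P (Suc m) x \<and> gate P (Suc m) x < epoch P (Suc (p + r)) x"
  unfolding window_def using truncated_gate_eq[of m p] by (metis le_SucI order_refl)

lemma truncated_gate_window:
  assumes "window P m p r x"
  shows "truncated_gate P p m x = gate P m x" "truncated_gate P p (Suc m) x = gate P (Suc m) x"
  using truncated_gate_eq[of m p] assms unfolding window_def by auto

lemma ex_epoch_interval:
  assumes "0 \<le> t"
  shows "\<exists>p. epoch P p x \<le> t \<and> t < epoch P (Suc p) x"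
proof -
  have ex: "\<exists>p. t < epoch P p x"
    using regular by (auto simp: regular_path_def)
  define q where "q = (LEAST p. t < epoch P p x)"
  have q: "t < epoch P q x" "\<And>p. p < q \<Longrightarrow> epoch P p x \<le> t"
    using LeastI_ex[OF ex] not_less_Least[of _ "\<lambda>p. t < epoch P p x"]
    unfolding q_def by (simp_all add: linorder_not_less)
  from q(1) assms have "q \<noteq> 0"
    by (metis epoch_0 linorder_not_less)
  then show ?thesis
    using q by (metis lessI not0_implies_Suc)
qed

lemma epoch_interval_unique:
  assumes "epoch P p x \<le> t" "t < epoch P (Suc p) x" "epoch P q x \<le> t" "t < epoch P (Suc q) x"
  shows "p = q"
  using assms epoch_le_iff[of "Suc p" q] epoch_le_iff[of "Suc q" p] by linarith

lemma ex_window: "\<exists>p r. window P m p r x"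
proof -
  obtain p where p: "epoch P p x \<le> gate P m x" "gate P m x < epoch P (Suc p) x"
    using ex_epoch_interval[of "gate P m x"] gate_mono[of 0 m] by auto
  obtain q where q: "epoch P q x \<le> gate P (Suc m) x" "gate P (Suc m) x < epoch P (Suc q) x"
    using ex_epoch_interval[of "gate P (Suc m) x"] gate_mono[of 0 "Suc m"] by auto
  have "p \<le> q"
    using p q gate_mono[of m "Suc m"] epoch_le_iff[of "Suc q" p] by linarith
  then obtain r where "q = p + r"
    using le_Suc_ex by blast
  with p q show ?thesis
    unfolding window_iff by blast
qed

lemma window_unique:
  assumes "window P m p r x" "window P m p' r' x"
  shows "p = p'" "r = r'"
  using assms epoch_interval_unique[of p "gate P m x" p']
    epoch_interval_unique[of "p + r" "gate P (Suc m) x" "p' + r'"] unfolding window_iff by auto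

lemma epoch_le_iff_number:
  assumes "epoch P p x \<le> t" "t < epoch P (Suc p) x"
  shows "epoch P (Suc n) x \<le> t \<longleftrightarrow> n < p"
proof (cases "n < p")
  case True
  then have "epoch P (Suc n) x \<le> epoch P p x"
    by (simp add: epoch_le_iff)
  with assms True show ?thesis
    by simp
next
  case False
  then have "epoch P (Suc p) x \<le> epoch P (Suc n) x"
    by (simp add: epoch_le_iff)
  with assms False show ?thesis
    by simp
qed

lemma arrivals_window:
  assumes "window P m p r x"
  shows "arrivals P m x = {p..<p+r}"
proof -
  have "n \<in> arrivals P m x \<longleftrightarrow> \<not> n < p \<and> n < p + r" for n
  proof -
    have w: "epoch P p x \<le> gate P m x" "gate P m x < epoch P (Suc p) x"
      "epoch P (p + r) x \<le> gate P (Suc m) x" "gate P (Suc m) x < epoch P (Suc (p + r)) x"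
      using assms by (simp_all only: window_iff)
    have "n \<in> arrivals P m x \<longleftrightarrow> \<not> epoch P (Suc n) x \<le> gate P m x \<and> epoch P (Suc n) x \<le> gate P (Suc m) x"
      by (simp only: arrivals_def batches_in_def arrival_epoch_eq mem_Collect_eq not_le)
    then show ?thesis
      by (simp only: epoch_le_iff_number[OF w(1,2)] epoch_le_iff_number[OF w(3,4)])
  qed
  then show ?thesis
    by (simp add: set_eq_iff not_less)
qed

lemma next_cycle_length_window:
  assumes "window P m p r x"
  shows "cycle_length P (Suc m) x =
    (\<Sum>n=p..<p+r. \<Sum>i=1..nq P. batch_work P n i x) + (\<Sum>i=1..nq P. switchover P (Suc m) i x)"
  unfolding cycle_length_eq gated_work_Suc arrivals_window[OF assms]
  unfolding sum.distrib by (simp only: sum.swap[of _ "{p..<p+r}" "{1..nq P}"])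

lemma visit_start_mono:
  assumes "i' < i" "i \<le> nq P" "1 \<le> i'"
  shows "visit_start P m i' x + gated_work P m i' x \<le> visit_start P m i x"
proof -
  have "(\<Sum>l\<in>{1..<i'}. gated_work P m l x + switchover P m l x) + gated_work P m i' x
      \<le> (\<Sum>l\<in>insert i' {1..<i'}. gated_work P m l x + switchover P m l x)"
    using switchover_nonneg[of i' m] assms by (simp add: add.commute)
  also have "\<dots> \<le> (\<Sum>l\<in>{1..<i}. gated_work P m l x + switchover P m l x)"
    using assms gated_work_nonneg switchover_nonneg by (intro sum_mono2) auto
  finally show ?thesis
    by (simp add: visit_start_def)
qed

text \<open>
  The queues are visited in increasing order, and every customer of the batch is served during the gated work of
  its queue, hence before the visit to the next queue begins. So the maximum is attained by the last customer of
  the batch in the last queue that the batch joins.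
\<close>

lemma sojourn_last_queue:
  assumes n: "n \<in> arrivals P m x" and i: "i \<in> {1..nq P}" "0 < batch_size P n x i"
    and last: "\<And>l. l \<in> {i<..nq P} \<Longrightarrow> batch_size P n x l = 0"
  shows "sojourn P m n x = visit_start P (Suc m) i x
    + (\<Sum>n'\<in>{n'\<in>arrivals P m x. n' < n}. batch_work P n' i x) + batch_work P n i x - arrival_epoch P n x"
proof -
  let ?K = "batch_size P n x"
  let ?S = "{completion P m n i c x | i c. i \<in> {1..nq P} \<and> c < ?K i}"
  let ?before = "\<lambda>l. \<Sum>n'\<in>{n'\<in>arrivals P m x. n' < n}. batch_work P n' l x"
  let ?last = "visit_start P (Suc m) i x + ?before i + batch_work P n i x"
  have fin: "finite (arrivals P m x)"
    unfolding arrivals_def by (rule finite_batches_in)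
  have finS: "finite ?S"
  proof -
    have "?S = (\<lambda>(i, c). completion P m n i c x) ` (SIGMA i:{1..nq P}. {..<?K i})"
      by (auto simp: image_iff) blast
    then show ?thesis
      by simp
  qed
  have eq: "completion P m n i (?K i - 1) x = ?last"
    using i by (simp add: completion_def batch_work_def lessThan_Suc_atMost[symmetric])
  have own: "completion P m n l c x \<le> visit_start P (Suc m) l x + ?before l + batch_work P n l x"
    if "l \<in> {1..nq P}" "c < ?K l" for l c
    using that service_nonneg[of l]
    by (auto simp: completion_def batch_work_def intro!: sum_mono2)
  have "completion P m n l c x \<le> ?last" if l: "l \<in> {1..nq P}" "c < ?K l" for l c
  proof -
    have "l \<le> i"
      using last[of l] l by (cases "l \<le> i") auto
    show ?thesis
    proof (cases "l = i")
      case True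
      then show ?thesis
        using own[OF l] by simp
    next
      case False
      with \<open>l \<le> i\<close> have "l < i"
        by simp
      have "?before l + batch_work P n l x = (\<Sum>n'\<in>insert n {n'\<in>arrivals P m x. n' < n}. batch_work P n' l x)"
        using fin by simp
      also have "\<dots> \<le> gated_work P (Suc m) l x"
        unfolding gated_work_Suc using fin n l batch_work_nonneg by (intro sum_mono2) auto
      finally have "completion P m n l c x \<le> visit_start P (Suc m) i x"
        using own[OF l] visit_start_mono[of l i "Suc m"] \<open>l < i\<close> i l by simp
      also have "0 \<le> ?before i" "0 \<le> batch_work P n i x"
        using batch_work_nonneg[OF i(1)] by (auto intro!: sum_nonneg)
      ultimately show ?thesis
        by linarith
    qed
  qed
  moreover have "?last \<in> ?S"
    unfolding eq[symmetric] mem_Collect_eq using i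
    by (intro exI[of _ i] exI[of _ "?K i - 1"]) simp
  ultimately have "Max ?S = ?last"
    using finS by (intro Max_eqI) auto
  then show ?thesis
    unfolding sojourn_def by simp
qed

text \<open>
  Batches that arrive in the same cycle delay the batch in different ways: the earlier ones are served before it
  in all queues up to \<open>i\<close>, the later ones only in the queues that are visited before queue
  \<open>i\<close>.
\<close>

lemma sojourn_window:
  assumes w: "window P m p (a + Suc b) x" and i: "i \<in> {1..nq P}" "0 < batch_size P (p + a) x i"
    and last: "\<And>l. l \<in> {i<..nq P} \<Longrightarrow> batch_size P (p + a) x l = 0"
  shows "sojourn P m (p + a) x = truncated_gate P p (Suc m) x - epoch P (Suc (p + a)) x
    + (\<Sum>n=p..<p+a. \<Sum>l=1..i. batch_work P n l x)
    + (\<Sum>l=1..i. batch_work P (p + a) l x)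
    + (\<Sum>n=Suc (p+a)..<Suc (p+a)+b. \<Sum>l=1..i-1. batch_work P n l x)
    + (\<Sum>l=1..i-1. switchover P (Suc m) l x)"
proof -
  have arr: "arrivals P m x = {p..<p + (a + Suc b)}"
    by (rule arrivals_window[OF w])
  then have n: "p + a \<in> arrivals P m x"
    by simp
  have before: "{n'\<in>arrivals P m x. n' < p + a} = {p..<p+a}"
    unfolding arr by auto
  have split: "(\<Sum>n\<in>arrivals P m x. f n) = (\<Sum>n=p..<p+a. f n) + f (p + a)
      + (\<Sum>n=Suc (p+a)..<Suc (p+a)+b. f n)" for f :: "nat \<Rightarrow> real"
  proof -
    have "arrivals P m x = {p..<p+a} \<union> ({p+a} \<union> {Suc (p+a)..<Suc (p+a)+b})"
      unfolding arr by auto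
    then show ?thesis
      by (simp only:) (subst sum.union_disjoint; simp)+
  qed
  obtain j where j: "i = Suc j"
    using i by (cases i) auto
  have intv: "{1..<i} = {1..j}" "{1..i-1} = {1..j}"
    using j by auto
  have swap: "(\<Sum>l=1..j. \<Sum>n\<in>A. f n l) = (\<Sum>n\<in>A. \<Sum>l=1..j. f n l)" for A and f :: "nat \<Rightarrow> nat \<Rightarrow> real"
    by (rule sum.swap)
  have last_term: "(\<Sum>l=1..i. f l) = (\<Sum>l=1..j. f l) + f i" for f :: "nat \<Rightarrow> real"
    by (simp add: j)
  have "sojourn P m (p + a) x = visit_start P (Suc m) i x
    + (\<Sum>n'\<in>{n'\<in>arrivals P m x. n' < p + a}. batch_work P n' i x) + batch_work P (p + a) i x
    - arrival_epoch P (p + a) x"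
    by (rule sojourn_last_queue[OF n i]) (rule last)
  then show ?thesis
    unfolding before visit_start_def truncated_gate_window[OF w]
      gated_work_Suc arrival_epoch_eq split intv last_term sum.distrib swap
    by linarith
qed

end

section \<open>Almost every sample path is regular\<close>

context stationary_globally_gated
begin

lemma rv_interarrival [measurable]: "interarrival P n \<in> borel_measurable M"
  by (rule measurable_source_algebra_imp[OF order_refl measurable_interarrival_source])
    (simp add: sources_def)

lemma rv_epoch [measurable]: "epoch P p \<in> borel_measurable M"
  unfolding epoch_def[abs_def] by simp

lemma rv_batch_size [measurable]: "batch_size P n \<in> measurable M (count_space UNIV)"
  by (rule measurable_source_algebra_imp[OF order_refl measurable_batch_size_source])
    (simp add: sources_def)

lemma rv_init_content [measurable]: "init_content P \<in> measurable M (count_space UNIV)"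
  by (rule measurable_source_algebra_imp[OF order_refl measurable_init_content_source])
    (simp add: sources_def)

lemma rv_service: "i \<in> {1..nq P} \<Longrightarrow> service P n i c \<in> borel_measurable M"
  by (rule measurable_source_algebra_imp[OF order_refl measurable_service_source])
    (simp add: sources_def)

lemma rv_init_service: "i \<in> {1..nq P} \<Longrightarrow> init_service P i c \<in> borel_measurable M"
  by (rule measurable_source_algebra_imp[OF order_refl measurable_init_service_source])
    (simp add: sources_def)

lemma rv_switchover: "i \<in> {1..nq P} \<Longrightarrow> switchover P m i \<in> borel_measurable M"
  by (rule measurable_source_algebra_imp[OF order_refl measurable_switchover_source])
    (simp add: sources_def)

lemma rv_gate [measurable]: "gate P m \<in> borel_measurable M"
  by (rule measurable_source_algebra_imp[OF order_refl measurable_gate_source])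

lemma rv_cycle_length [measurable]: "cycle_length P m \<in> borel_measurable M"
  unfolding cycle_length_def[abs_def] by simp

lemma rv_truncated_gate [measurable]: "truncated_gate P p m \<in> borel_measurable M"
  using measurable_truncated_gate_source'[OF past_sources_subset]
  by (rule measurable_source_algebra_imp[OF order_refl])

lemma indep_interarrivals: "indep_vars (\<lambda>_. borel) (interarrival P) I"
  by (rule indep_vars_of_sources[where J = "\<lambda>n. {Interarrival n}"])
    (auto simp: sources_def disjoint_family_on_def intro: measurable_interarrival_source)

lemma interarrival_sum_erlang:
  "distributed M lborel (\<lambda>x. \<Sum>j=p..<p + Suc k. interarrival P j x) (erlang_density k (rate P))"
  using exponential_distributed_sum[of "{p..<p + Suc k}" "rate P" "interarrival P"]
    interarrival_distr rate_pos indep_interarrivals by simp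

lemma erlang_CDF_tendsto_0:
  assumes "0 < l"
  shows "(\<lambda>k. erlang_CDF k l t) \<longlonglongrightarrow> 0"
proof (cases "t < 0")
  case False
  have "(\<lambda>n. (l * t) ^ n / fact n) sums exp (l * t)"
    using exp_converges[of "l * t"] by (simp add: divide_inverse mult.commute)
  then have "(\<lambda>n. (l * t) ^ n / fact n * exp (- l * t)) sums (exp (l * t) * exp (- l * t))"
    by (rule sums_mult2)
  then have "(\<lambda>k. \<Sum>n\<le>k. (l * t) ^ n / fact n * exp (- l * t)) \<longlonglongrightarrow> 1"
    by (simp add: sums_def_le exp_minus)
  then have "(\<lambda>k. 1 - (\<Sum>n\<le>k. (l * t) ^ n * exp (- l * t) / fact n)) \<longlonglongrightarrow> 1 - 1"
    by (intro tendsto_diff tendsto_const) simp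
  with False show ?thesis
    by (simp add: erlang_CDF_def)
qed (simp add: erlang_CDF_def)

text \<open>
  The epochs have Erlang distributions, whose distribution functions at a fixed point tend to 0 with the number of
  phases.
\<close>

lemma AE_epochs_unbounded: "AE x in M. \<forall>t. \<exists>p. t < epoch P p x"
proof -
  have "AE x in M. \<exists>p. t < epoch P p x" for t :: real
  proof -
    let ?A = "{x \<in> space M. \<forall>p. epoch P p x \<le> t}"
    have "prob ?A \<le> erlang_CDF k (rate P) t" for k
    proof -
      have "prob ?A \<le> \<P>(x in M. (\<Sum>j=0..<0 + Suc k. interarrival P j x) \<le> t)"
        by (intro finite_measure_mono) (auto simp: epoch_def[symmetric] atLeast0LessThan simp del: sum.lessThan_Suc)
      also have "\<dots> = erlang_CDF k (rate P) t"
      proof (cases "0 \<le> t")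
        case True
        then show ?thesis
          using interarrival_sum_erlang[of 0 k] rate_pos by (intro erlang_distributed_le)
      next
        case False
        have "\<P>(x in M. (\<Sum>j=0..<0 + Suc k. interarrival P j x) \<le> t)
            \<le> \<P>(x in M. (\<Sum>j=0..<0 + Suc k. interarrival P j x) \<le> 0)"
          using False by (intro finite_measure_mono) auto
        also have "\<dots> = 0"
          using erlang_distributed_le[OF interarrival_sum_erlang[of 0 k] rate_pos order_refl]
          by (simp add: erlang_CDF_at0)
        finally show ?thesis
          using False by (simp add: erlang_CDF_def measure_le_0_iff)
      qed
      finally show ?thesis .
    qed
    then have "prob ?A \<le> 0"
      by (intro LIMSEQ_le_const[OF erlang_CDF_tendsto_0[OF rate_pos]]) auto
    then have "prob ?A = 0"
      by (simp add: measure_le_0_iff)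
    then have "AE x in M. \<not> (\<forall>p. epoch P p x \<le> t)"
      by (subst (asm) prob_eq_0) (auto simp: not_le)
    then show ?thesis
      by (simp add: not_le)
  qed
  then have "AE x in M. \<forall>k::nat. \<exists>p. real k < epoch P p x"
    by (simp add: AE_all_countable)
  then show ?thesis
    by eventually_elim (meson less_trans reals_Archimedean2)
qed

lemma AE_distr_nonneg:
  assumes "f \<in> borel_measurable M" "distr M borel f = \<mu>" "nonneg_law \<mu>"
  shows "AE x in M. 0 \<le> f x"
  using assms AE_distrD[of f M borel "\<lambda>t. 0 \<le> t"] unfolding nonneg_law_def by auto

lemma AE_regular: "AE x in M. regular_path P x"
proof -
  have 1: "AE x in M. 0 < interarrival P n x" for n
    using exponential_distributedD_gt[OF interarrival_distr order_refl rate_pos, of n]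
      AE_prob_1[of "{x \<in> space M. 0 < interarrival P n x}"] by simp
  have 2: "AE x in M. batch_size P n x \<in> set_pmf (batch_pmf P)" for n
    using AE_distrD[OF rv_batch_size, where P = "\<lambda>k. k \<in> set_pmf (batch_pmf P)"]
    unfolding batch_size_distr by (simp add: AE_measure_pmf)
  have 3: "AE x in M. 0 \<le> switchover P m i x" "AE x in M. 0 \<le> init_service P i c x"
     "AE x in M. 0 \<le> service P n i c x" if "i \<in> {1..nq P}" for m i c n
    using AE_distr_nonneg[OF rv_switchover[OF that] switchover_distr[OF that] switch_law[OF that]]
      AE_distr_nonneg[OF rv_init_service[OF that] init_service_distr[OF that] service_law[OF that]]
      AE_distr_nonneg[OF rv_service[OF that] service_distr[OF that] service_law[OF that]]
    by auto
  show ?thesis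
    unfolding regular_path_def
    using 1 2 3 AE_epochs_unbounded
    by (auto simp: AE_all_countable AE_ball_countable intro!: AE_conjI)
qed

end

section \<open>Sums over countable partitions\<close>

lemma integrable_count_space_has_sum:
  fixes f :: "'i \<Rightarrow> 'b::{banach, second_countable_topology}"
  assumes "integrable (count_space I) f"
  shows "(f has_sum (\<integral>i. f i \<partial>count_space I)) I"
proof -
  have abs: "Infinite_Set_Sum.abs_summable_on f I"
    using assms by (simp add: Infinite_Set_Sum.abs_summable_on_def)
  then have "f summable_on I"
    using abs_summable_equivalent abs_summable_summable by blast
  moreover have "(\<integral>i. f i \<partial>count_space I) = infsum f I"
    using infsetsum_infsum[OF abs] by (simp add: infsetsum_def)
  ultimately show ?thesis
    by (simp add: has_sum_infsum)
qed

text \<open>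
  Fubini's theorem for a sigma-finite measure and a counting measure, with the integral over the latter read as an
  unordered sum.
\<close>

lemma integral_has_sum:
  fixes f :: "'i \<Rightarrow> 'c \<Rightarrow> 'b::{banach, second_countable_topology}"
  assumes N: "sigma_finite_measure N" and I: "countable I"
    and meas: "\<And>i. i \<in> I \<Longrightarrow> f i \<in> borel_measurable N"
    and bound: "(\<integral>\<^sup>+x. (\<integral>\<^sup>+i. norm (f i x) \<partial>count_space I) \<partial>N) < \<infinity>"
  shows "((\<lambda>i. \<integral>x. f i x \<partial>N) has_sum (\<integral>x. (\<integral>i. f i x \<partial>count_space I) \<partial>N)) I"
proof -
  interpret N: sigma_finite_measure N by fact
  interpret C: sigma_finite_measure "count_space I"
    using I by (rule sigma_finite_measure_count_space_countable)
  interpret NC: pair_sigma_finite N "count_space I" ..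
  let ?f = "\<lambda>z. f (snd z) (fst z)"
  have [measurable]: "?f \<in> borel_measurable (N \<Otimes>\<^sub>M count_space I)"
    by (rule measurable_compose_countable'[where f = "\<lambda>i z. f i (fst z)" and g = snd and I = I])
      (use I meas in auto)
  have int: "integrable (N \<Otimes>\<^sub>M count_space I) ?f"
  proof (rule integrableI_bounded)
    have "(\<integral>\<^sup>+z. norm (?f z) \<partial>(N \<Otimes>\<^sub>M count_space I))
        = (\<integral>\<^sup>+x. (\<integral>\<^sup>+i. norm (f i x) \<partial>count_space I) \<partial>N)"
      by (subst C.nn_integral_fst[symmetric]) simp_all
    with bound show "(\<integral>\<^sup>+z. norm (?f z) \<partial>(N \<Otimes>\<^sub>M count_space I)) < \<infinity>"
      by simp
  qed simp
  then have int': "integrable (N \<Otimes>\<^sub>M count_space I) (\<lambda>(x, i). f i x)"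
    by (simp add: case_prod_unfold)
  show ?thesis
    using integrable_count_space_has_sum[OF NC.integrable_snd[OF int']]
    by (simp add: NC.Fubini_integral[OF int'])
qed

lemma nn_integral_count_space_single:
  assumes "j \<in> I" "\<And>i. i \<in> I \<Longrightarrow> i \<noteq> j \<Longrightarrow> f i = 0"
  shows "(\<integral>\<^sup>+i. f i \<partial>count_space I) = f j"
proof -
  have "(\<integral>\<^sup>+i. f i \<partial>count_space I) = (\<integral>\<^sup>+i. f i * indicator {j} i \<partial>count_space I)"
    using assms by (intro nn_integral_cong) (auto simp: indicator_def)
  then show ?thesis
    using assms(1) by simp
qed

lemma integral_count_space_single:
  fixes f :: "'i \<Rightarrow> 'b::{banach, second_countable_topology}"
  assumes "j \<in> I" "\<And>i. i \<in> I \<Longrightarrow> i \<noteq> j \<Longrightarrow> f i = 0"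
  shows "(\<integral>i. f i \<partial>count_space I) = f j"
proof -
  have "{a\<in>I. f a \<noteq> 0} \<subseteq> {j}"
    using assms(2) by blast
  moreover from this have "finite {a\<in>I. f a \<noteq> 0}"
    by (rule finite_subset) simp
  moreover have "(\<Sum>a | a \<in> I \<and> f a \<noteq> 0. f a) = (\<Sum>a\<in>{j}. f a)"
    using calculation(1) assms(1) by (intro sum.mono_neutral_left) auto
  ultimately show ?thesis
    by (simp add: lebesgue_integral_count_space_finite_support)
qed

text \<open>
  The sets have to be disjoint and to cover only where the integrand lives, and only up to a null set; this
  matters because distinct windows are disjoint on regular paths only.
\<close>

lemma integral_countable_partition:
  fixes F :: "'c \<Rightarrow> 'b::{banach, second_countable_topology}"
  assumes N: "sigma_finite_measure N" and I: "countable I" and F: "integrable N F"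
    and A: "\<And>i. i \<in> I \<Longrightarrow> A i \<in> sets N"
    and cover: "AE x in N. F x \<noteq> 0 \<longrightarrow> (\<exists>i\<in>I. x \<in> A i \<and> (\<forall>j\<in>I. x \<in> A j \<longrightarrow> j = i))"
  shows "((\<lambda>i. \<integral>x. indicator (A i) x *\<^sub>R F x \<partial>N) has_sum (\<integral>x. F x \<partial>N)) I"
proof -
  have single: "AE x in N. (\<integral>\<^sup>+i. norm (indicator (A i) x *\<^sub>R F x) \<partial>count_space I) = norm (F x)
      \<and> (\<integral>i. indicator (A i) x *\<^sub>R F x \<partial>count_space I) = F x"
    using cover
  proof eventually_elim
    case (elim x)
    show ?case
    proof (cases "F x = 0")
      case False
      with elim obtain i where i: "i \<in> I" "x \<in> A i" "\<And>j. j \<in> I \<Longrightarrow> x \<in> A j \<Longrightarrow> j = i"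
        by blast
      have 0: "indicator (A j) x *\<^sub>R F x = 0" if "j \<in> I" "j \<noteq> i" for j
      proof -
        have "x \<notin> A j"
          using that i(3) by blast
        then show ?thesis
          by simp
      qed
      have "(\<integral>\<^sup>+i. norm (indicator (A i) x *\<^sub>R F x) \<partial>count_space I) = norm (indicator (A i) x *\<^sub>R F x)"
        using i(1) by (rule nn_integral_count_space_single) (subst 0, assumption+, simp)
      moreover have "(\<integral>i. indicator (A i) x *\<^sub>R F x \<partial>count_space I) = indicator (A i) x *\<^sub>R F x"
        using i(1) 0 by (intro integral_count_space_single)
      ultimately show ?thesis
        using i(2) by simp
    qed simp
  qed
  have "((\<lambda>i. \<integral>x. indicator (A i) x *\<^sub>R F x \<partial>N) has_sum
      (\<integral>x. (\<integral>i. indicator (A i) x *\<^sub>R F x \<partial>count_space I) \<partial>N)) I"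
  proof (rule integral_has_sum[OF N I])
    show "(\<lambda>x. indicator (A i) x *\<^sub>R F x) \<in> borel_measurable N" if "i \<in> I" for i
      using A[OF that] F by (intro borel_measurable_scaleR) auto
    have "(\<integral>\<^sup>+x. (\<integral>\<^sup>+i. norm (indicator (A i) x *\<^sub>R F x) \<partial>count_space I) \<partial>N)
        = (\<integral>\<^sup>+x. norm (F x) \<partial>N)"
      using single by (intro nn_integral_cong_AE) auto
    also have "\<dots> < \<infinity>"
      using F by (simp add: integrable_iff_bounded)
    finally show "(\<integral>\<^sup>+x. (\<integral>\<^sup>+i. norm (indicator (A i) x *\<^sub>R F x) \<partial>count_space I) \<partial>N) < \<infinity>" .
  qed
  also have "(\<integral>x. (\<integral>i. indicator (A i) x *\<^sub>R F x \<partial>count_space I) \<partial>N) = (\<integral>x. F x \<partial>N)"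
  proof (rule integral_cong_AE)
    interpret C: sigma_finite_measure "count_space I"
      using I by (rule sigma_finite_measure_count_space_countable)
    have "(\<lambda>z. indicator (A (snd z)) (fst z) *\<^sub>R F (fst z)) \<in> borel_measurable (N \<Otimes>\<^sub>M count_space I)"
    proof (rule measurable_compose_countable'[where f = "\<lambda>i z. indicator (A i) (fst z) *\<^sub>R F (fst z)"
          and g = snd and I = I])
      fix i assume "i \<in> I"
      then have [measurable]: "A i \<in> sets N" "F \<in> borel_measurable N"
        using A F by auto
      show "(\<lambda>z. indicator (A i) (fst z) *\<^sub>R F (fst z)) \<in> borel_measurable (N \<Otimes>\<^sub>M count_space I)"
        by simp
    qed (use I in auto)
    then show "(\<lambda>x. \<integral>i. indicator (A i) x *\<^sub>R F x \<partial>count_space I) \<in> borel_measurable N"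
      by (intro C.borel_measurable_lebesgue_integral) (simp add: case_prod_unfold)
  qed (use F single in auto)
  finally show ?thesis .
qed

lemma pmf_expectation_has_sum:
  fixes g :: "'k \<Rightarrow> complex"
  assumes "\<And>k. k \<in> set_pmf p \<Longrightarrow> norm (g k) \<le> b"
  shows "((\<lambda>k. of_real (pmf p k) * g k) has_sum measure_pmf.expectation p g) (set_pmf p)"
proof -
  have "integrable p g"
    using assms by (intro measure_pmf.integrable_const_bound[where B = b]) (auto simp: AE_measure_pmf_iff)
  then have "((\<lambda>k. \<integral>x. indicator {k} x *\<^sub>R g x \<partial>p) has_sum (\<integral>x. g x \<partial>p)) (set_pmf p)"
    by (intro integral_countable_partition)
      (auto intro: measure_pmf.sigma_finite_measure_axioms simp: AE_measure_pmf_iff)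
  also have "(\<lambda>k. \<integral>x. indicator {k} x *\<^sub>R g x \<partial>p) = (\<lambda>k. of_real (pmf p k) * g k)"
  proof
    fix k
    have "(\<integral>x. indicator {k} x *\<^sub>R g x \<partial>p) = (\<integral>x. indicator {k} x *\<^sub>R g k \<partial>p)"
      by (intro Bochner_Integration.integral_cong) (auto simp: indicator_def)
    then show "(\<integral>x. indicator {k} x *\<^sub>R g x \<partial>p) = of_real (pmf p k) * g k"
      by (simp add: measure_pmf_single scaleR_conv_of_real)
  qed
  finally show ?thesis .
qed

lemma norm_exp_minus_le_1:
  assumes "0 \<le> Re \<omega>" "0 \<le> t"
  shows "norm (damp \<omega> t) \<le> 1"
  using assms by simp

section \<open>Independent marks\<close>

text \<open>
  For batches that arrive during cycle \<open>m\<close> the relevant variables split into independent groups: the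
  clock (everything that determines the window), the batches from number \<open>p\<close> on, and the switch-over
  times of the next cycle.
\<close>

definition switch_sources :: "'a polling \<Rightarrow> nat \<Rightarrow> source set" where
  "switch_sources P m = {Switchover m i | i. i \<in> {1..nq P}}"

definition clock_sources :: "'a polling \<Rightarrow> nat \<Rightarrow> nat \<Rightarrow> source set" where
  "clock_sources P m p = past_sources P p m \<union> range Interarrival"

context stationary_globally_gated
begin

lemma switch_sources_subset: "switch_sources P m \<subseteq> sources (nq P)"
  by (auto simp: switch_sources_def sources_def)

lemma clock_sources_subset: "clock_sources P m p \<subseteq> sources (nq P)"
proof -
  have "range Interarrival \<subseteq> sources (nq P)"
    by (auto simp: sources_def)
  then show ?thesis
    using past_sources_subset by (simp add: clock_sources_def)
qed

text \<open>
  Given a window that begins with batch \<open>p\<close>, the batches from \<open>p\<close> on have had no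
  influence on the clock, and so they are independent marks.
\<close>

lemma integral_marks:
  fixes Y g :: "'a \<Rightarrow> complex" and f :: "nat \<Rightarrow> 'a \<Rightarrow> complex"
  assumes Y: "Y \<in> borel_measurable (source_algebra P (clock_sources P m p))" "integrable M Y"
    and f: "\<And>n. n \<in> {p..<p+r} \<Longrightarrow> f n \<in> borel_measurable (source_algebra P (batch_sources P n))"
      "\<And>n. n \<in> {p..<p+r} \<Longrightarrow> integrable M (f n)"
    and g: "g \<in> borel_measurable (source_algebra P (switch_sources P (Suc m)))" "integrable M g"
  shows "(\<integral>x. Y x * (\<Prod>n=p..<p+r. f n x) * g x \<partial>M)
    = (\<integral>x. Y x \<partial>M) * (\<Prod>n=p..<p+r. \<integral>x. f n x \<partial>M) * (\<integral>x. g x \<partial>M)"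
proof -
  \<comment> \<open>Index 0 is the clock, index 1 the switch-over times, index \<open>n + 2\<close> is batch \<open>n\<close>.\<close>
  define J where "J j = (case j of 0 \<Rightarrow> clock_sources P m p | Suc 0 \<Rightarrow> switch_sources P (Suc m)
      | Suc (Suc n) \<Rightarrow> batch_sources P n)" for j
  define Z where "Z j = (case j of 0 \<Rightarrow> Y | Suc 0 \<Rightarrow> g | Suc (Suc n) \<Rightarrow> f n)" for j
  let ?R = "(\<lambda>n. Suc (Suc n)) ` {p..<p+r}"
  let ?I = "insert 0 (insert (Suc 0) ?R)"
  have disj: "disjoint_family_on J ?I"
    unfolding disjoint_family_on_def J_def
    by (auto simp: clock_sources_def past_sources_def switch_sources_def batch_sources_def)
  have ind: "indep_vars (\<lambda>_. borel) Z ?I"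
  proof (rule indep_vars_of_sources[where J = J, OF _ disj])
    show "J j \<subseteq> sources (nq P)" for j
      unfolding J_def
      by (cases j; simp add: clock_sources_subset)
        (metis nat.case_eq_if batch_sources_subset switch_sources_subset)
    show "Z j \<in> borel_measurable (source_algebra P (J j))" if "j \<in> ?I" for j
      using that Y f g by (auto simp: J_def Z_def)
  qed
  have prod: "(\<Prod>j\<in>?I. h (Z j)) = h Y * (\<Prod>n=p..<p+r. h (f n)) * h g" for h :: "('a \<Rightarrow> complex) \<Rightarrow> complex"
  proof -
    have "(\<Prod>j\<in>?I. h (Z j)) = h (Z 0) * (h (Z (Suc 0)) * (\<Prod>j\<in>?R. h (Z j)))"
      by (subst prod.insert; (subst prod.insert)?) auto
    also have "(\<Prod>j\<in>?R. h (Z j)) = (\<Prod>n=p..<p+r. h (f n))"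
      by (subst prod.reindex) (auto simp: Z_def inj_on_def)
    finally show ?thesis
      by (simp add: Z_def)
  qed
  have "(\<integral>x. (\<Prod>j\<in>?I. Z j x) \<partial>M) = (\<Prod>j\<in>?I. \<integral>x. Z j x \<partial>M)"
    using Y f g by (intro indep_vars_lebesgue_integral ind) (auto simp: Z_def)
  then show ?thesis
    using prod[of "\<lambda>z. z x" for x] prod[of "\<lambda>z. \<integral>x. z x \<partial>M"] by simp
qed

lemma integral_lst:
  assumes "f \<in> borel_measurable M" "distr M borel f = \<mu>"
  shows "(\<integral>x. damp \<omega> (f x) \<partial>M) = lst \<mu> \<omega>"
  unfolding lst_def assms(2)[symmetric] using assms(1) by (subst integral_distr) auto

lemma integrable_damped:
  assumes "0 \<le> Re \<omega>" "f \<in> borel_measurable M" "AE x in M. 0 \<le> f x"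
  shows "integrable M (\<lambda>x. damp \<omega> (f x))"
proof (rule integrable_const_bound)
  show "AE x in M. norm (damp \<omega> (f x)) \<le> 1"
    using assms(3) by eventually_elim (rule norm_exp_minus_le_1[OF assms(1)])
qed (use assms in simp)

lemma norm_integral_damped:
  assumes "0 \<le> Re \<omega>" "f \<in> borel_measurable M" "AE x in M. 0 \<le> f x"
  shows "norm (\<integral>x. damp \<omega> (f x) \<partial>M) \<le> 1"
proof -
  have "AE x in M. norm (damp \<omega> (f x)) \<le> 1"
    using assms(3) by eventually_elim (rule norm_exp_minus_le_1[OF assms(1)])
  note AE = this
  have "norm (\<integral>x. damp \<omega> (f x) \<partial>M)
      \<le> (\<integral>x. norm (damp \<omega> (f x)) \<partial>M)"
    by (rule integral_norm_bound)
  also have "\<dots> \<le> (\<integral>x. 1 \<partial>M)"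
    by (intro integral_mono_AE AE integrable_norm integrable_damped assms) simp
  finally show ?thesis
    by (simp add: prob_space)
qed

lemma AE_service_nonneg: "i \<in> {1..nq P} \<Longrightarrow> AE x in M. 0 \<le> service P n i c x"
  using AE_regular by eventually_elim (rule service_nonneg)

lemma AE_switchover_nonneg: "i \<in> {1..nq P} \<Longrightarrow> AE x in M. 0 \<le> switchover P m i x"
  using AE_regular by eventually_elim (rule switchover_nonneg)

lemma norm_service_lst_le_1:
  assumes "0 \<le> Re \<omega>" "i \<in> {1..nq P}"
  shows "norm (lst (service_law P i) \<omega>) \<le> 1"
  using norm_integral_damped[OF assms(1) rv_service[OF assms(2)] AE_service_nonneg[OF assms(2)], of 0 0]
  unfolding integral_lst[OF rv_service[OF assms(2)] service_distr[OF assms(2)]] .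

lemma integral_switchovers:
  assumes \<omega>: "0 \<le> Re \<omega>" and L: "L \<subseteq> {1..nq P}"
  shows "(\<integral>x. damp \<omega> (\<Sum>l\<in>L. switchover P m l x) \<partial>M)
    = (\<Prod>l\<in>L. lst (switch_law P l) \<omega>)"
proof -
  have fin: "finite L"
    using L finite_subset by blast
  have ind: "indep_vars (\<lambda>_. borel) (\<lambda>l x. damp \<omega> (switchover P m l x)) L"
  proof (rule indep_vars_of_sources[where J = "\<lambda>l. {Switchover m l}"])
    fix l
    have [measurable]: "switchover P m l \<in> borel_measurable (source_algebra P {Switchover m l})"
      by (rule measurable_switchover_source) simp
    show "(\<lambda>x. damp \<omega> (switchover P m l x))
        \<in> borel_measurable (source_algebra P {Switchover m l})"
      by simp
  qed (use L in \<open>auto simp: sources_def disjoint_family_on_def\<close>)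
  have "(\<integral>x. damp \<omega> (\<Sum>l\<in>L. switchover P m l x) \<partial>M)
      = (\<integral>x. (\<Prod>l\<in>L. damp \<omega> (switchover P m l x)) \<partial>M)"
    using fin by (simp add: exp_sum[symmetric] sum_distrib_left sum_negf)
  also have "\<dots> = (\<Prod>l\<in>L. \<integral>x. damp \<omega> (switchover P m l x) \<partial>M)"
    using L \<omega> by (intro indep_vars_lebesgue_integral[OF fin ind] integrable_damped rv_switchover
        AE_switchover_nonneg) auto
  also have "\<dots> = (\<Prod>l\<in>L. lst (switch_law P l) \<omega>)"
    using L by (intro prod.cong refl integral_lst rv_switchover switchover_distr) auto
  finally show ?thesis .
qed

text \<open>
  On the event that the number of customers is \<open>k\<close>, the sum of service times has fixed length and its
  transform factorises. The batches and the initial content are the two instances.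
\<close>

lemma integral_count_and_services:
  fixes K :: "'a \<Rightarrow> nat \<Rightarrow> nat" and V :: "nat \<Rightarrow> nat \<Rightarrow> 'a \<Rightarrow> real"
  assumes \<omega>: "0 \<le> Re \<omega>" and L: "L \<subseteq> {1..nq P}"
    and count: "src \<in> sources (nq P)" "{x\<in>space M. K x = k} \<in> source_events P src"
    and serv: "\<And>l c. l \<in> L \<Longrightarrow> sv l c \<in> sources (nq P)" "\<And>l c. l \<in> L \<Longrightarrow> sv l c \<noteq> src"
      "inj_on (\<lambda>(l, c). sv l c) (L \<times> UNIV)"
    and V: "\<And>l c. l \<in> L \<Longrightarrow> V l c \<in> borel_measurable (source_algebra P {sv l c})"
      "\<And>l c. l \<in> L \<Longrightarrow> distr M borel (V l c) = service_law P l"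
  shows "(\<integral>x. indicator {x\<in>space M. K x = k} x
        * damp \<omega> (\<Sum>l\<in>L. \<Sum>c<K x l. V l c x) \<partial>M)
    = complex_of_real (prob {x\<in>space M. K x = k}) * (\<Prod>l\<in>L. lst (service_law P l) \<omega> ^ k l)"
proof -
  let ?D = "SIGMA l:L. {..<k l}"
  let ?I = "insert None (Some ` ?D)"
  let ?A = "{x\<in>space M. K x = k}"
  define J where "J j = (case j of None \<Rightarrow> {src} | Some (l, c) \<Rightarrow> {sv l c})" for j
  define Y :: "(nat \<times> nat) option \<Rightarrow> 'a \<Rightarrow> complex" where "Y j = (case j of
      None \<Rightarrow> indicator ?A | Some (l, c) \<Rightarrow> (\<lambda>x. damp \<omega> (V l c x)))" for j
  have finL: "finite L"
    using L finite_subset by blast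
  then have finI: "finite ?I"
    by simp
  have A0: "?A \<in> sets (source_algebra P {src})"
    using count(2) by (intro source_event_in_algebra[of src]) simp_all
  then have A: "?A \<in> events"
    using source_algebra_subset[of "{src}"] count(1) by auto
  have rv: "V l c \<in> borel_measurable M" if "l \<in> L" for l c
    using V(1)[OF that] serv(1)[OF that] by (intro measurable_source_algebra_imp[of "{sv l c}"]) auto
  have ind: "indep_vars (\<lambda>_. borel) Y ?I"
  proof (rule indep_vars_of_sources[where J = J])
    show "J j \<subseteq> sources (nq P)" if "j \<in> ?I" for j
      using that count(1) serv(1) by (auto simp: J_def)
    have "J j \<inter> J j' = {}" if "j \<in> ?I" "j' \<in> ?I" "j \<noteq> j'" for j j'
    proof -
      have "sv l c \<noteq> sv l' c'" if "l \<in> L" "l' \<in> L" "(l, c) \<noteq> (l', c')" for l l' c c'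
        using inj_onD[OF serv(3), of "(l, c)" "(l', c')"] that by auto
      then show ?thesis
        using that serv(2) by (auto simp: J_def) metis+
    qed
    then show "disjoint_family_on J ?I"
      unfolding disjoint_family_on_def by blast
    show "Y j \<in> borel_measurable (source_algebra P (J j))" if "j \<in> ?I" for j
    proof (cases j)
      case None
      then show ?thesis
        using A0 by (simp add: Y_def J_def borel_measurable_indicator)
    next
      case (Some lc)
      obtain l c where lc: "lc = (l, c)"
        by fastforce
      with Some that have "l \<in> L"
        by auto
      note [measurable] = V(1)[OF this, of c]
      show ?thesis
        unfolding Y_def J_def Some lc by simp
    qed
  qed
  have prod: "(\<Prod>j\<in>?I. h (Y j)) = h (Y None) * (\<Prod>l\<in>L. \<Prod>c<k l. h (Y (Some (l, c))))"
    for h :: "('a \<Rightarrow> complex) \<Rightarrow> complex"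
  proof -
    have "(\<Prod>j\<in>?I. h (Y j)) = h (Y None) * (\<Prod>j\<in>Some ` ?D. h (Y j))"
      using finL by (subst prod.insert) auto
    also have "(\<Prod>j\<in>Some ` ?D. h (Y j)) = (\<Prod>(l, c)\<in>?D. h (Y (Some (l, c))))"
      by (subst prod.reindex) (auto simp: case_prod_unfold)
    also have "\<dots> = (\<Prod>l\<in>L. \<Prod>c<k l. h (Y (Some (l, c))))"
      using finL by (subst prod.Sigma) auto
    finally show ?thesis .
  qed
  have int: "integrable M (Y j)" if "j \<in> ?I" for j
  proof (cases j)
    case None
    then show ?thesis
      unfolding Y_def using A by (intro integrable_const_bound[where B = 1]) (auto simp: indicator_def)
  next
    case (Some lc)
    obtain l c where lc: "lc = (l, c)"
      by fastforce
    with Some that have l: "l \<in> L"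
      by auto
    with L have "AE x in M. 0 \<le> V l c x"
      by (intro AE_distr_nonneg[OF rv[OF l] V(2)[OF l] service_law]) auto
    then show ?thesis
      unfolding Y_def Some lc using integrable_damped[OF \<omega> rv[OF l]] by simp
  qed
  have eq: "(\<Prod>j\<in>?I. Y j x) = indicator ?A x
        * damp \<omega> (\<Sum>l\<in>L. \<Sum>c<K x l. V l c x)" for x
  proof (cases "x \<in> ?A")
    case True
    then show ?thesis
      using finL prod[of "\<lambda>z. z x"]
      by (simp add: Y_def exp_sum[symmetric] sum_distrib_left sum_negf)
  next
    case False
    then show ?thesis
      using prod[of "\<lambda>z. z x"] by (simp add: Y_def)
  qed
  have size: "(\<integral>x. Y None x \<partial>M) = complex_of_real (prob ?A)"
  proof -
    have "(\<integral>x. Y None x \<partial>M) = (\<integral>x. complex_of_real (indicator ?A x) \<partial>M)"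
      unfolding Y_def by (intro Bochner_Integration.integral_cong) (auto simp: indicator_def)
    then show ?thesis
      using A by simp
  qed
  have lst: "(\<integral>x. Y (Some (l, c)) x \<partial>M) = lst (service_law P l) \<omega>" if "l \<in> L" for l c
    unfolding Y_def using integral_lst[OF rv[OF that] V(2)[OF that], of \<omega>] by simp
  have "(\<integral>x. (\<Prod>j\<in>?I. Y j x) \<partial>M) = (\<Prod>j\<in>?I. \<integral>x. Y j x \<partial>M)"
    by (rule indep_vars_lebesgue_integral[OF finI ind int])
  also have "\<dots> = complex_of_real (prob ?A) * (\<Prod>l\<in>L. lst (service_law P l) \<omega> ^ k l)"
    unfolding prod[of "\<lambda>z. \<integral>x. z x \<partial>M"] size using lst by simp
  finally show ?thesis
    unfolding eq .
qed

lemma integral_batch_size_services: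
  assumes "0 \<le> Re \<omega>" and L: "L \<subseteq> {1..nq P}"
  shows "(\<integral>x. indicator {x\<in>space M. batch_size P n x = k} x
        * damp \<omega> (\<Sum>l\<in>L. batch_work P n l x) \<partial>M)
    = complex_of_real (pmf (batch_pmf P) k) * (\<Prod>l\<in>L. lst (service_law P l) \<omega> ^ k l)"
proof -
  have "pmf (batch_pmf P) k = measure (distr M (count_space UNIV) (batch_size P n)) {k}"
    by (simp add: batch_size_distr measure_pmf_single)
  also have "\<dots> = prob {x\<in>space M. batch_size P n x = k}"
    by (subst measure_distr) (auto intro!: arg_cong[where f = prob])
  finally have "pmf (batch_pmf P) k = prob {x\<in>space M. batch_size P n x = k}" .
  moreover have "{x\<in>space M. batch_size P n x = k} \<in> source_events P (Batch_Size n)"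
    by (auto intro!: exI[of _ "{k}"])
  ultimately show ?thesis
    unfolding batch_work_def using L
    by (simp only:)
      (intro integral_count_and_services[OF assms, where sv = "Service n" and src = "Batch_Size n"],
        auto simp: sources_def inj_on_def intro!: measurable_service_source service_distr)
qed

lemma integral_init_content_services:
  assumes "0 \<le> Re \<omega>" and L: "L \<subseteq> {1..nq P}"
  shows "(\<integral>x. indicator {x\<in>space M. init_content P x = k} x
        * damp \<omega> (\<Sum>l\<in>L. init_work P l x) \<partial>M)
    = complex_of_real (prob {x\<in>space M. init_content P x = k}) * (\<Prod>l\<in>L. lst (service_law P l) \<omega> ^ k l)"
proof -
  have "{x\<in>space M. init_content P x = k} \<in> source_events P Init_Content"
    by (auto intro!: exI[of _ "{k}"])
  then show ?thesis
    unfolding init_work_def using L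
    by (intro integral_count_and_services[OF assms, where sv = Init_Service and src = Init_Content])
      (auto simp: sources_def inj_on_def intro!: measurable_init_service_source init_service_distr)
qed

lemma batch_size_partition:
  fixes F :: "'a \<Rightarrow> complex"
  assumes "integrable M F"
  shows "((\<lambda>k. \<integral>x. indicator {x\<in>space M. batch_size P n x = k} x * F x \<partial>M) has_sum (\<integral>x. F x \<partial>M))
    (set_pmf (batch_pmf P))"
proof -
  have "((\<lambda>k. \<integral>x. indicator {x\<in>space M. batch_size P n x = k} x *\<^sub>R F x \<partial>M) has_sum (\<integral>x. F x \<partial>M))
    (set_pmf (batch_pmf P))"
  proof (rule integral_countable_partition[OF sigma_finite_measure_axioms _ assms])
    show "AE x in M. F x \<noteq> 0 \<longrightarrow> (\<exists>i\<in>set_pmf (batch_pmf P). x \<in> {x \<in> space M. batch_size P n x = i}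
        \<and> (\<forall>j\<in>set_pmf (batch_pmf P). x \<in> {x \<in> space M. batch_size P n x = j} \<longrightarrow> j = i))"
      using AE_regular AE_space by eventually_elim (auto simp: regular_path_def)
  qed auto
  moreover have "indicator A x *\<^sub>R F x = indicator A x * F x" for A :: "'a set" and x
    by (simp add: indicator_def)
  ultimately show ?thesis
    by simp
qed

lemma integral_batch_work:
  assumes \<omega>: "0 \<le> Re \<omega>" and L: "L \<subseteq> {1..nq P}"
  shows "(\<integral>x. damp \<omega> (\<Sum>l\<in>L. batch_work P n l x) \<partial>M)
    = batch_pgf P (\<lambda>l. if l \<in> L then lst (service_law P l) \<omega> else 1)"
proof -
  let ?F = "\<lambda>x. damp \<omega> (\<Sum>l\<in>L. batch_work P n l x)"
  have rv: "(\<lambda>x. \<Sum>l\<in>L. batch_work P n l x) \<in> borel_measurable M"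
    using L by (intro borel_measurable_sum measurable_source_algebra_imp[OF order_refl]
        measurable_batch_work_source batch_sources_subset) auto
  have "AE x in M. 0 \<le> (\<Sum>l\<in>L. batch_work P n l x)"
    using AE_regular by eventually_elim (use L in \<open>auto intro!: sum_nonneg batch_work_nonneg\<close>)
  then have "integrable M ?F"
    by (intro integrable_damped \<omega> rv)
  from batch_size_partition[OF this, of n]
  have 1: "((\<lambda>k. complex_of_real (pmf (batch_pmf P) k) * (\<Prod>l\<in>L. lst (service_law P l) \<omega> ^ k l))
      has_sum (\<integral>x. ?F x \<partial>M)) (set_pmf (batch_pmf P))"
    unfolding integral_batch_size_services[OF assms] .
  have "norm (\<Prod>l\<in>L. lst (service_law P l) \<omega> ^ k l) \<le> 1" for k
    unfolding prod_norm[symmetric] using L norm_service_lst_le_1[OF \<omega>]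
    by (intro prod_le_1) (auto simp: norm_power intro!: power_le_one)
  then have 2: "((\<lambda>k. complex_of_real (pmf (batch_pmf P) k) * (\<Prod>l\<in>L. lst (service_law P l) \<omega> ^ k l))
      has_sum measure_pmf.expectation (batch_pmf P) (\<lambda>k. \<Prod>l\<in>L. lst (service_law P l) \<omega> ^ k l))
      (set_pmf (batch_pmf P))"
    by (rule pmf_expectation_has_sum)
  have "(\<Prod>l\<in>L. lst (service_law P l) \<omega> ^ k l)
      = (\<Prod>l=1..nq P. (if l \<in> L then lst (service_law P l) \<omega> else 1) ^ k l)" for k
    using L by (intro prod.mono_neutral_cong_left) auto
  with has_sum_unique[OF 1 2] show ?thesis
    by (simp add: batch_pgf_def)
qed

end

section \<open>Arrivals in a cycle of given length\<close>

definition poisson_weight :: "real \<Rightarrow> nat \<Rightarrow> real" where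
  "poisson_weight t k = t ^ k / fact k * exp (- t)"

lemma poisson_weight_nonneg: "0 \<le> t \<Longrightarrow> 0 \<le> poisson_weight t k"
  by (simp add: poisson_weight_def)

lemma measurable_poisson_weight [measurable]:
  "f \<in> borel_measurable A \<Longrightarrow> (\<lambda>x. poisson_weight (f x) k) \<in> borel_measurable A"
  unfolding poisson_weight_def by simp

lemma erlang_density_eq_poisson_weight:
  "0 \<le> u \<Longrightarrow> erlang_density k l u = l * poisson_weight (l * u) k"
  by (simp add: erlang_density_def poisson_weight_def power_mult_distrib)

lemma poisson_weight_sums:
  fixes z :: complex
  shows "(\<lambda>k. of_real (poisson_weight t k) * z ^ k) sums exp (- of_real t * (1 - z))"
proof -
  have "(\<lambda>k. (of_real t * z) ^ k /\<^sub>R fact k * exp (- of_real t)) sums (exp (of_real t * z) * exp (- of_real t))"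
    by (intro sums_mult2 exp_converges)
  also have "(\<lambda>k. (of_real t * z) ^ k /\<^sub>R fact k * exp (- of_real t))
      = (\<lambda>k. of_real (poisson_weight t k) * z ^ k)"
    by (rule ext) (simp add: poisson_weight_def power_mult_distrib scaleR_conv_of_real exp_of_real[symmetric]
        field_simps)
  also have "exp (of_real t * z) * exp (- of_real t) = exp (- of_real t * (1 - z))"
    by (simp add: exp_add[symmetric] algebra_simps)
  finally show ?thesis .
qed

text \<open>
  The time from the arrival of batch \<open>p - 1\<close> (from time 0 if \<open>p = 0\<close>) to the arrival of
  batch \<open>p + k - 1\<close>.
\<close>

definition interarrival_sum :: "'a polling \<Rightarrow> nat \<Rightarrow> nat \<Rightarrow> 'a \<Rightarrow> real" where
  "interarrival_sum P p k x = (\<Sum>j=p..<p+k. interarrival P j x)"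

lemma interarrival_sum_0 [simp]: "interarrival_sum P p 0 x = 0"
  by (simp add: interarrival_sum_def)

lemma interarrival_sum_Suc:
  "interarrival_sum P p (Suc k) x = interarrival_sum P p k x + interarrival P (p + k) x"
  by (simp add: interarrival_sum_def)

lemma interarrival_sum_add:
  "interarrival_sum P p (k + k') x = interarrival_sum P p k x + interarrival_sum P (p + k) k' x"
  by (induction k') (simp_all add: interarrival_sum_Suc add.assoc)

lemma epoch_eq_interarrival_sum: "epoch P (p + k) x = epoch P p x + interarrival_sum P p k x"
  by (simp add: epoch_add interarrival_sum_def)

lemma measurable_interarrival_sum_source:
  assumes "Interarrival ` {p..<p+k} \<subseteq> J"
  shows "interarrival_sum P p k \<in> borel_measurable (source_algebra P J)"
  unfolding interarrival_sum_def[abs_def]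
  using assms by (intro borel_measurable_sum measurable_interarrival_source) auto

lemma interarrival_sum_nonneg: "regular_path P x \<Longrightarrow> 0 \<le> interarrival_sum P p k x"
  unfolding interarrival_sum_def by (intro sum_nonneg) (simp add: regular_path_def less_imp_le)

text \<open>
  The transform of the residual cycle \<open>c - u\<close> of a batch that arrives \<open>u\<close> time units
  into a cycle of length \<open>c\<close>, on the event that \<open>a\<close> batches arrive before it and
  \<open>b\<close> after it in that cycle. The Erlang density is the density of the arrival epoch \<open>u\<close>
  of the batch number \<open>a + 1\<close>.
\<close>

definition residual_kernel :: "real \<Rightarrow> complex \<Rightarrow> nat \<Rightarrow> nat \<Rightarrow> real \<Rightarrow> complex" where
  "residual_kernel l \<omega> a b c = (\<integral>u. erlang_density a l u *\<^sub>R
     (if u \<le> c then of_real (poisson_weight (l * (c - u)) b) * damp \<omega> (c - u) else 0) \<partial>lborel)"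

context stationary_globally_gated
begin

lemma rv_interarrival_sum [measurable]: "interarrival_sum P p k \<in> borel_measurable M"
  unfolding interarrival_sum_def[abs_def] by simp

lemma interarrival_sum_distributed:
  "distributed M lborel (interarrival_sum P p (Suc k)) (erlang_density k (rate P))"
  unfolding interarrival_sum_def[abs_def] by (rule interarrival_sum_erlang)

lemma prob_interarrival_sum_le:
  assumes "0 \<le> t"
  shows "prob {x\<in>space M. interarrival_sum P p k x \<le> t} = 1 - (\<Sum>j<k. poisson_weight (rate P * t) j)"
proof (cases k)
  case 0
  then show ?thesis
    using assms prob_space by simp
next
  case (Suc k')
  have "prob {x\<in>space M. interarrival_sum P p k x \<le> t} = erlang_CDF k' (rate P) t"
    unfolding Suc using erlang_distributed_le[OF interarrival_sum_distributed rate_pos assms] .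
  then show ?thesis
    using assms by (simp add: erlang_CDF_def Suc lessThan_Suc_atMost poisson_weight_def)
qed

text \<open>
  The events \<open>interarrival_sum P p k x \<le> t\<close> decrease with \<open>k\<close>; the difference of two
  consecutive Erlang distribution functions is a Poisson weight.
\<close>

lemma prob_interarrival_count:
  assumes "0 \<le> t"
  shows "prob {x\<in>space M. interarrival_sum P p k x \<le> t \<and> t < interarrival_sum P p (Suc k) x}
    = poisson_weight (rate P * t) k"
proof -
  let ?A = "\<lambda>k. {x\<in>space M. interarrival_sum P p k x \<le> t}"
  have "prob {x\<in>space M. interarrival_sum P p k x \<le> t \<and> t < interarrival_sum P p (Suc k) x}
      = prob (?A k - ?A (Suc k))"
    by (intro arg_cong[where f = prob]) auto
  also have "\<dots> = prob (?A k) - prob (?A k \<inter> ?A (Suc k))"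
    by (rule finite_measure_Diff') auto
  also have "prob (?A k \<inter> ?A (Suc k)) = prob (?A (Suc k))"
  proof (rule finite_measure_eq_AE)
    show "AE x in M. x \<in> ?A k \<inter> ?A (Suc k) \<longleftrightarrow> x \<in> ?A (Suc k)"
      using AE_regular by eventually_elim (auto simp: interarrival_sum_Suc regular_path_def dest: spec[of _ "p + k"] less_imp_le
        intro: order_trans[of _ "interarrival_sum P p k x + interarrival P (p + k) x" t for x])
  qed auto
  finally show ?thesis
    unfolding prob_interarrival_sum_le[OF assms] by simp
qed

lemma integral_interarrival_sum:
  fixes G :: "real \<Rightarrow> complex"
  assumes [measurable]: "G \<in> borel_measurable borel"
  shows "(\<integral>x. G (interarrival_sum P p (Suc k) x) \<partial>M) = (\<integral>u. erlang_density k (rate P) u *\<^sub>R G u \<partial>lborel)"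
proof -
  have "(\<integral>x. G (interarrival_sum P p (Suc k) x) \<partial>M)
      = (\<integral>u. G u \<partial>distr M lborel (interarrival_sum P p (Suc k)))"
    by (subst integral_distr) auto
  also have "\<dots> = (\<integral>u. G u \<partial>density lborel (erlang_density k (rate P)))"
    by (simp only: distributed_distr_eq_density[OF interarrival_sum_distributed])
  also have "\<dots> = (\<integral>u. erlang_density k (rate P) u *\<^sub>R G u \<partial>lborel)"
    using rate_pos by (intro integral_density) auto
  finally show ?thesis .
qed

text \<open>
  The memoryless property in integrated form, obtained by a translation of Lebesgue measure.
\<close>

lemma exponential_overshoot:
  fixes G :: "real \<Rightarrow> complex"
  assumes s: "0 \<le> s" and [measurable]: "G \<in> borel_measurable borel"
  shows "(\<integral>x. (if s < interarrival P p x then G (interarrival P p x - s) else 0) \<partial>M)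
    = exp (- rate P * s) *\<^sub>R (\<integral>x. G (interarrival P p x) \<partial>M)"
proof -
  let ?d = "erlang_density 0 (rate P)"
  have 1: "interarrival P p x = interarrival_sum P p (Suc 0) x" for x
    by (simp add: interarrival_sum_def)
  have "(\<integral>x. (if s < interarrival P p x then G (interarrival P p x - s) else 0) \<partial>M)
      = (\<integral>u. ?d u *\<^sub>R (if s < u then G (u - s) else 0) \<partial>lborel)"
    unfolding 1 by (rule integral_interarrival_sum) simp
  also have "\<dots> = (\<integral>u. ?d (s + 1 * u) *\<^sub>R (if s < s + 1 * u then G (s + 1 * u - s) else 0) \<partial>lborel)"
    using lborel_integral_real_affine[of 1 "\<lambda>u. ?d u *\<^sub>R (if s < u then G (u - s) else 0)" s] by simp
  also have "\<dots> = (\<integral>u. exp (- rate P * s) *\<^sub>R (?d u *\<^sub>R G u) \<partial>lborel)"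
  proof (rule integral_cong_AE)
    have "AE u in lborel. u \<noteq> (0::real)"
      by (rule AE_lborel_singleton)
    then show "AE u in lborel. ?d (s + 1 * u) *\<^sub>R (if s < s + 1 * u then G (s + 1 * u - s) else 0)
        = exp (- rate P * s) *\<^sub>R (?d u *\<^sub>R G u)"
    proof eventually_elim
      case (elim u)
      then show ?case
        using s by (auto simp: erlang_density_def exp_add[symmetric] algebra_simps)
    qed
  qed simp_all
  also have "\<dots> = exp (- rate P * s) *\<^sub>R (\<integral>x. G (interarrival P p x) \<partial>M)"
    unfolding 1 by (simp only: integral_interarrival_sum[OF assms(2)] integral_scaleR_right)
  finally show ?thesis .
qed

text \<open>
  Only the first interarrival time has partly elapsed; the others are averaged as they stand, and after the
  translation all of them together have an Erlang distribution again.
\<close>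

lemma memoryless_interarrival_sum:
  fixes G :: "real \<Rightarrow> complex"
  assumes s: "0 \<le> s" and G [measurable]: "G \<in> borel_measurable borel" and bound: "\<And>u. norm (G u) \<le> B"
  shows "(\<integral>x. (if s < interarrival P p x then G (interarrival_sum P p (Suc k) x - s) else 0) \<partial>M)
    = exp (- rate P * s) *\<^sub>R (\<integral>u. erlang_density k (rate P) u *\<^sub>R G u \<partial>lborel)"
proof -
  let ?J1 = "Interarrival ` {p<..}" and ?J2 = "{Interarrival p}"
  have J: "?J1 \<subseteq> sources (nq P)" "?J2 \<subseteq> sources (nq P)" "?J1 \<inter> ?J2 = {}"
    by (auto simp: sources_def)
  have [measurable]: "interarrival_sum P (Suc p) k \<in> borel_measurable (source_algebra P ?J1)"
    "interarrival P p \<in> borel_measurable (source_algebra P ?J2)"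
    by (auto intro!: measurable_interarrival_sum_source measurable_interarrival_source)
  have split: "interarrival_sum P p (Suc k) x = interarrival P p x + interarrival_sum P (Suc p) k x" for x
    using interarrival_sum_add[of P p 1 k x] by (simp add: interarrival_sum_Suc[of P p 0])
  have B: "0 \<le> B"
    using bound[of 0] norm_ge_zero order_trans by blast
  have "(\<integral>x. (if s < interarrival P p x then G (interarrival_sum P p (Suc k) x - s) else 0) \<partial>M)
      = (\<integral>x. (\<integral>y. (if s < interarrival P p y then G (interarrival P p y + interarrival_sum P (Suc p) k x - s) else 0) \<partial>M) \<partial>M)"
    unfolding split using bound B
    by (intro integral_indep_sources(1)[OF J, where b = B]) (auto simp: case_prod_unfold)
  also have "\<dots> = (\<integral>x. (exp (- rate P * s) *\<^sub>R
      (\<integral>y. G (interarrival P p y + interarrival_sum P (Suc p) k x) \<partial>M)) \<partial>M)"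
  proof (rule Bochner_Integration.integral_cong[OF refl])
    fix x
    show "(\<integral>y. (if s < interarrival P p y then G (interarrival P p y + interarrival_sum P (Suc p) k x - s) else 0) \<partial>M)
      = exp (- rate P * s) *\<^sub>R (\<integral>y. G (interarrival P p y + interarrival_sum P (Suc p) k x) \<partial>M)"
    proof -
      have "interarrival P p y + v - s = interarrival P p y - s + v" for v y
        by simp
      then show ?thesis
        by (simp only: exponential_overshoot[OF s, of "\<lambda>u. G (u + interarrival_sum P (Suc p) k x)" p])
          (rule exponential_overshoot[OF s], measurable)
    qed
  qed
  also have "\<dots> = exp (- rate P * s) *\<^sub>R
      (\<integral>x. (\<integral>y. G (interarrival P p y + interarrival_sum P (Suc p) k x) \<partial>M) \<partial>M)"
    by simp
  also have "(\<integral>x. (\<integral>y. G (interarrival P p y + interarrival_sum P (Suc p) k x) \<partial>M) \<partial>M)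
      = (\<integral>x. G (interarrival_sum P p (Suc k) x) \<partial>M)"
    unfolding split using bound
    by (intro integral_indep_sources(1)[OF J, where b = B, symmetric]) (auto simp: case_prod_unfold)
  also have "\<dots> = (\<integral>u. erlang_density k (rate P) u *\<^sub>R G u \<partial>lborel)"
    by (rule integral_interarrival_sum) simp
  finally show ?thesis .
qed

lemma measurable_residual_kernel [measurable]: "residual_kernel l \<omega> a b \<in> borel_measurable borel"
  unfolding residual_kernel_def[abs_def]
  by (rule lborel.borel_measurable_lebesgue_integral) (simp add: case_prod_unfold)

lemma norm_poisson_weight_le_1:
  assumes "0 \<le> t"
  shows "poisson_weight (rate P * t) k \<le> 1"
  unfolding prob_interarrival_count[OF assms, of 0 k, symmetric] by simp

lemma norm_residual_integrand:
  assumes "0 \<le> Re \<omega>"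
  shows "norm (if u \<le> c then of_real (poisson_weight (rate P * (c - u)) b) * damp \<omega> (c - u) else 0 :: complex)
    \<le> 1"
proof (cases "u \<le> c")
  case True
  then have "0 \<le> poisson_weight (rate P * (c - u)) b" "poisson_weight (rate P * (c - u)) b \<le> 1"
    using rate_pos by (auto intro: poisson_weight_nonneg norm_poisson_weight_le_1)
  moreover have "norm (damp \<omega> (c - u)) \<le> 1"
    using norm_exp_minus_le_1[OF assms, of "c - u"] True by simp
  ultimately show ?thesis
    using True by (simp add: norm_mult mult_le_one del: norm_exp_eq_Re)
qed simp

lemma norm_residual_kernel_le_1:
  assumes "0 \<le> Re \<omega>"
  shows "norm (residual_kernel (rate P) \<omega> a b c) \<le> 1"
proof -
  let ?G = "\<lambda>u. if u \<le> c then of_real (poisson_weight (rate P * (c - u)) b) * damp \<omega> (c - u) else 0 :: complex"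
  have "residual_kernel (rate P) \<omega> a b c = (\<integral>x. ?G (interarrival_sum P 0 (Suc a) x) \<partial>M)"
    unfolding residual_kernel_def by (rule integral_interarrival_sum[symmetric]) simp
  also have "norm \<dots> \<le> (\<integral>x. norm (?G (interarrival_sum P 0 (Suc a) x)) \<partial>M)"
    by (rule integral_norm_bound)
  also have "\<dots> \<le> (\<integral>x. 1 \<partial>M)"
  proof (rule integral_mono)
    show "integrable M (\<lambda>x. norm (?G (interarrival_sum P 0 (Suc a) x)))"
      using norm_residual_integrand[OF assms]
      by (intro integrable_norm integrable_const_bound[where B = 1]) simp_all
  qed (simp, rule norm_residual_integrand[OF assms])
  finally show ?thesis
    by (simp add: prob_space)
qed

text \<open>
  Here the cycle length \<open>c\<close> and the age \<open>s\<close> of the current interarrival time are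
  constants. The arrivals up to the batch in question and those after it are averaged separately: the former
  produce the Erlang density, the latter a Poisson weight.
\<close>

lemma integral_arrival_given_cycle:
  assumes \<omega>: "0 \<le> Re \<omega>" and s: "0 \<le> s"
  shows "(\<integral>y. (if s < interarrival P p y \<and> interarrival_sum P p (Suc a) y - s \<le> c
        \<and> interarrival_sum P p (Suc a) y - s + interarrival_sum P (p + Suc a) b y \<le> c
        \<and> c < interarrival_sum P p (Suc a) y - s + interarrival_sum P (p + Suc a) (Suc b) y
      then damp \<omega> (c - (interarrival_sum P p (Suc a) y - s)) else 0) \<partial>M)
    = exp (- rate P * s) *\<^sub>R residual_kernel (rate P) \<omega> a b c"
proof -
  let ?J1 = "Interarrival ` {p..<p + Suc a}" and ?J2 = "Interarrival ` {p + Suc a..<p + Suc a + Suc b}"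
  let ?U = "interarrival_sum P p (Suc a)" and ?V = "interarrival_sum P (p + Suc a)"
  let ?G = "\<lambda>u. if u \<le> c then of_real (poisson_weight (rate P * (c - u)) b) * damp \<omega> (c - u) else 0 :: complex"
  have J: "?J1 \<subseteq> sources (nq P)" "?J2 \<subseteq> sources (nq P)" "?J1 \<inter> ?J2 = {}"
    by (auto simp: sources_def)
  have [measurable]: "?U \<in> borel_measurable (source_algebra P ?J1)"
    "interarrival P p \<in> borel_measurable (source_algebra P ?J1)"
    "?V b \<in> borel_measurable (source_algebra P ?J2)" "?V (Suc b) \<in> borel_measurable (source_algebra P ?J2)"
    by (auto intro!: measurable_interarrival_sum_source measurable_interarrival_source)
  have count: "(\<integral>y. (if u + ?V b y \<le> c \<and> c < u + ?V (Suc b) y then w else 0) \<partial>M)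
      = poisson_weight (rate P * (c - u)) b *\<^sub>R w" if "u \<le> c" for u and w :: complex
  proof -
    have "(\<integral>y. (if u + ?V b y \<le> c \<and> c < u + ?V (Suc b) y then w else 0) \<partial>M)
        = (\<integral>y. indicator {y\<in>space M. ?V b y \<le> c - u \<and> c - u < ?V (Suc b) y} y *\<^sub>R w \<partial>M)"
      by (intro Bochner_Integration.integral_cong) (auto simp: indicator_def algebra_simps)
    also have "\<dots> = prob {y\<in>space M. ?V b y \<le> c - u \<and> c - u < ?V (Suc b) y} *\<^sub>R w"
    proof -
      have "{y\<in>space M. ?V b y \<le> c - u \<and> c - u < ?V (Suc b) y} \<in> events" (is "?A \<in> _")
        by measurable
      then have "integrable M (indicat_real ?A)" "?A \<inter> space M = ?A"
        by (auto simp: integrable_indicator_iff emeasure_eq_measure)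
      then show ?thesis
        by (subst integral_scaleR_left) simp_all
    qed
    finally show ?thesis
      using prob_interarrival_count[of "c - u" "p + Suc a" b] that by simp
  qed
  have "(\<integral>y. (if s < interarrival P p y \<and> ?U y - s \<le> c \<and> ?U y - s + ?V b y \<le> c \<and> c < ?U y - s + ?V (Suc b) y
      then damp \<omega> (c - (?U y - s)) else 0) \<partial>M)
    = (\<integral>x. (\<integral>y. (if s < interarrival P p x \<and> ?U x - s \<le> c \<and> ?U x - s + ?V b y \<le> c \<and> c < ?U x - s + ?V (Suc b) y
      then damp \<omega> (c - (?U x - s)) else 0) \<partial>M) \<partial>M)"
  proof (rule integral_indep_sources(1)[OF J, where b = 1])
    show "norm (if s < interarrival P p x \<and> ?U x - s \<le> c \<and> ?U x - s + ?V b y \<le> c \<and> c < ?U x - s + ?V (Suc b) y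
      then damp \<omega> (c - (?U x - s)) else 0) \<le> 1" for x y
      using norm_exp_minus_le_1[OF \<omega>, of "c - (?U x - s)"] by auto
  qed (unfold case_prod_unfold, measurable)
  also have "\<dots> = (\<integral>x. (if s < interarrival P p x then ?G (?U x - s) else 0) \<partial>M)"
  proof (rule Bochner_Integration.integral_cong[OF refl])
    fix x
    show "(\<integral>y. (if s < interarrival P p x \<and> ?U x - s \<le> c \<and> ?U x - s + ?V b y \<le> c \<and> c < ?U x - s + ?V (Suc b) y
      then damp \<omega> (c - (?U x - s)) else 0) \<partial>M) = (if s < interarrival P p x then ?G (?U x - s) else 0)"
    proof (cases "s < interarrival P p x \<and> ?U x - s \<le> c")
      case True
      then show ?thesis
        using count[of "?U x - s" "damp \<omega> (c - (?U x - s))"]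
        by (simp add: scaleR_conv_of_real)
    qed auto
  qed
  also have "\<dots> = exp (- rate P * s) *\<^sub>R residual_kernel (rate P) \<omega> a b c"
    unfolding residual_kernel_def
    by (rule memoryless_interarrival_sum[OF s _ norm_residual_integrand[OF \<omega>]]) simp
  finally show ?thesis .
qed

lemma window_iff_sums:
  "window P m p (a + Suc b) x \<longleftrightarrow>
    0 \<le> truncated_gate P p m x - epoch P p x \<and>
    truncated_gate P p m x - epoch P p x < interarrival P p x \<and>
    interarrival_sum P p (Suc a) x - (truncated_gate P p m x - epoch P p x) + interarrival_sum P (p + Suc a) b x
      \<le> truncated_gate P p (Suc m) x - truncated_gate P p m x \<and>
    truncated_gate P p (Suc m) x - truncated_gate P p m x
      < interarrival_sum P p (Suc a) x - (truncated_gate P p m x - epoch P p x) + interarrival_sum P (p + Suc a) (Suc b) x"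
proof -
  have "epoch P (p + (a + Suc b)) x = epoch P p x + interarrival_sum P p (Suc a) x + interarrival_sum P (p + Suc a) b x"
    using epoch_eq_interarrival_sum[of P p "Suc a + b" x] interarrival_sum_add[of P p "Suc a" b x] by simp
  moreover have "epoch P (Suc (p + (a + Suc b))) x = epoch P p x + interarrival_sum P p (Suc a) x + interarrival_sum P (p + Suc a) (Suc b) x"
    using epoch_eq_interarrival_sum[of P p "Suc a + Suc b" x] interarrival_sum_add[of P p "Suc a" "Suc b" x] by simp
  ultimately show ?thesis
    unfolding window_def by (simp only: epoch_Suc) linarith
qed

text \<open>
  The factor \<open>exp (- rate P * s)\<close> from the memoryless property is itself the probability that batch
  \<open>p\<close> has not arrived by the start of the cycle. Reinserting it as an event turns the truncated cycle
  back into the true one, so that the right-hand side can be summed over \<open>p\<close>.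
\<close>

lemma integral_residual_window:
  assumes \<omega>: "0 \<le> Re \<omega>"
  shows "(\<integral>x. (if window P m p (a + Suc b) x
        then damp \<omega> (truncated_gate P p (Suc m) x - epoch P (Suc (p + a)) x) else 0) \<partial>M)
    = (\<integral>x. (if epoch P p x \<le> gate P m x \<and> gate P m x < epoch P (Suc p) x
        then residual_kernel (rate P) \<omega> a b (cycle_length P m x) else 0) \<partial>M)"
proof -
  let ?J1 = "past_sources P p m" and ?J2 = "Interarrival ` {p..}"
  have J: "?J1 \<subseteq> sources (nq P)" "?J2 \<subseteq> sources (nq P)" "?J1 \<inter> ?J2 = {}"
    using past_sources_subset by (auto simp: past_sources_def) (auto simp: sources_def)
  \<comment> \<open>\<open>s\<close> is the age of the current interarrival time at the start of the cycle, \<open>c\<close> the length of the cycle.\<close>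
  define s where "s x = truncated_gate P p m x - epoch P p x" for x
  define c where "c x = truncated_gate P p (Suc m) x - truncated_gate P p m x" for x
  let ?U = "interarrival_sum P p (Suc a)" and ?V = "interarrival_sum P (p + Suc a)"
  have [measurable]: "truncated_gate P p m \<in> borel_measurable (source_algebra P ?J1)"
      "truncated_gate P p (Suc m) \<in> borel_measurable (source_algebra P ?J1)"
      "epoch P p \<in> borel_measurable (source_algebra P ?J1)"
    by (rule measurable_truncated_gate_source'[OF order_refl] measurable_truncated_gate_source[OF order_refl]
        measurable_epoch_source, (simp add: past_sources_def; blast)?)+
  have [measurable]: "s \<in> borel_measurable (source_algebra P ?J1)" "c \<in> borel_measurable (source_algebra P ?J1)"
    unfolding s_def[abs_def] c_def[abs_def] by simp_all
  have [measurable]: "s \<in> borel_measurable M" "c \<in> borel_measurable M"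
    unfolding s_def[abs_def] c_def[abs_def] by simp_all
  have [measurable]: "?U \<in> borel_measurable (source_algebra P ?J2)"
    "interarrival P p \<in> borel_measurable (source_algebra P ?J2)"
    "?V b \<in> borel_measurable (source_algebra P ?J2)" "?V (Suc b) \<in> borel_measurable (source_algebra P ?J2)"
    by (auto intro!: measurable_interarrival_sum_source measurable_interarrival_source)
  \<comment> \<open>The past enters through \<open>x\<close>, the interarrival times from \<open>p\<close> on through \<open>y\<close>.  The condition
    \<open>?U y - s x \<le> c x\<close> is implied almost surely; it makes the integrand bounded everywhere.\<close>
  let ?f = "\<lambda>x y. if 0 \<le> s x \<and> s x < interarrival P p y \<and> ?U y - s x \<le> c x
        \<and> ?U y - s x + ?V b y \<le> c x \<and> c x < ?U y - s x + ?V (Suc b) y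
      then damp \<omega> (c x - (?U y - s x)) else 0"
  let ?K = "residual_kernel (rate P) \<omega> a b"
  have [measurable]: "Measurable.pred M (window P m p (a + Suc b))"
    unfolding window_def[abs_def] by measurable
  have epoch: "epoch P (Suc (p + a)) x = epoch P p x + ?U x" for x
    using epoch_eq_interarrival_sum[of P p "Suc a" x] by simp
  have "(\<integral>x. (if window P m p (a + Suc b) x
        then damp \<omega> (truncated_gate P p (Suc m) x - epoch P (Suc (p + a)) x) else 0) \<partial>M)
    = (\<integral>x. ?f x x \<partial>M)"
  proof (rule integral_cong_AE)
    show "AE x in M. (if window P m p (a + Suc b) x
        then damp \<omega> (truncated_gate P p (Suc m) x - epoch P (Suc (p + a)) x) else 0) = ?f x x"
      using AE_regular
    proof eventually_elim
      case (elim x)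
      have "window P m p (a + Suc b) x \<longleftrightarrow> 0 \<le> s x \<and> s x < interarrival P p x \<and> ?U x - s x \<le> c x
        \<and> ?U x - s x + ?V b x \<le> c x \<and> c x < ?U x - s x + ?V (Suc b) x"
        unfolding window_iff_sums s_def[symmetric] c_def[symmetric]
        using interarrival_sum_nonneg[OF elim, of "p + Suc a" b] by auto
      moreover have "truncated_gate P p (Suc m) x - epoch P (Suc (p + a)) x = c x - (?U x - s x)"
        by (simp add: epoch s_def c_def)
      ultimately show ?case
        by simp
    qed
  qed measurable
  also have "\<dots> = (\<integral>x. (\<integral>y. ?f x y \<partial>M) \<partial>M)"
  proof (rule integral_indep_sources(1)[OF J, where b = 1])
    show "norm (?f x y) \<le> 1" for x y
      using norm_exp_minus_le_1[OF \<omega>, of "c x - (?U y - s x)"] by auto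
  qed (unfold case_prod_unfold, measurable)
  also have "\<dots> = (\<integral>x. (if 0 \<le> s x then exp (- rate P * s x) *\<^sub>R ?K (c x) else 0) \<partial>M)"
  proof (rule Bochner_Integration.integral_cong[OF refl])
    show "(\<integral>y. ?f x y \<partial>M) = (if 0 \<le> s x then exp (- rate P * s x) *\<^sub>R ?K (c x) else 0)" for x
      using integral_arrival_given_cycle[OF \<omega>, of "s x" p a "c x" b] by auto
  qed
  also have "\<dots> = (\<integral>x. (\<integral>y. (if 0 \<le> s x \<and> s x < interarrival P p y then ?K (c x) else 0) \<partial>M) \<partial>M)"
  proof (rule Bochner_Integration.integral_cong[OF refl])
    show "(if 0 \<le> s x then exp (- rate P * s x) *\<^sub>R ?K (c x) else 0)
        = (\<integral>y. (if 0 \<le> s x \<and> s x < interarrival P p y then ?K (c x) else 0) \<partial>M)" for x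
      using exponential_overshoot[of "s x" "\<lambda>_. ?K (c x)" p] by (auto simp: prob_space)
  qed
  also have "\<dots> = (\<integral>x. (if 0 \<le> s x \<and> s x < interarrival P p x then ?K (c x) else 0) \<partial>M)"
    using norm_residual_kernel_le_1[OF \<omega>]
    by (intro integral_indep_sources(1)[OF J, where b = 1, symmetric]) (auto simp: case_prod_unfold)
  also have "\<dots> = (\<integral>x. (if epoch P p x \<le> gate P m x \<and> gate P m x < epoch P (Suc p) x
        then ?K (cycle_length P m x) else 0) \<partial>M)"
  proof (rule integral_cong_AE)
    show "AE x in M. (if 0 \<le> s x \<and> s x < interarrival P p x then ?K (c x) else 0)
      = (if epoch P p x \<le> gate P m x \<and> gate P m x < epoch P (Suc p) x then ?K (cycle_length P m x) else 0)"
      using AE_regular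
    proof eventually_elim
      case (elim x)
      have eq: "truncated_gate P p m x = gate P m x" "truncated_gate P p (Suc m) x = gate P (Suc m) x"
        if "gate P m x < epoch P (Suc p) x \<or> truncated_gate P p m x < epoch P (Suc p) x"
        using truncated_gate_eq[OF elim that] by auto
      have iff: "0 \<le> s x \<and> s x < interarrival P p x \<longleftrightarrow>
          epoch P p x \<le> truncated_gate P p m x \<and> truncated_gate P p m x < epoch P (Suc p) x"
        by (auto simp: s_def epoch_Suc)
      show ?case
      proof (cases "gate P m x < epoch P (Suc p) x \<or> truncated_gate P p m x < epoch P (Suc p) x")
        case True
        show ?thesis
          unfolding iff eq[OF True] c_def cycle_length_def ..
      next
        case False
        then show ?thesis
          unfolding iff by simp
      qed
    qed
  qed measurable
  finally show ?thesis .
qed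

end

section \<open>The law of the cycle length\<close>

lemma countable_finite_support:
  fixes A :: "'i set"
  assumes "finite A"
  shows "countable {k :: 'i \<Rightarrow> nat. \<forall>i. i \<notin> A \<longrightarrow> k i = 0}"
proof -
  have "{k :: 'i \<Rightarrow> nat. \<forall>i. i \<notin> A \<longrightarrow> k i = 0} \<subseteq> (\<lambda>f i. if i \<in> A then f i else 0) ` (PiE A (\<lambda>_. UNIV))"
  proof
    fix k :: "'i \<Rightarrow> nat" assume "k \<in> {k. \<forall>i. i \<notin> A \<longrightarrow> k i = 0}"
    then have "k = (\<lambda>i. if i \<in> A then restrict k A i else 0)"
      by (auto simp: fun_eq_iff)
    then show "k \<in> (\<lambda>f i. if i \<in> A then f i else 0) ` (PiE A (\<lambda>_. UNIV))"
      by (rule image_eqI[where x = "restrict k A"]) simp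
  qed
  moreover have "countable ((\<lambda>f i. if i \<in> A then f i else 0) ` (PiE A (\<lambda>_. UNIV :: nat set)))"
    using assms by (intro countable_image countable_PiE) auto
  ultimately show ?thesis
    by (rule countable_subset)
qed

context stationary_globally_gated
begin

lemma measurable_window_clock:
  "Measurable.pred (source_algebra P (clock_sources P m p)) (window P m p r)"
proof -
  have [measurable]: "truncated_gate P p m \<in> borel_measurable (source_algebra P (clock_sources P m p))"
    "truncated_gate P p (Suc m) \<in> borel_measurable (source_algebra P (clock_sources P m p))"
    by (rule measurable_truncated_gate_source' measurable_truncated_gate_source, simp add: clock_sources_def)+
  have [measurable]: "epoch P q \<in> borel_measurable (source_algebra P (clock_sources P m p))" for q
    by (rule measurable_epoch_source) (auto simp: clock_sources_def)
  show ?thesis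
    unfolding window_def[abs_def] by measurable
qed

lemma measurable_window [measurable]: "Measurable.pred M (window P m p r)"
  using measurable_source_algebra_imp[OF clock_sources_subset measurable_window_clock] .

lemma window_partition:
  assumes "regular_path P x" "x \<in> space M"
  shows "\<exists>i\<in>UNIV. x \<in> (\<lambda>(p, r). {x\<in>space M. window P m p r x}) i
    \<and> (\<forall>j\<in>UNIV. x \<in> (\<lambda>(p, r). {x\<in>space M. window P m p r x}) j \<longrightarrow> j = i)"
proof -
  obtain p r where w: "window P m p r x"
    using ex_window[OF assms(1)] by blast
  then show ?thesis
    using window_unique[OF assms(1)] assms(2) by (intro bexI[of _ "(p, r)"]) auto
qed

lemma integral_window_marks:
  fixes F g :: "'a \<Rightarrow> complex" and f :: "nat \<Rightarrow> 'a \<Rightarrow> complex"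
  assumes F: "F \<in> borel_measurable M"
    and f: "\<And>n. f n \<in> borel_measurable (source_algebra P (batch_sources P n))"
      "\<And>n. integrable M (f n)" "\<And>n. (\<integral>x. f n x \<partial>M) = z"
    and g: "g \<in> borel_measurable (source_algebra P (switch_sources P (Suc m)))" "integrable M g"
    and eq: "AE x in M. window P m p r x \<longrightarrow> F x = (\<Prod>n=p..<p+r. f n x) * g x"
  shows "(\<integral>x. indicator {x\<in>space M. window P m p r x} x *\<^sub>R F x \<partial>M)
    = complex_of_real (prob {x\<in>space M. window P m p r x}) * z ^ r * (\<integral>x. g x \<partial>M)"
proof -
  let ?A = "{x\<in>space M. window P m p r x}"
  have A0: "?A \<in> sets (source_algebra P (clock_sources P m p))"
    using measurable_window_clock[unfolded pred_def] by simp
  have A: "?A \<in> events"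
    by measurable
  have Y: "indicator ?A \<in> borel_measurable (source_algebra P (clock_sources P m p))"
    using A0 by (rule borel_measurable_indicator)
  have rv: "f n \<in> borel_measurable M" "g \<in> borel_measurable M" for n
    using f(2) g(2) by auto
  have "(\<integral>x. indicator ?A x *\<^sub>R F x \<partial>M) = (\<integral>x. indicator ?A x * (\<Prod>n=p..<p+r. f n x) * g x \<partial>M)"
  proof (rule integral_cong_AE)
    show "AE x in M. indicator ?A x *\<^sub>R F x = indicator ?A x * (\<Prod>n=p..<p+r. f n x) * g x"
      using eq by eventually_elim (auto simp: indicator_def)
    show "(\<lambda>x. indicator ?A x * (\<Prod>n=p..<p+r. f n x) * g x) \<in> borel_measurable M"
      using rv A by (intro borel_measurable_times borel_measurable_prod borel_measurable_indicator) auto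
  qed (use F A in \<open>auto intro!: borel_measurable_scaleR\<close>)
  also have "\<dots> = (\<integral>x. indicator ?A x \<partial>M) * (\<Prod>n=p..<p+r. \<integral>x. f n x \<partial>M) * (\<integral>x. g x \<partial>M)"
    by (rule integral_marks[OF Y _ f(1,2) g])
      (use A in \<open>auto intro!: integrable_const_bound[where B = 1] simp: indicator_def\<close>)
  also have "(\<integral>x. indicator ?A x \<partial>M) = complex_of_real (prob ?A)"
  proof -
    have "(\<integral>x. indicator ?A x \<partial>M) = (\<integral>x. complex_of_real (indicator ?A x) \<partial>M)"
      by (intro Bochner_Integration.integral_cong) (auto simp: indicator_def)
    then show ?thesis
      using A by simp
  qed
  finally show ?thesis
    by (simp add: f(3))
qed

text \<open>
  Used twice with the same marginal transform of a batch, once for the work and once for the numbers of customers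
  in the next cycle.
\<close>

lemma has_sum_window_marks:
  fixes F g :: "'a \<Rightarrow> complex" and f :: "nat \<Rightarrow> 'a \<Rightarrow> complex"
  assumes F: "integrable M F"
    and f: "\<And>n. f n \<in> borel_measurable (source_algebra P (batch_sources P n))"
      "\<And>n. integrable M (f n)" "\<And>n. (\<integral>x. f n x \<partial>M) = z"
    and g: "g \<in> borel_measurable (source_algebra P (switch_sources P (Suc m)))" "integrable M g"
    and eq: "\<And>p r. AE x in M. window P m p r x \<longrightarrow> F x = (\<Prod>n=p..<p+r. f n x) * g x"
  shows "((\<lambda>(p, r). complex_of_real (prob {x\<in>space M. window P m p r x}) * z ^ r * (\<integral>x. g x \<partial>M))
    has_sum (\<integral>x. F x \<partial>M)) UNIV"
proof -
  have "((\<lambda>i. \<integral>x. indicator ((\<lambda>(p, r). {x\<in>space M. window P m p r x}) i) x *\<^sub>R F x \<partial>M)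
      has_sum (\<integral>x. F x \<partial>M)) UNIV"
  proof (rule integral_countable_partition[OF sigma_finite_measure_axioms _ F])
    show "(\<lambda>(p, r). {x\<in>space M. window P m p r x}) i \<in> events" for i
      by (cases i) simp
    show "AE x in M. F x \<noteq> 0 \<longrightarrow> (\<exists>i\<in>UNIV. x \<in> (\<lambda>(p, r). {x\<in>space M. window P m p r x}) i
        \<and> (\<forall>j\<in>UNIV. x \<in> (\<lambda>(p, r). {x\<in>space M. window P m p r x}) j \<longrightarrow> j = i))"
      using AE_regular AE_space by eventually_elim (blast intro: window_partition)
  qed simp
  moreover have "(\<lambda>i. \<integral>x. indicator ((\<lambda>(p, r). {x\<in>space M. window P m p r x}) i) x *\<^sub>R F x \<partial>M)
      = (\<lambda>(p, r). complex_of_real (prob {x\<in>space M. window P m p r x}) * z ^ r * (\<integral>x. g x \<partial>M))"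
    using F by (auto simp: fun_eq_iff integral_window_marks[OF _ f g eq])
  ultimately show ?thesis
    by simp
qed

abbreviation contents :: "(nat \<Rightarrow> nat) set" where
  "contents \<equiv> {k. \<forall>i. i \<notin> {1..nq P} \<longrightarrow> k i = 0}"

lemma countable_contents: "countable contents"
  by (rule countable_finite_support) simp

lemma queue_content_Suc: "queue_content P (Suc m) x i = (\<Sum>n\<in>arrivals P m x. batch_size P n x i)"
  by (simp add: queue_content_def)

lemma queue_content_0: "queue_content P 0 x = init_content P x"
  by (simp add: queue_content_def fun_eq_iff)

lemma measurable_queue_content [measurable]:
  "(\<lambda>x. queue_content P m x i) \<in> measurable M (count_space UNIV)"
proof (cases m)
  case 0
  show ?thesis
    unfolding 0 queue_content_0 by (rule measurable_compose[OF rv_init_content]) simp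
next
  case (Suc m')
  have size: "(\<lambda>x. batch_size P n x i) \<in> measurable M (count_space UNIV)" for n
    by (rule measurable_compose[OF rv_batch_size]) simp
  have "(\<lambda>x. \<Sum>n\<in>arrivals P m' x. real (batch_size P n x i)) \<in> borel_measurable M"
  proof (rule borel_measurable_random_sum)
    show "(\<lambda>x. real (batch_size P n x i)) \<in> borel_measurable M" for n
      using size by (rule measurable_compose) simp
    show "Measurable.pred M (\<lambda>x. n \<in> arrivals P m' x)" for n
      unfolding arrivals_def batches_in_def arrival_epoch_eq mem_Collect_eq by measurable
  qed
  then have 1: "(\<lambda>x. real (queue_content P m x i)) \<in> borel_measurable M"
    by (simp add: Suc queue_content_Suc)
  have "(\<lambda>x. queue_content P m x i) = (\<lambda>x. nat \<lfloor>real (queue_content P m x i)\<rfloor>)"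
    by simp
  also have "\<dots> \<in> measurable M (count_space UNIV)"
    using 1 by measurable
  finally show ?thesis .
qed

lemma measurable_queue_content_eq [measurable]: "Measurable.pred M (\<lambda>x. queue_content P m x = k)"
  unfolding fun_eq_iff by measurable

lemma AE_queue_content_Suc: "AE x in M. queue_content P (Suc m) x \<in> contents"
  using AE_regular
proof eventually_elim
  case (elim x)
  then have "batch_size P n x i = 0" if "i \<notin> {1..nq P}" for n i
    using batch_support that by (auto simp: regular_path_def)
  then show ?case
    by (auto simp: queue_content_Suc)
qed

lemma content_partition:
  fixes F :: "'a \<Rightarrow> 'b::{banach, second_countable_topology}"
  assumes F: "integrable M F" and cover: "AE x in M. F x \<noteq> 0 \<longrightarrow> queue_content P m x \<in> contents"
  shows "((\<lambda>k. \<integral>x. indicator {x\<in>space M. queue_content P m x = k} x *\<^sub>R F x \<partial>M) has_sum (\<integral>x. F x \<partial>M)) contents"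
proof (rule integral_countable_partition[OF sigma_finite_measure_axioms countable_contents F])
  show "AE x in M. F x \<noteq> 0 \<longrightarrow> (\<exists>i\<in>contents. x \<in> {x\<in>space M. queue_content P m x = i}
      \<and> (\<forall>j\<in>contents. x \<in> {x\<in>space M. queue_content P m x = j} \<longrightarrow> j = i))"
    using cover AE_space by eventually_elim auto
qed measurable

text \<open>
  The law of the initial content is not assumed to be discrete. It is, because it coincides with the law of the
  contents at the next cycle start, which are sums of batch sizes.
\<close>

lemma AE_queue_content: "AE x in M. queue_content P m x \<in> contents"
proof (cases m)
  case 0
  let ?A = "{x\<in>space M. queue_content P 0 x \<in> contents}"
  have A [measurable]: "?A \<in> events"
  proof -
    have "?A = (\<Union>k\<in>contents. {x\<in>space M. queue_content P 0 x = k})"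
      by auto
    also have "\<dots> \<in> events"
    proof (rule sets.countable_UN'[OF countable_contents])
      have "{x\<in>space M. queue_content P 0 x = k} \<in> events" for k
        by measurable
      then show "(\<lambda>k. {x\<in>space M. queue_content P 0 x = k}) ` contents \<subseteq> events"
        by blast
    qed
    finally show ?thesis .
  qed
  have has_sum_A: "((\<lambda>k. prob {x\<in>space M. queue_content P 0 x = k}) has_sum prob ?A) contents"
  proof -
    have "((\<lambda>k. \<integral>x. indicator {x\<in>space M. queue_content P 0 x = k} x *\<^sub>R indicator ?A x \<partial>M)
        has_sum (\<integral>x. indicat_real ?A x \<partial>M)) contents"
    proof (rule content_partition)
      show "integrable M (indicat_real ?A)"
        by (rule integrable_real_indicator[OF A]) (simp add: emeasure_eq_measure)
    qed (auto simp: indicator_def)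
    also have "?this \<longleftrightarrow> ((\<lambda>k. prob {x\<in>space M. queue_content P 0 x = k}) has_sum (\<integral>x. indicat_real ?A x \<partial>M)) contents"
    proof (rule has_sum_cong)
      fix k assume "k \<in> contents"
      then have "(\<integral>x. indicator {x\<in>space M. queue_content P 0 x = k} x *\<^sub>R indicat_real ?A x \<partial>M)
          = (\<integral>x. indicat_real {x\<in>space M. queue_content P 0 x = k} x \<partial>M)"
        by (intro Bochner_Integration.integral_cong) (auto simp: indicator_def)
      then show "(\<integral>x. indicator {x\<in>space M. queue_content P 0 x = k} x *\<^sub>R indicat_real ?A x \<partial>M)
          = prob {x\<in>space M. queue_content P 0 x = k}"
        by simp
    qed
    finally show ?thesis
      by simp
  qed
  have "((\<lambda>k. \<integral>x. indicator {x\<in>space M. queue_content P (Suc 0) x = k} x *\<^sub>R (1::real) \<partial>M)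
      has_sum (\<integral>x. 1 \<partial>M)) contents"
    using AE_queue_content_Suc[of 0] by (intro content_partition) (auto elim: AE_mp)
  then have 1: "((\<lambda>k. prob {x\<in>space M. queue_content P 0 x = k}) has_sum 1) contents"
    by (simp add: prob_space stationary[of "Suc 0"])
  have "prob ?A = 1"
    using has_sum_unique[OF has_sum_A 1] .
  then have "AE x in M. x \<in> ?A"
    by (rule AE_prob_1)
  then show ?thesis
    unfolding 0 by eventually_elim auto
qed (simp only: AE_queue_content_Suc)

text \<open>
  The transform of the work found at a cycle start, given that \<open>k i\<close> customers are in queue
  \<open>i\<close>.
\<close>

definition content_transform :: "complex \<Rightarrow> (nat \<Rightarrow> nat) \<Rightarrow> complex" where
  "content_transform \<omega> k = (\<Prod>i=1..nq P. lst (service_law P i) \<omega> ^ k i)"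

lemma norm_content_transform: "0 \<le> Re \<omega> \<Longrightarrow> norm (content_transform \<omega> k) \<le> 1"
  unfolding content_transform_def prod_norm[symmetric]
  using norm_service_lst_le_1[of \<omega>] by (intro prod_le_1) (auto simp: norm_power intro!: power_le_one)

lemma measurable_content_transform [measurable]:
  "(\<lambda>x. content_transform \<omega> (queue_content P m x)) \<in> borel_measurable M"
  unfolding content_transform_def
proof (rule borel_measurable_prod)
  fix i
  show "(\<lambda>x. lst (service_law P i) \<omega> ^ queue_content P m x i) \<in> borel_measurable M"
    by (rule measurable_compose[OF measurable_queue_content]) simp
qed

lemma has_sum_content_transform:
  assumes \<omega>: "0 \<le> Re \<omega>"
  shows "((\<lambda>k. prob {x\<in>space M. queue_content P m x = k} *\<^sub>R content_transform \<omega> k) has_sum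
    (\<integral>x. content_transform \<omega> (queue_content P m x) \<partial>M)) contents"
proof -
  have "((\<lambda>k. \<integral>x. indicator {x\<in>space M. queue_content P m x = k} x *\<^sub>R content_transform \<omega> (queue_content P m x) \<partial>M)
      has_sum (\<integral>x. content_transform \<omega> (queue_content P m x) \<partial>M)) contents"
    using AE_queue_content[of m] norm_content_transform[OF \<omega>]
    by (intro content_partition integrable_const_bound[where B = 1]) (auto elim: AE_mp)
  moreover have "(\<integral>x. indicator {x\<in>space M. queue_content P m x = k} x *\<^sub>R content_transform \<omega> (queue_content P m x) \<partial>M)
      = prob {x\<in>space M. queue_content P m x = k} *\<^sub>R content_transform \<omega> k" for k
  proof -
    let ?A = "{x\<in>space M. queue_content P m x = k}"
    have A: "?A \<in> events" "integrable M (indicat_real ?A)"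
      by (auto simp: integrable_indicator_iff emeasure_eq_measure)
    have "(\<integral>x. indicator ?A x *\<^sub>R content_transform \<omega> (queue_content P m x) \<partial>M)
        = (\<integral>x. indicator ?A x *\<^sub>R content_transform \<omega> k \<partial>M)"
      by (intro Bochner_Integration.integral_cong) (auto simp: indicator_def)
    also have "\<dots> = prob ?A *\<^sub>R content_transform \<omega> k"
      using A by (subst integral_scaleR_left) auto
    finally show ?thesis .
  qed
  ultimately show ?thesis
    by simp
qed

lemma content_transform_stationary:
  assumes \<omega>: "0 \<le> Re \<omega>"
  shows "(\<integral>x. content_transform \<omega> (queue_content P m x) \<partial>M) = (\<integral>x. content_transform \<omega> (queue_content P 0 x) \<partial>M)"
  using has_sum_unique[OF has_sum_content_transform[OF \<omega>, of m]] has_sum_content_transform[OF \<omega>, of 0]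
  by (simp add: stationary[of m])

lemma rv_switchover_sum: "L \<subseteq> {1..nq P} \<Longrightarrow> (\<lambda>x. \<Sum>l\<in>L. switchover P m l x) \<in> borel_measurable (source_algebra P (switch_sources P m))"
  by (intro borel_measurable_sum measurable_switchover_source) (auto simp: switch_sources_def)

lemma integrable_switchovers:
  assumes "0 \<le> Re \<omega>" "L \<subseteq> {1..nq P}"
  shows "integrable M (\<lambda>x. damp \<omega> (\<Sum>l\<in>L. switchover P m l x))"
proof (rule integrable_damped[OF assms(1)])
  show "(\<lambda>x. \<Sum>l\<in>L. switchover P m l x) \<in> borel_measurable M"
    by (rule measurable_source_algebra_imp[OF switch_sources_subset rv_switchover_sum[OF assms(2)]])
  show "AE x in M. 0 \<le> (\<Sum>l\<in>L. switchover P m l x)"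
    using AE_regular by eventually_elim (use assms in \<open>auto intro!: sum_nonneg switchover_nonneg\<close>)
qed

lemma measurable_batch_work_sum_source:
  "L \<subseteq> {1..nq P} \<Longrightarrow> (\<lambda>x. \<Sum>l\<in>L. batch_work P n l x) \<in> borel_measurable (source_algebra P (batch_sources P n))"
  by (intro borel_measurable_sum measurable_batch_work_source) auto

lemma integrable_batch_work:
  assumes "0 \<le> Re \<omega>" "L \<subseteq> {1..nq P}"
  shows "integrable M (\<lambda>x. damp \<omega> (\<Sum>l\<in>L. batch_work P n l x))"
proof (rule integrable_damped[OF assms(1)])
  show "(\<lambda>x. \<Sum>l\<in>L. batch_work P n l x) \<in> borel_measurable M"
    by (rule measurable_source_algebra_imp[OF batch_sources_subset measurable_batch_work_sum_source[OF assms(2)]])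
  show "AE x in M. 0 \<le> (\<Sum>l\<in>L. batch_work P n l x)"
    using AE_regular by eventually_elim (use assms in \<open>auto intro!: sum_nonneg batch_work_nonneg\<close>)
qed

lemma AE_cycle_length_nonneg: "AE x in M. 0 \<le> cycle_length P m x"
  using AE_regular by eventually_elim (rule cycle_length_nonneg)

lemma integrable_damped_cycle:
  "0 \<le> Re \<omega> \<Longrightarrow> integrable M (\<lambda>x. damp \<omega> (cycle_length P m x))"
  by (rule integrable_damped[OF _ rv_cycle_length AE_cycle_length_nonneg])

lemma batch_pgf_all_queues:
  "batch_pgf P (\<lambda>l. if l \<in> {1..nq P} then lst (service_law P l) \<omega> else 1)
    = measure_pmf.expectation (batch_pmf P) (content_transform \<omega>)"
  unfolding batch_pgf_def content_transform_def[abs_def]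
  by (intro Bochner_Integration.integral_cong prod.cong) auto

lemma has_sum_next_cycle_transform:
  assumes \<omega>: "0 \<le> Re \<omega>"
  shows "((\<lambda>(p, r). complex_of_real (prob {x\<in>space M. window P m p r x})
      * measure_pmf.expectation (batch_pmf P) (content_transform \<omega>) ^ r
      * (\<Prod>i=1..nq P. lst (switch_law P i) \<omega>))
    has_sum (\<integral>x. damp \<omega> (cycle_length P (Suc m) x) \<partial>M)) UNIV"
  unfolding integral_switchovers[OF \<omega> order_refl, of "Suc m", symmetric]
proof (rule has_sum_window_marks)
  have [measurable]: "(\<lambda>x. \<Sum>l=1..nq P. batch_work P n l x) \<in> borel_measurable (source_algebra P (batch_sources P n))" for n
    by (rule measurable_batch_work_sum_source) simp
  show "(\<lambda>x. damp \<omega> (\<Sum>l=1..nq P. batch_work P n l x))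
      \<in> borel_measurable (source_algebra P (batch_sources P n))" for n
    by measurable
  have [measurable]: "(\<lambda>x. \<Sum>l=1..nq P. switchover P (Suc m) l x) \<in> borel_measurable (source_algebra P (switch_sources P (Suc m)))"
    by (rule rv_switchover_sum) simp
  show "(\<lambda>x. damp \<omega> (\<Sum>l=1..nq P. switchover P (Suc m) l x))
      \<in> borel_measurable (source_algebra P (switch_sources P (Suc m)))"
    by measurable
  show "(\<integral>x. damp \<omega> (\<Sum>l=1..nq P. batch_work P n l x) \<partial>M)
      = measure_pmf.expectation (batch_pmf P) (content_transform \<omega>)" for n
    unfolding batch_pgf_all_queues[symmetric] by (rule integral_batch_work[OF \<omega> order_refl])
  show "AE x in M. window P m p r x \<longrightarrow> damp \<omega> (cycle_length P (Suc m) x)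
      = (\<Prod>n=p..<p+r. damp \<omega> (\<Sum>l=1..nq P. batch_work P n l x))
        * damp \<omega> (\<Sum>l=1..nq P. switchover P (Suc m) l x)" for p r
    using AE_regular
  proof eventually_elim
    case (elim x)
    show ?case
      by (auto simp: next_cycle_length_window[OF elim] exp_sum[symmetric] exp_add[symmetric] sum_negf
          sum_distrib_left algebra_simps)
  qed
qed (intro integrable_damped_cycle integrable_batch_work integrable_switchovers \<omega> order_refl)+

lemma has_sum_next_content_transform:
  assumes \<omega>: "0 \<le> Re \<omega>"
  shows "((\<lambda>(p, r). complex_of_real (prob {x\<in>space M. window P m p r x})
      * measure_pmf.expectation (batch_pmf P) (content_transform \<omega>) ^ r)
    has_sum (\<integral>x. content_transform \<omega> (queue_content P (Suc m) x) \<partial>M)) UNIV"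
proof -
  have size: "batch_size P n \<in> measurable (source_algebra P (batch_sources P n)) (count_space UNIV)" for n
    by (rule measurable_batch_size_source) (simp add: batch_sources_def)
  have "((\<lambda>(p, r). complex_of_real (prob {x\<in>space M. window P m p r x})
      * measure_pmf.expectation (batch_pmf P) (content_transform \<omega>) ^ r * (\<integral>x. 1 \<partial>M))
    has_sum (\<integral>x. content_transform \<omega> (queue_content P (Suc m) x) \<partial>M)) UNIV"
  proof (rule has_sum_window_marks)
    show "integrable M (\<lambda>x. content_transform \<omega> (queue_content P (Suc m) x))"
      using norm_content_transform[OF \<omega>] by (intro integrable_const_bound[where B = 1]) auto
    show "(\<lambda>x. content_transform \<omega> (batch_size P n x)) \<in> borel_measurable (source_algebra P (batch_sources P n))" for n
      by (rule measurable_compose[OF size]) simp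
    show "integrable M (\<lambda>x. content_transform \<omega> (batch_size P n x))" for n
      using norm_content_transform[OF \<omega>]
      by (intro integrable_const_bound[where B = 1]) (auto intro!: measurable_compose[OF rv_batch_size])
    show "(\<integral>x. content_transform \<omega> (batch_size P n x) \<partial>M)
        = measure_pmf.expectation (batch_pmf P) (content_transform \<omega>)" for n
      unfolding batch_size_distr[of n, symmetric] by (subst integral_distr) auto
    show "AE x in M. window P m p r x \<longrightarrow> content_transform \<omega> (queue_content P (Suc m) x)
        = (\<Prod>n=p..<p+r. content_transform \<omega> (batch_size P n x)) * 1" for p r
      using AE_regular
    proof eventually_elim
      case (elim x)
      show ?case
        by (auto simp: content_transform_def queue_content_Suc arrivals_window[OF elim] power_sum
            prod.swap[of _ "{Suc 0..nq P}"])
    qed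
  qed simp_all
  then show ?thesis
    by (simp add: prob_space)
qed

text \<open>
  Up to the switch-over times, both expectations are the same sum over windows: a batch contributes the same
  factor, whether its work is damped or its customers are replaced by transforms of service times.
\<close>

lemma transform_next_cycle:
  assumes \<omega>: "0 \<le> Re \<omega>"
  shows "(\<integral>x. damp \<omega> (cycle_length P (Suc m) x) \<partial>M)
    = (\<integral>x. content_transform \<omega> (queue_content P (Suc m) x) \<partial>M) * (\<Prod>i=1..nq P. lst (switch_law P i) \<omega>)"
  by (rule has_sum_unique[OF has_sum_next_cycle_transform[OF \<omega>]])
    (use has_sum_cmult_left[OF has_sum_next_content_transform[OF \<omega>, of m]] in \<open>simp add: case_prod_unfold\<close>)

lemma transform_first_cycle:
  assumes \<omega>: "0 \<le> Re \<omega>"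
  shows "(\<integral>x. damp \<omega> (cycle_length P 0 x) \<partial>M)
    = (\<integral>x. content_transform \<omega> (queue_content P 0 x) \<partial>M) * (\<Prod>i=1..nq P. lst (switch_law P i) \<omega>)"
proof -
  let ?W = "\<lambda>x. \<Sum>l=1..nq P. init_work P l x" and ?S = "\<lambda>x. \<Sum>l=1..nq P. switchover P 0 l x"
  let ?J = "{Init_Content} \<union> {Init_Service i c | i c. i \<in> {1..nq P}}"
  have J: "?J \<subseteq> sources (nq P)"
    by (auto simp: sources_def)
  have W: "?W \<in> borel_measurable (source_algebra P ?J)"
    by (intro borel_measurable_sum measurable_init_work_source) auto
  note [measurable] = W rv_switchover_sum[OF order_refl, of 0]
  have rvW: "?W \<in> borel_measurable M"
    by (rule measurable_source_algebra_imp[OF J W])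
  have intW: "integrable M (\<lambda>x. damp \<omega> (?W x))"
  proof (rule integrable_damped[OF \<omega> rvW])
    show "AE x in M. 0 \<le> ?W x"
      using AE_regular by eventually_elim (auto intro!: sum_nonneg init_work_nonneg)
  qed
  have ind: "indep_var borel (\<lambda>x. damp \<omega> (?W x)) borel (\<lambda>x. damp \<omega> (?S x))"
  proof -
    have "indep_vars (\<lambda>_. borel) (case_bool (\<lambda>x. damp \<omega> (?W x)) (\<lambda>x. damp \<omega> (?S x))) UNIV"
    proof (rule indep_vars_of_sources[where J = "case_bool ?J (switch_sources P 0)"])
      show "case_bool ?J (switch_sources P 0) b \<subseteq> sources (nq P)" for b
        using J switch_sources_subset by (cases b) auto
      show "disjoint_family_on (case_bool ?J (switch_sources P 0)) UNIV"
        by (auto simp: disjoint_family_on_def switch_sources_def split: bool.splits)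
      show "case_bool (\<lambda>x. damp \<omega> (?W x)) (\<lambda>x. damp \<omega> (?S x)) b
          \<in> borel_measurable (source_algebra P (case_bool ?J (switch_sources P 0) b))" for b
        by (cases b) (simp_all only: bool.case, measurable)
    qed
    then show ?thesis
      unfolding indep_var_def
      by (rule indep_vars_cong[THEN iffD1, rotated -1]) (auto split: bool.splits)
  qed
  have "(\<integral>x. damp \<omega> (cycle_length P 0 x) \<partial>M)
      = (\<integral>x. damp \<omega> (?W x) * damp \<omega> (?S x) \<partial>M)"
    by (simp add: cycle_length_eq gated_work_0 sum.distrib exp_add[symmetric] algebra_simps)
  also have "\<dots> = (\<integral>x. damp \<omega> (?W x) \<partial>M) * (\<integral>x. damp \<omega> (?S x) \<partial>M)"
    by (rule indep_var_lebesgue_integral[OF ind intW integrable_switchovers[OF \<omega> order_refl]])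
  also have "(\<integral>x. damp \<omega> (?S x) \<partial>M) = (\<Prod>i=1..nq P. lst (switch_law P i) \<omega>)"
    by (rule integral_switchovers[OF \<omega> order_refl])
  also have "(\<integral>x. damp \<omega> (?W x) \<partial>M) = (\<integral>x. content_transform \<omega> (queue_content P 0 x) \<partial>M)"
  proof (rule has_sum_unique)
    have "((\<lambda>k. \<integral>x. indicator {x\<in>space M. queue_content P 0 x = k} x *\<^sub>R damp \<omega> (?W x) \<partial>M)
        has_sum (\<integral>x. damp \<omega> (?W x) \<partial>M)) contents"
      using AE_queue_content[of 0] by (intro content_partition intW) (auto elim: AE_mp)
    moreover have "indicator A x *\<^sub>R w = indicator A x * w" for A :: "'a set" and x and w :: complex
      by (simp add: indicator_def)
    ultimately show "((\<lambda>k. prob {x\<in>space M. queue_content P 0 x = k} *\<^sub>R content_transform \<omega> k)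
        has_sum (\<integral>x. damp \<omega> (?W x) \<partial>M)) contents"
      by (simp only: queue_content_0 integral_init_content_services[OF \<omega> order_refl]
          content_transform_def scaleR_conv_of_real)
  qed (rule has_sum_content_transform[OF \<omega>])
  finally show ?thesis .
qed

lemma transform_cycle_stationary:
  assumes "0 \<le> Re \<omega>"
  shows "(\<integral>x. damp \<omega> (cycle_length P m x) \<partial>M)
    = (\<integral>x. damp \<omega> (cycle_length P 0 x) \<partial>M)"
  using content_transform_stationary[OF assms, of m]
  by (cases m) (simp_all only: transform_next_cycle[OF assms] transform_first_cycle[OF assms])

text \<open>
  The service and switch-over laws being fixed, the transform is a function of the law of the queue contents,
  which is stationary; on the imaginary axis it is the characteristic function.
\<close>

lemma distr_cycle_length: "distr M borel (cycle_length P m) = distr M borel (cycle_length P 0)"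
proof (rule Levy_uniqueness)
  show "real_distribution (distr M borel (cycle_length P m))" for m
    by (rule real_distribution_distr) simp
  have "char (distr M borel (cycle_length P m)) t = (\<integral>x. exp (- (- \<i> * t) * complex_of_real (cycle_length P m x)) \<partial>M)" for m t
    unfolding char_def by (subst integral_distr) (auto simp: mult.assoc)
  then show "char (distr M borel (cycle_length P m)) = char (distr M borel (cycle_length P 0))"
    using transform_cycle_stationary[of "- \<i> * complex_of_real t" for t] by (auto simp: fun_eq_iff)
qed (rule real_distribution_distr, simp)

end

section \<open>Bounds on transforms\<close>

text \<open>
  The derivative of \<open>exp\<close> is bounded by 1 in the left half-plane, which is convex.
\<close>

lemma norm_exp_minus_1_le:
  fixes z :: complex
  assumes "Re z \<le> 0"
  shows "norm (exp z - 1) \<le> norm z"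
proof -
  have "norm (exp z - exp 0) \<le> 1 * norm (z - 0)"
  proof (rule field_differentiable_bound[where S = "{z. Re z \<le> 0}" and f' = exp])
    show "convex {z. Re z \<le> 0}"
      by (rule convex_halfspace_Re_le)
  qed (use assms in \<open>auto intro!: derivative_eq_intros\<close>)
  then show ?thesis
    by simp
qed

lemma norm_1_minus_lst_le:
  assumes \<mu>: "nonneg_law \<mu>" and \<omega>: "0 \<le> Re \<omega>"
  shows "norm (1 - lst \<mu> \<omega>) \<le> norm \<omega> * (LINT t|\<mu>. t)"
proof -
  interpret prob_space \<mu>
    using \<mu> by (simp add: nonneg_law_def)
  have [measurable_cong]: "sets \<mu> = sets borel" and AE: "AE t in \<mu>. 0 \<le> t" and int: "integrable \<mu> (\<lambda>t. t)"
    using \<mu> by (auto simp: nonneg_law_def)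
  have int': "integrable \<mu> (\<lambda>t. damp \<omega> t)"
  proof (rule integrable_const_bound)
    show "AE t in \<mu>. norm (damp \<omega> t) \<le> 1"
      using AE by eventually_elim (rule norm_exp_minus_le_1[OF \<omega>])
  qed measurable
  have "1 - lst \<mu> \<omega> = (\<integral>t. 1 - damp \<omega> t \<partial>\<mu>)"
    unfolding lst_def using int' by (subst Bochner_Integration.integral_diff) (auto simp: prob_space)
  also have "norm \<dots> \<le> (\<integral>t. norm (1 - damp \<omega> t) \<partial>\<mu>)"
    by (rule integral_norm_bound)
  also have "\<dots> \<le> (\<integral>t. norm \<omega> * t \<partial>\<mu>)"
  proof (rule integral_mono_AE)
    show "AE t in \<mu>. norm (1 - damp \<omega> t) \<le> norm \<omega> * t"
      using AE
    proof eventually_elim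
      case (elim t)
      have "norm (damp \<omega> t - 1) \<le> norm (- \<omega> * complex_of_real t)"
        using \<omega> elim by (intro norm_exp_minus_1_le) simp
      then show ?case
        using elim by (simp add: norm_mult norm_minus_commute)
    qed
  qed (use int int' in auto)
  finally show ?thesis
    by simp
qed

lemma poisson_weight_sums_1: "poisson_weight t sums 1"
proof -
  have "(\<lambda>k. complex_of_real (poisson_weight t k)) sums complex_of_real 1"
    using poisson_weight_sums[of t 1] by simp
  then show ?thesis
    by (simp only: sums_of_real_iff)
qed

lemma nn_integral_poisson_weight:
  assumes "0 \<le> t"
  shows "(\<integral>\<^sup>+k. ennreal (poisson_weight t k) \<partial>count_space UNIV) = 1"
  using suminf_ennreal_eq[OF poisson_weight_nonneg[OF assms] poisson_weight_sums_1]
  by (simp add: nn_integral_count_space_nat)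

lemma integrable_poisson_weight:
  fixes z :: complex
  assumes "0 \<le> t" "norm z \<le> 1"
  shows "integrable (count_space UNIV) (\<lambda>k. of_real (poisson_weight t k) * z ^ k)"
proof -
  have "summable (\<lambda>k. norm (of_real (poisson_weight t k) * z ^ k))"
  proof (rule summable_comparison_test')
    show "summable (poisson_weight t)"
      using poisson_weight_sums_1 by (rule sums_summable)
    show "norm (norm (of_real (poisson_weight t k) * z ^ k)) \<le> poisson_weight t k" for k
      using assms poisson_weight_nonneg[OF assms(1), of k]
      by (simp add: norm_mult norm_power mult_left_le power_le_one)
  qed
  then show ?thesis
    by (simp add: integrable_count_space_nat_iff)
qed

lemma integral_poisson_weight:
  fixes z :: complex
  assumes "0 \<le> t" "norm z \<le> 1"
  shows "(\<integral>k. of_real (poisson_weight t k) * z ^ k \<partial>count_space UNIV) = exp (- of_real t * (1 - z))"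
  using integral_count_space_nat[OF integrable_poisson_weight[OF assms]] sums_unique[OF poisson_weight_sums, of t z]
  by simp

context stationary_globally_gated
begin

lemma mean_batch_size_nonneg: "0 \<le> mean_batch_size P i"
  by (simp add: mean_batch_size_def)

lemma mean_law_nonneg: "nonneg_law \<mu> \<Longrightarrow> 0 \<le> (LINT t|\<mu>. t)"
  unfolding nonneg_law_def by (intro integral_nonneg_AE) auto

lemma queue_load_nonneg:
  "i \<in> {1..nq P} \<Longrightarrow> 0 \<le> (rate P * mean_batch_size P i) * (LINT t|service_law P i. t)"
  using rate_pos by (intro mult_nonneg_nonneg mean_batch_size_nonneg mean_law_nonneg service_law) auto

lemma load_nonneg: "0 \<le> load P"
  unfolding load_def by (intro sum_nonneg queue_load_nonneg)

text \<open>
  For factors in the unit disc, the difference of two products is at most the sum of the differences.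
\<close>

lemma norm_batch_pgf_diff:
  assumes u: "\<And>i. i \<in> {1..nq P} \<Longrightarrow> norm (u i) \<le> 1" and v: "\<And>i. i \<in> {1..nq P} \<Longrightarrow> norm (v i) \<le> 1"
  shows "norm (batch_pgf P u - batch_pgf P v) \<le> (\<Sum>i=1..nq P. mean_batch_size P i * norm (u i - v i))"
proof -
  have norm: "norm (\<Prod>i=1..nq P. w i ^ k i) \<le> 1" if "\<And>i. i \<in> {1..nq P} \<Longrightarrow> norm (w i) \<le> 1"
    for w :: "nat \<Rightarrow> complex" and k :: "nat \<Rightarrow> nat"
    unfolding prod_norm[symmetric] using that
    by (intro prod_le_1) (auto simp: norm_power intro!: power_le_one)
  have int: "integrable (batch_pmf P) (\<lambda>k. \<Prod>i=1..nq P. w i ^ k i)" if "\<And>i. i \<in> {1..nq P} \<Longrightarrow> norm (w i) \<le> 1"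
    for w :: "nat \<Rightarrow> complex"
    using norm[OF that] by (intro measure_pmf.integrable_const_bound[where B = 1]) auto
  have "norm (batch_pgf P u - batch_pgf P v)
      = norm (\<integral>k. (\<Prod>i=1..nq P. u i ^ k i) - (\<Prod>i=1..nq P. v i ^ k i) \<partial>batch_pmf P)"
    unfolding batch_pgf_def using int u v by simp
  also have "\<dots> \<le> (\<integral>k. norm ((\<Prod>i=1..nq P. u i ^ k i) - (\<Prod>i=1..nq P. v i ^ k i)) \<partial>batch_pmf P)"
    by (rule integral_norm_bound)
  also have "\<dots> \<le> (\<integral>k. (\<Sum>i=1..nq P. real (k i) * norm (u i - v i)) \<partial>batch_pmf P)"
  proof (rule integral_mono)
    fix k :: "nat \<Rightarrow> nat"
    have "norm ((\<Prod>i=1..nq P. u i ^ k i) - (\<Prod>i=1..nq P. v i ^ k i)) \<le> (\<Sum>i=1..nq P. norm (u i ^ k i - v i ^ k i))"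
      using u v by (intro norm_prod_diff) (auto simp: norm_power intro!: power_le_one)
    also have "\<dots> \<le> (\<Sum>i=1..nq P. real (k i) * norm (u i - v i))"
      using u v by (intro sum_mono norm_power_diff) auto
    finally show "norm ((\<Prod>i=1..nq P. u i ^ k i) - (\<Prod>i=1..nq P. v i ^ k i)) \<le> \<dots>" .
  qed (use int u v batch_integrable in auto)
  also have "\<dots> = (\<Sum>i=1..nq P. mean_batch_size P i * norm (u i - v i))"
    unfolding mean_batch_size_def using batch_integrable by (subst Bochner_Integration.integral_sum) auto
  finally show ?thesis .
qed

lemma batch_pgf_1: "batch_pgf P (\<lambda>_. 1) = 1"
  by (simp add: batch_pgf_def)

text \<open>
  Adding queue \<open>i\<close> to the vector of transforms changes \<open>K\<close> by at most \<open>norm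
  \<omega> * E(K_i) * E(B_i)\<close>. After multiplication by the arrival rate this is at most \<open>norm
  \<omega>\<close> times the load, hence less than \<open>norm \<omega>\<close>.
\<close>

lemma cycle_term_denominator_nonzero:
  assumes \<omega>: "0 \<le> Re \<omega>" "\<omega> \<noteq> 0" and i: "i \<in> {1..nq P}"
  shows "\<omega> - complex_of_real (rate P)
    * (batch_pgf P (service_vec P \<omega> 1 (i - 1)) - batch_pgf P (service_vec P \<omega> 1 i)) \<noteq> 0"
proof
  let ?u = "service_vec P \<omega> 1 (i - 1)" and ?v = "service_vec P \<omega> 1 i"
  assume "\<omega> - complex_of_real (rate P) * (batch_pgf P ?u - batch_pgf P ?v) = 0"
  then have "norm \<omega> = norm (complex_of_real (rate P) * (batch_pgf P ?u - batch_pgf P ?v))"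
    by simp
  also have "\<dots> = rate P * norm (batch_pgf P ?u - batch_pgf P ?v)"
    using rate_pos by (simp add: norm_mult)
  also have "norm (batch_pgf P ?u - batch_pgf P ?v) \<le> (\<Sum>l=1..nq P. mean_batch_size P l * norm (?u l - ?v l))"
    using norm_service_lst_le_1[OF \<omega>(1)] by (intro norm_batch_pgf_diff) (auto simp: service_vec_def)
  also have "(\<Sum>l=1..nq P. mean_batch_size P l * norm (?u l - ?v l))
      = (\<Sum>l\<in>{i}. mean_batch_size P l * norm (?u l - ?v l))"
    using i by (intro sum.mono_neutral_right) (auto simp: service_vec_def)
  also have "\<dots> = mean_batch_size P i * norm (1 - lst (service_law P i) \<omega>)"
  proof -
    have "\<not> i \<le> i - 1"
      using i by auto
    then show ?thesis
      using i by (simp add: service_vec_def)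
  qed
  also have "\<dots> \<le> mean_batch_size P i * (norm \<omega> * (LINT t|service_law P i. t))"
    by (intro mult_left_mono norm_1_minus_lst_le service_law i \<omega> mean_batch_size_nonneg)
  finally have "norm \<omega> \<le> norm \<omega> * ((rate P * mean_batch_size P i) * (LINT t|service_law P i. t))"
    using rate_pos by (simp add: mult_left_mono mult_ac)
  also have "(rate P * mean_batch_size P i) * (LINT t|service_law P i. t) \<le> load P"
    unfolding load_def by (rule member_le_sum[OF i queue_load_nonneg]) auto
  then have "norm \<omega> * ((rate P * mean_batch_size P i) * (LINT t|service_law P i. t)) \<le> norm \<omega> * load P"
    by (intro mult_left_mono) auto
  also have "\<dots> < norm \<omega>"
    using stable \<omega>(2) by simp
  finally show False
    by simp
qed

section \<open>The mean cycle length\<close>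

definition cycle_transform :: "complex \<Rightarrow> complex" where
  "cycle_transform \<omega> = (\<integral>x. damp \<omega> (cycle_length P 0 x) \<partial>M)"

text \<open>
  Cycle 0 starts at time 0, before any arrival, and its length is independent of the arrival process.
\<close>

lemma prob_window_first_cycle:
  "complex_of_real (prob {x\<in>space M. window P 0 p r x})
    = (if p = 0 then \<integral>x. of_real (poisson_weight (rate P * cycle_length P 0 x) r) \<partial>M else 0)"
proof (cases "p = 0")
  case False
  have "AE x in M. \<not> window P 0 p r x"
    using AE_regular
  proof eventually_elim
    case (elim x)
    then show ?case
      using epoch_less[of P x 0 p] False by (simp add: window_def)
  qed
  then have "prob {x\<in>space M. window P 0 p r x} = 0"
    by (subst prob_eq_0) auto
  with False show ?thesis
    by simp
next
  case True
  let ?J1 = "past_sources P 0 0" and ?J2 = "range Interarrival"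
  let ?C = "truncated_gate P 0 (Suc 0)" and ?V = "interarrival_sum P 0"
  have J: "?J1 \<subseteq> sources (nq P)" "?J2 \<subseteq> sources (nq P)" "?J1 \<inter> ?J2 = {}"
    using past_sources_subset by (auto simp: past_sources_def) (auto simp: sources_def)
  have [measurable]: "?C \<in> borel_measurable (source_algebra P ?J1)"
    by (rule measurable_truncated_gate_source) simp
  have [measurable]: "?V k \<in> borel_measurable (source_algebra P ?J2)" for k
    by (rule measurable_interarrival_sum_source) auto
  have C: "?C x = cycle_length P 0 x" for x
    by (simp add: cycle_length_def)
  let ?f = "\<lambda>x y. if ?V r y \<le> ?C x \<and> ?C x < ?V (Suc r) y then 1 else 0 :: complex"
  have "complex_of_real (prob {x\<in>space M. window P 0 0 r x})
      = (\<integral>x. complex_of_real (indicator {x\<in>space M. window P 0 0 r x} x) \<partial>M)"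
    by simp
  also have "\<dots> = (\<integral>x. ?f x x \<partial>M)"
  proof (rule integral_cong_AE)
    show "AE x in M. complex_of_real (indicator {x\<in>space M. window P 0 0 r x} x) = ?f x x"
      using AE_regular AE_space
    proof eventually_elim
      case (elim x)
      have "epoch P k x = ?V k x" for k
        using epoch_eq_interarrival_sum[of P 0 k x] by simp
      moreover have "0 < interarrival P 0 x"
        using elim(1) by (simp add: regular_path_def)
      ultimately have "window P 0 0 r x \<longleftrightarrow> ?V r x \<le> ?C x \<and> ?C x < ?V (Suc r) x"
        unfolding window_def by (simp add: interarrival_sum_Suc del: truncated_gate.simps(2))
      then show ?case
        using elim(2) by (simp add: indicator_def)
    qed
  qed measurable
  also have "\<dots> = (\<integral>x. (\<integral>y. ?f x y \<partial>M) \<partial>M)"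
  proof (rule integral_indep_sources(1)[OF J, where b = 1])
    show "(\<lambda>(x, y). ?f x y) \<in> borel_measurable (source_algebra P ?J1 \<Otimes>\<^sub>M source_algebra P ?J2)"
      unfolding case_prod_unfold by measurable
  qed simp
  also have "\<dots> = (\<integral>x. of_real (poisson_weight (rate P * cycle_length P 0 x) r) \<partial>M)"
  proof (rule integral_cong_AE)
    show "AE x in M. (\<integral>y. ?f x y \<partial>M) = of_real (poisson_weight (rate P * cycle_length P 0 x) r)"
      using AE_regular
    proof eventually_elim
      case (elim x)
      have "(\<integral>y. ?f x y \<partial>M) = (\<integral>y. complex_of_real (indicator {y\<in>space M. ?V r y \<le> ?C x \<and> ?C x < ?V (Suc r) y} y) \<partial>M)"
        by (intro Bochner_Integration.integral_cong) (auto simp: indicator_def)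
      also have "\<dots> = of_real (prob {y\<in>space M. ?V r y \<le> ?C x \<and> ?C x < ?V (Suc r) y})"
      proof -
        have "{y\<in>space M. ?V r y \<le> ?C x \<and> ?C x < ?V (Suc r) y} \<in> events" (is "?A \<in> _")
          by measurable
        then have "?A \<inter> space M = ?A"
          by auto
        then show ?thesis
          by simp
      qed
      also have "\<dots> = of_real (poisson_weight (rate P * ?C x) r)"
        using cycle_length_nonneg[OF elim, of 0] unfolding C by (subst prob_interarrival_count) auto
      finally show ?case
        unfolding C .
    qed
    have "(\<lambda>x. \<integral>y. ?f x y \<partial>M) \<in> borel_measurable (source_algebra P ?J1)"
    proof (rule integral_indep_sources(2)[OF J, where b = 1])
      show "(\<lambda>(x, y). ?f x y) \<in> borel_measurable (source_algebra P ?J1 \<Otimes>\<^sub>M source_algebra P ?J2)"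
        unfolding case_prod_unfold by measurable
    qed simp
    then show "(\<lambda>x. \<integral>y. ?f x y \<partial>M) \<in> borel_measurable M"
      by (rule measurable_source_algebra_imp[OF J(1)])
  qed measurable
  finally show ?thesis
    by (simp add: True)
qed

lemma has_sum_poisson_first_cycle:
  assumes z: "norm z \<le> 1"
  shows "((\<lambda>r. (\<integral>x. of_real (poisson_weight (rate P * cycle_length P 0 x) r) \<partial>M) * z ^ r)
    has_sum cycle_transform (complex_of_real (rate P) * (1 - z))) UNIV"
proof -
  let ?f = "\<lambda>r x. of_real (poisson_weight (rate P * cycle_length P 0 x) r) * z ^ r"
  have "((\<lambda>r. \<integral>x. ?f r x \<partial>M) has_sum (\<integral>x. (\<integral>r. ?f r x \<partial>count_space UNIV) \<partial>M)) UNIV"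
  proof (rule integral_has_sum[OF sigma_finite_measure_axioms])
    have "(\<integral>\<^sup>+x. (\<integral>\<^sup>+r. norm (?f r x) \<partial>count_space UNIV) \<partial>M) \<le> (\<integral>\<^sup>+x. 1 \<partial>M)"
    proof (rule nn_integral_mono_AE)
      show "AE x in M. (\<integral>\<^sup>+r. norm (?f r x) \<partial>count_space UNIV) \<le> 1"
        using AE_cycle_length_nonneg[of 0]
      proof eventually_elim
        case (elim x)
        then have t: "0 \<le> rate P * cycle_length P 0 x"
          using rate_pos by simp
        have "(\<integral>\<^sup>+r. norm (?f r x) \<partial>count_space UNIV)
            \<le> (\<integral>\<^sup>+r. ennreal (poisson_weight (rate P * cycle_length P 0 x) r) \<partial>count_space UNIV)"
          using z poisson_weight_nonneg[OF t]
          by (intro nn_integral_mono ennreal_leI) (simp add: norm_mult norm_power mult_left_le power_le_one)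
        then show ?case
          by (simp add: nn_integral_poisson_weight[OF t])
      qed
    qed
    also have "\<dots> < \<infinity>"
      by (simp add: emeasure_space_1)
    finally show "(\<integral>\<^sup>+x. (\<integral>\<^sup>+r. norm (?f r x) \<partial>count_space UNIV) \<partial>M) < \<infinity>" .
  qed simp_all
  also have "(\<integral>x. (\<integral>r. ?f r x \<partial>count_space UNIV) \<partial>M) = cycle_transform (complex_of_real (rate P) * (1 - z))"
    unfolding cycle_transform_def
  proof (rule integral_cong_AE)
    show eq: "AE x in M. (\<integral>r. ?f r x \<partial>count_space UNIV)
        = exp (- (complex_of_real (rate P) * (1 - z)) * complex_of_real (cycle_length P 0 x))"
      using AE_cycle_length_nonneg[of 0]
    proof eventually_elim
      case (elim x)
      then show ?case
        using rate_pos by (subst integral_poisson_weight[OF _ z]) (auto simp: algebra_simps)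
    qed
    have "(\<lambda>z. ?f (snd z) (fst z)) \<in> borel_measurable (M \<Otimes>\<^sub>M count_space UNIV)"
      by (rule measurable_compose_countable[where f = "\<lambda>r z. ?f r (fst z)" and g = snd]) simp_all
    then show "(\<lambda>x. \<integral>r. ?f r x \<partial>count_space UNIV) \<in> borel_measurable M"
      by (intro sigma_finite_measure.borel_measurable_lebesgue_integral sigma_finite_measure_count_space)
        (simp add: case_prod_unfold)
  qed simp
  finally show ?thesis
    by simp
qed

text \<open>
  The cycle that follows a cycle of length \<open>c\<close> consists of the work of a Poisson number of batches
  with mean \<open>rate P * c\<close> and of the switch-over times; in steady state it has the same law.
\<close>

lemma cycle_transform_functional_equation:
  assumes \<omega>: "0 \<le> Re \<omega>"
  defines "z \<equiv> measure_pmf.expectation (batch_pmf P) (content_transform \<omega>)"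
  shows "cycle_transform \<omega> = cycle_transform (complex_of_real (rate P) * (1 - z))
    * (\<Prod>i=1..nq P. lst (switch_law P i) \<omega>)"
proof -
  let ?\<sigma> = "\<Prod>i=1..nq P. lst (switch_law P i) \<omega>"
  let ?q = "\<lambda>r. \<integral>x. complex_of_real (poisson_weight (rate P * cycle_length P 0 x) r) \<partial>M"
  have "norm z \<le> (\<integral>k. norm (content_transform \<omega> k) \<partial>batch_pmf P)"
    unfolding z_def by (rule integral_norm_bound)
  also have "\<dots> \<le> (\<integral>k. 1 \<partial>batch_pmf P)"
    using norm_content_transform[OF \<omega>]
    by (intro integral_mono measure_pmf.integrable_const_bound[where B = 1]) auto
  finally have z: "norm z \<le> 1"
    by simp
  have "((\<lambda>r. ?q r * z ^ r * ?\<sigma>) has_sum cycle_transform (complex_of_real (rate P) * (1 - z)) * ?\<sigma>) UNIV"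
    by (rule has_sum_cmult_left[OF has_sum_poisson_first_cycle[OF z]])
  then have "((\<lambda>(p :: nat, r). (if p = 0 then ?q r else 0) * z ^ r * ?\<sigma>)
      has_sum cycle_transform (complex_of_real (rate P) * (1 - z)) * ?\<sigma>) (Pair 0 ` UNIV)"
    by (subst has_sum_reindex) (auto simp: inj_on_def o_def)
  then have "((\<lambda>(p :: nat, r). (if p = 0 then ?q r else 0) * z ^ r * ?\<sigma>)
      has_sum cycle_transform (complex_of_real (rate P) * (1 - z)) * ?\<sigma>) UNIV"
    by (rule has_sum_cong_neutral[THEN iffD1, rotated -1]) auto
  then have "(\<integral>x. damp \<omega> (cycle_length P (Suc 0) x) \<partial>M)
      = cycle_transform (complex_of_real (rate P) * (1 - z)) * ?\<sigma>"
  proof (rule has_sum_unique[rotated])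
    show "((\<lambda>(p :: nat, r). (if p = 0 then ?q r else 0) * z ^ r * ?\<sigma>)
      has_sum (\<integral>x. damp \<omega> (cycle_length P (Suc 0) x) \<partial>M)) UNIV"
    using has_sum_next_cycle_transform[OF \<omega>, of 0] by (simp only: prob_window_first_cycle z_def)
  qed
  then show ?thesis
    unfolding transform_cycle_stationary[OF \<omega>, of "Suc 0"] cycle_transform_def .
qed

abbreviation real_transform :: "real \<Rightarrow> real" where
  "real_transform s \<equiv> \<integral>x. exp (- s * cycle_length P 0 x) \<partial>M"

lemma cycle_transform_of_real: "cycle_transform (complex_of_real s) = complex_of_real (real_transform s)"
proof -
  have "cycle_transform (complex_of_real s) = (\<integral>x. complex_of_real (exp (- s * cycle_length P 0 x)) \<partial>M)"
    unfolding cycle_transform_def by (simp add: exp_of_real[symmetric])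
  then show ?thesis
    by simp
qed

lemma integrable_real_damped: "0 \<le> s \<Longrightarrow> integrable M (\<lambda>x. exp (- s * cycle_length P 0 x))"
proof (rule integrable_const_bound[where B = 1])
  assume "0 \<le> s"
  then show "AE x in M. norm (exp (- s * cycle_length P 0 x)) \<le> 1"
    using AE_cycle_length_nonneg[of 0] by (auto elim!: AE_mp)
qed simp

lemma real_transform_antimono:
  assumes "0 \<le> s" "s \<le> t"
  shows "real_transform t \<le> real_transform s"
proof (rule integral_mono_AE)
  show "AE x in M. exp (- t * cycle_length P 0 x) \<le> exp (- s * cycle_length P 0 x)"
    using AE_cycle_length_nonneg[of 0] by eventually_elim (use assms in \<open>simp add: mult_right_mono\<close>)
qed (intro integrable_real_damped; use assms in simp)+

lemma real_transform_0: "real_transform 0 = 1"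
  by (simp add: prob_space)

lemma real_transform_bounds: "0 \<le> s \<Longrightarrow> 0 \<le> real_transform s" "0 \<le> s \<Longrightarrow> real_transform s \<le> 1"
  using real_transform_antimono[of 0 s] real_transform_0 by (auto intro!: integral_nonneg)

abbreviation mean_switch_sum :: real where
  "mean_switch_sum \<equiv> \<Sum>i=1..nq P. LINT t|switch_law P i. t"

text \<open>
  By the functional equation, \<open>1 - \<phi>(s) = (1 - \<phi>(t)) + \<phi>(t) * (1 - \<sigma>)\<close> with
  \<open>t = \<lambda> (1 - z) \<le> \<rho> s\<close>, where \<open>z\<close> is the transform of the work of a
  batch and \<open>\<sigma>\<close> that of the switch-over times. Moreover, \<open>\<phi>\<close> is decreasing
  and \<open>1 - \<sigma>\<close> is at most \<open>s\<close> times the mean switch-over time.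
\<close>

lemma real_transform_step:
  assumes s: "0 \<le> s"
  shows "1 - real_transform s \<le> (1 - real_transform (load P * s)) + s * mean_switch_sum"
proof -
  let ?\<omega> = "complex_of_real s"
  have \<omega>: "0 \<le> Re ?\<omega>"
    using s by simp
  let ?z = "measure_pmf.expectation (batch_pmf P) (content_transform ?\<omega>)"
  define z' where "z' = (\<integral>x. exp (- s * (\<Sum>l=1..nq P. batch_work P 0 l x)) \<partial>M)"
  have "?z = (\<integral>x. damp ?\<omega> (\<Sum>l=1..nq P. batch_work P 0 l x) \<partial>M)"
    unfolding batch_pgf_all_queues[symmetric] by (rule integral_batch_work[OF \<omega> order_refl, symmetric])
  also have "\<dots> = (\<integral>x. complex_of_real (exp (- s * (\<Sum>l=1..nq P. batch_work P 0 l x))) \<partial>M)"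
    by (intro Bochner_Integration.integral_cong refl) (simp add: exp_of_real[symmetric])
  also have "\<dots> = complex_of_real z'"
    unfolding z'_def by simp
  finally have z: "?z = complex_of_real z'" .
  define \<sigma>' where "\<sigma>' = (\<integral>x. exp (- s * (\<Sum>l=1..nq P. switchover P 0 l x)) \<partial>M)"
  let ?\<sigma> = "\<Prod>i=1..nq P. lst (switch_law P i) ?\<omega>"
  have "?\<sigma> = (\<integral>x. damp ?\<omega> (\<Sum>l=1..nq P. switchover P 0 l x) \<partial>M)"
    by (rule integral_switchovers[OF \<omega> order_refl, symmetric])
  also have "\<dots> = (\<integral>x. complex_of_real (exp (- s * (\<Sum>l=1..nq P. switchover P 0 l x))) \<partial>M)"
    by (intro Bochner_Integration.integral_cong refl) (simp add: exp_of_real[symmetric])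
  also have "\<dots> = complex_of_real \<sigma>'"
    unfolding \<sigma>'_def by simp
  finally have \<sigma>: "?\<sigma> = complex_of_real \<sigma>'" .
  have lst_switch: "norm (lst (switch_law P i) ?\<omega>) \<le> 1" if i: "i \<in> {1..nq P}" for i
    using norm_integral_damped[OF \<omega> rv_switchover[OF i] AE_switchover_nonneg[OF i], of 0]
    unfolding integral_lst[OF rv_switchover[OF i] switchover_distr[OF i]] .
  have "norm (1 - ?z) = norm (batch_pgf P (\<lambda>_. 1) - batch_pgf P (\<lambda>l. if l \<in> {1..nq P} then lst (service_law P l) ?\<omega> else 1))"
    by (simp only: batch_pgf_all_queues batch_pgf_1)
  also have "\<dots> \<le> (\<Sum>i=1..nq P. mean_batch_size P i * norm (1 - (if i \<in> {1..nq P} then lst (service_law P i) ?\<omega> else 1)))"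
    using norm_service_lst_le_1[OF \<omega>] by (intro norm_batch_pgf_diff) auto
  also have "\<dots> \<le> (\<Sum>i=1..nq P. mean_batch_size P i * (s * (LINT t|service_law P i. t)))"
    using norm_1_minus_lst_le[OF service_law \<omega>] s
    by (intro sum_mono mult_left_mono mean_batch_size_nonneg) auto
  finally have "rate P * norm (1 - ?z)
      \<le> rate P * (\<Sum>i=1..nq P. mean_batch_size P i * (s * (LINT t|service_law P i. t)))"
    using rate_pos by (intro mult_left_mono) auto
  also have "\<dots> = load P * s"
    by (simp add: load_def sum_distrib_left sum_distrib_right mult_ac)
  finally have "rate P * norm (1 - ?z) \<le> load P * s" .
  moreover have "1 - ?z = complex_of_real (1 - z')"
    by (simp add: z)
  ultimately have load: "rate P * (1 - z') \<le> load P * s"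
    using rate_pos by (simp only: norm_of_real) (smt (verit) mult_left_mono)
  have z'_le: "z' \<le> 1"
  proof -
    have "z' \<le> norm ?z"
      unfolding z by simp
    also have "\<dots> \<le> (\<integral>k. norm (content_transform ?\<omega> k) \<partial>batch_pmf P)"
      by (rule integral_norm_bound)
    also have "\<dots> \<le> (\<integral>k. 1 \<partial>batch_pmf P)"
      using norm_content_transform[OF \<omega>]
      by (intro integral_mono measure_pmf.integrable_const_bound[where B = 1]) auto
    finally show ?thesis
      by simp
  qed
  have "norm ((\<Prod>i=1..nq P. 1) - ?\<sigma>) \<le> (\<Sum>i=1..nq P. norm (1 - lst (switch_law P i) ?\<omega>))"
    using lst_switch by (intro norm_prod_diff) auto
  also have "\<dots> \<le> (\<Sum>i=1..nq P. s * (LINT t|switch_law P i. t))"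
    using norm_1_minus_lst_le[OF switch_law \<omega>] s by (intro sum_mono) auto
  also have "(\<Prod>i=1..nq P. 1) - ?\<sigma> = complex_of_real (1 - \<sigma>')"
    unfolding \<sigma> by simp
  finally have switch: "1 - \<sigma>' \<le> s * mean_switch_sum"
    by (simp only: norm_of_real sum_distrib_left)
  have arg: "complex_of_real (rate P) * (1 - ?z) = complex_of_real (rate P * (1 - z'))"
    unfolding z by simp
  have "cycle_transform ?\<omega> = cycle_transform (complex_of_real (rate P * (1 - z'))) * complex_of_real \<sigma>'"
    using cycle_transform_functional_equation[OF \<omega>] unfolding arg \<sigma> .
  then have eq: "real_transform s = real_transform (rate P * (1 - z')) * \<sigma>'"
    unfolding cycle_transform_of_real of_real_mult[symmetric] of_real_eq_iff .
  have a: "0 \<le> rate P * (1 - z')"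
    using rate_pos z'_le by simp
  have "0 \<le> mean_switch_sum * s"
    using switch_pos s by simp
  have "1 - real_transform s = (1 - real_transform (rate P * (1 - z'))) + real_transform (rate P * (1 - z')) * (1 - \<sigma>')"
    unfolding eq by (simp add: algebra_simps)
  also have "real_transform (rate P * (1 - z')) * (1 - \<sigma>') \<le> real_transform (rate P * (1 - z')) * (s * mean_switch_sum)"
    using switch real_transform_bounds[OF a] by (intro mult_left_mono)
  also have "\<dots> \<le> 1 * (s * mean_switch_sum)"
    using real_transform_bounds[OF a] s switch_pos by (intro mult_right_mono) auto
  also have "1 - real_transform (rate P * (1 - z')) \<le> 1 - real_transform (load P * s)"
    using real_transform_antimono[OF a load] by simp
  finally show ?thesis
    by simp
qed

lemma real_transform_tendsto_1:
  assumes s: "\<And>n. 0 \<le> s n" and lim: "s \<longlonglongrightarrow> 0"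
  shows "(\<lambda>n. real_transform (s n)) \<longlonglongrightarrow> 1"
proof -
  have "(\<lambda>n. real_transform (s n)) \<longlonglongrightarrow> (\<integral>x. 1 \<partial>M)"
  proof (rule integral_dominated_convergence[where w = "\<lambda>_. 1"])
    show "AE x in M. (\<lambda>n. exp (- s n * cycle_length P 0 x)) \<longlonglongrightarrow> 1"
    proof (rule AE_I2)
      fix x
      have "(\<lambda>n. exp (- s n * cycle_length P 0 x)) \<longlonglongrightarrow> exp (- 0 * cycle_length P 0 x)"
        by (intro tendsto_intros lim)
      then show "(\<lambda>n. exp (- s n * cycle_length P 0 x)) \<longlonglongrightarrow> 1"
        by simp
    qed
    show "AE x in M. norm (exp (- s n * cycle_length P 0 x)) \<le> 1" for n
      using AE_cycle_length_nonneg[of 0] by eventually_elim (simp add: s)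
  qed simp_all
  then show ?thesis
    by (simp add: prob_space)
qed

text \<open>
  Iterating the previous inequality sums a geometric series with ratio \<open>load P < 1\<close>, and the
  remainder \<open>1 - \<phi>(\<rho>^n s)\<close> vanishes because the cycle length is finite.
\<close>

lemma real_transform_linear_bound:
  assumes s: "0 \<le> s"
  shows "1 - real_transform s \<le> s * (mean_switch_sum / (1 - load P))"
proof -
  let ?\<rho> = "load P"
  have iter: "1 - real_transform s \<le> (1 - real_transform (?\<rho> ^ n * s)) + s * mean_switch_sum * (\<Sum>k<n. ?\<rho> ^ k)" for n
  proof (induction n)
    case (Suc n)
    have "1 - real_transform (?\<rho> ^ n * s) \<le> (1 - real_transform (?\<rho> ^ Suc n * s)) + ?\<rho> ^ n * s * mean_switch_sum"
      using real_transform_step[of "?\<rho> ^ n * s"] load_nonneg s by (simp add: mult_ac)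
    with Suc.IH show ?case
      by (simp add: algebra_simps)
  qed simp
  have "(\<lambda>n. (1 - real_transform (?\<rho> ^ n * s)) + s * mean_switch_sum * (\<Sum>k<n. ?\<rho> ^ k))
      \<longlonglongrightarrow> (1 - 1) + s * mean_switch_sum * (1 / (1 - ?\<rho>))"
  proof (intro tendsto_intros real_transform_tendsto_1)
    show "(\<lambda>n. \<Sum>k<n. ?\<rho> ^ k) \<longlonglongrightarrow> 1 / (1 - ?\<rho>)"
      using geometric_sums[of ?\<rho>] load_nonneg stable by (simp add: sums_def)
    have "(\<lambda>n. ?\<rho> ^ n * s) \<longlonglongrightarrow> 0 * s"
      using load_nonneg stable by (intro tendsto_mult LIMSEQ_realpow_zero tendsto_const)
    then show "(\<lambda>n. ?\<rho> ^ n * s) \<longlonglongrightarrow> 0"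
      by simp
  qed (use load_nonneg s in auto)
  then show ?thesis
    by (intro LIMSEQ_le_const[where X = "\<lambda>n. (1 - real_transform (?\<rho> ^ n * s)) + s * mean_switch_sum * (\<Sum>k<n. ?\<rho> ^ k)"])
      (use iter in auto)
qed

text \<open>
  \<open>c * exp (- s * c) \<le> (1 - exp (- s * c)) / s\<close>, and the mean of the right-hand side is bounded
  uniformly in \<open>s\<close>; Fatou's lemma for \<open>s \<rightarrow> 0\<close> bounds the mean of
  \<open>c\<close>.
\<close>

lemma integrable_first_cycle: "integrable M (cycle_length P 0)"
proof -
  let ?C = "cycle_length P 0" and ?B = "mean_switch_sum / (1 - load P)"
  define s where "s n = inverse (real (Suc n))" for n
  have s: "0 < s n" for n
    by (simp add: s_def)
  have "s \<longlonglongrightarrow> 0"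
    unfolding s_def by (rule LIMSEQ_inverse_real_of_nat)
  then have lim: "(\<lambda>n. ennreal (c * exp (- s n * c))) \<longlonglongrightarrow> ennreal c" for c
  proof -
    assume "s \<longlonglongrightarrow> 0"
    then have "(\<lambda>n. c * exp (- s n * c)) \<longlonglongrightarrow> c * exp (- 0 * c)"
      by (intro tendsto_intros)
    then show ?thesis
      by (intro tendsto_ennrealI) simp
  qed
  have bound: "(\<integral>\<^sup>+x. ennreal (?C x * exp (- s n * ?C x)) \<partial>M) \<le> ennreal ?B" for n
  proof -
    have int: "integrable M (\<lambda>x. (1 - exp (- s n * ?C x)) / s n)"
      using integrable_real_damped[of "s n"] s[of n] by simp
    have "(\<integral>\<^sup>+x. ennreal (?C x * exp (- s n * ?C x)) \<partial>M) \<le> (\<integral>\<^sup>+x. ennreal ((1 - exp (- s n * ?C x)) / s n) \<partial>M)"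
    proof (intro nn_integral_mono ennreal_leI)
      fix x
      have "(1 + s n * ?C x) * exp (- s n * ?C x) \<le> exp (s n * ?C x) * exp (- s n * ?C x)"
        by (intro mult_right_mono exp_ge_add_one_self) simp
      then have "s n * (?C x * exp (- s n * ?C x)) \<le> 1 - exp (- s n * ?C x)"
        by (simp add: exp_add[symmetric] algebra_simps)
      then show "?C x * exp (- s n * ?C x) \<le> (1 - exp (- s n * ?C x)) / s n"
        using s[of n] by (simp add: field_simps)
    qed
    also have "\<dots> = ennreal (\<integral>x. (1 - exp (- s n * ?C x)) / s n \<partial>M)"
    proof (rule nn_integral_eq_integral[OF int])
      show "AE x in M. 0 \<le> (1 - exp (- s n * ?C x)) / s n"
        using AE_cycle_length_nonneg[of 0] by eventually_elim (use s[of n] in simp)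
    qed
    also have "(\<integral>x. (1 - exp (- s n * ?C x)) / s n \<partial>M) = (1 - real_transform (s n)) / s n"
      using integrable_real_damped[of "s n"] s[of n] by (simp add: prob_space)
    also have "\<dots> \<le> ?B"
      using real_transform_linear_bound[of "s n"] s[of n] by (simp add: pos_divide_le_eq mult.commute)
    finally show ?thesis
      by (simp add: ennreal_leI)
  qed
  have "(\<integral>\<^sup>+x. ennreal (?C x) \<partial>M) = (\<integral>\<^sup>+x. liminf (\<lambda>n. ennreal (?C x * exp (- s n * ?C x))) \<partial>M)"
    by (intro nn_integral_cong lim_imp_Liminf[OF _ lim, symmetric]) simp
  also have "\<dots> \<le> liminf (\<lambda>n. \<integral>\<^sup>+x. ennreal (?C x * exp (- s n * ?C x)) \<partial>M)"
    by (rule nn_integral_liminf) simp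
  also have "\<dots> \<le> liminf (\<lambda>n::nat. ennreal ?B)"
    by (intro Liminf_mono always_eventually allI bound)
  also have "\<dots> = ennreal ?B"
    by (simp add: Liminf_const)
  finally have "(\<integral>\<^sup>+x. ennreal (?C x) \<partial>M) < \<infinity>"
    by (simp add: le_less_trans)
  then show ?thesis
    using AE_cycle_length_nonneg[of 0] by (intro integrableI_nonneg) auto
qed

text \<open>
  A cycle is at least as long as its switch-over times.
\<close>

lemma mean_cycle_pos: "0 < mean_cycle P"
proof -
  have law: "integrable M (switchover P 0 i)" "(\<integral>x. switchover P 0 i x \<partial>M) = (LINT t|switch_law P i. t)"
    if i: "i \<in> {1..nq P}" for i
  proof -
    have "integrable (distr M borel (switchover P 0 i)) (\<lambda>t. t)"
      using switch_law[OF i] unfolding switchover_distr[OF i] nonneg_law_def by simp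
    then show "integrable M (switchover P 0 i)"
      using rv_switchover[OF i] by (subst (asm) integrable_distr_eq) auto
    show "(\<integral>x. switchover P 0 i x \<partial>M) = (LINT t|switch_law P i. t)"
      unfolding switchover_distr[OF i, of 0, symmetric] using rv_switchover[OF i] by (subst integral_distr) auto
  qed
  note switch_pos
  also have "mean_switch_sum = (\<integral>x. (\<Sum>i=1..nq P. switchover P 0 i x) \<partial>M)"
    using law by (subst Bochner_Integration.integral_sum) auto
  also have "\<dots> \<le> (\<integral>x. cycle_length P 0 x \<partial>M)"
  proof (rule integral_mono_AE)
    show "AE x in M. (\<Sum>i=1..nq P. switchover P 0 i x) \<le> cycle_length P 0 x"
      using AE_regular by eventually_elim (auto simp: cycle_length_eq intro!: sum_mono gated_work_nonneg)
  qed (use law integrable_first_cycle in auto)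
  finally show ?thesis
    by (simp add: mean_cycle_def)
qed

lemma integrable_cycle: "integrable M (cycle_length P m)"
proof -
  have "integrable (distr M borel (cycle_length P 0)) (\<lambda>t. t)"
    using integrable_first_cycle by (subst integrable_distr_eq) auto
  then have "integrable (distr M borel (cycle_length P m)) (\<lambda>t. t)"
    by (simp only: distr_cycle_length[of m])
  then show ?thesis
    by (subst (asm) integrable_distr_eq) auto
qed

lemma mean_cycle_eq: "(\<integral>x. cycle_length P m x \<partial>M) = mean_cycle P"
proof -
  have "(\<integral>x. cycle_length P m x \<partial>M) = (\<integral>t. t \<partial>distr M borel (cycle_length P m))" for m
    by (subst integral_distr) auto
  then show ?thesis
    unfolding mean_cycle_def by (simp only: distr_cycle_length[of m])
qed

lemma cycle_lst_eq: "cycle_lst P \<omega> = (\<integral>x. damp \<omega> (cycle_length P m x) \<partial>M)"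
proof -
  have "(\<integral>x. damp \<omega> (cycle_length P m x) \<partial>M) = lst (distr M borel (cycle_length P m)) \<omega>"
    by (rule integral_lst) auto
  then show ?thesis
    unfolding cycle_lst_def by (simp only: distr_cycle_length[of m])
qed

end

section \<open>Summation over the numbers of earlier and later arrivals\<close>

lemma AE_pair_fst:
  assumes N: "sigma_finite_measure N" and N': "sigma_finite_measure N'" and AE: "AE x in N. Q x"
  shows "AE z in N \<Otimes>\<^sub>M N'. Q (fst z)"
proof -
  interpret N: sigma_finite_measure N by fact
  interpret N': sigma_finite_measure N' by fact
  interpret NN': pair_sigma_finite N N' ..
  obtain A where A: "{x\<in>space N. \<not> Q x} \<subseteq> A" "A \<in> sets N" "emeasure N A = 0"
    using AE_E[OF AE] by metis
  have "AE z in N \<Otimes>\<^sub>M N'. fst z \<notin> A"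
  proof (rule NN'.AE_pair_measure)
    show "{z\<in>space (N \<Otimes>\<^sub>M N'). fst z \<notin> A} \<in> sets (N \<Otimes>\<^sub>M N')"
      using A(2) by measurable
    have "AE x in N. x \<notin> A"
      using A by (intro AE_not_in) (auto intro: null_setsI)
    then show "AE x in N. AE y in N'. fst (x, y) \<notin> A"
      by eventually_elim simp
  qed
  then show ?thesis
    using AE_space
  proof eventually_elim
    case (elim z)
    then show ?case
      using A(1) by (auto simp: space_pair_measure)
  qed
qed

lemma nn_integral_count_space_triple:
  fixes F :: "'i \<Rightarrow> ennreal" and G :: "'j \<Rightarrow> ennreal" and H :: "'k \<Rightarrow> ennreal"
  shows "(\<integral>\<^sup>+(p, a, b). F p * (G a * H b) \<partial>count_space UNIV)
    = (\<integral>\<^sup>+p. F p \<partial>count_space UNIV) * ((\<integral>\<^sup>+a. G a \<partial>count_space UNIV) * (\<integral>\<^sup>+b. H b \<partial>count_space UNIV))"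
  by (simp add: nn_integral_fst_count_space[symmetric] nn_integral_cmult nn_integral_multc)

lemma integral_count_space_prod:
  fixes f :: "'i::countable \<Rightarrow> complex" and g :: "'j::countable \<Rightarrow> complex"
  assumes f: "integrable (count_space UNIV) f" and g: "integrable (count_space UNIV) g"
  shows "integrable (count_space UNIV) (\<lambda>(i, j). f i * g j)"
    and "(\<integral>(i, j). f i * g j \<partial>count_space UNIV) = (\<integral>i. f i \<partial>count_space UNIV) * (\<integral>j. g j \<partial>count_space UNIV)"
proof -
  interpret I: sigma_finite_measure "count_space (UNIV :: 'i set)"
    by (rule sigma_finite_measure_count_space_countable) simp
  interpret J: sigma_finite_measure "count_space (UNIV :: 'j set)"
    by (rule sigma_finite_measure_count_space_countable) simp
  interpret IJ: pair_sigma_finite "count_space (UNIV :: 'i set)" "count_space (UNIV :: 'j set)" ..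
  have eq: "count_space (UNIV :: 'i set) \<Otimes>\<^sub>M count_space (UNIV :: 'j set) = count_space UNIV"
    by (simp add: pair_measure_countable)
  have int: "integrable (count_space (UNIV :: 'i set) \<Otimes>\<^sub>M count_space (UNIV :: 'j set)) (\<lambda>(i, j). f i * g j)"
  proof (rule IJ.Fubini_integrable)
    show "(\<lambda>(i, j). f i * g j) \<in> borel_measurable (count_space UNIV \<Otimes>\<^sub>M count_space UNIV)"
      unfolding eq by simp
  qed (use f g in \<open>auto simp: norm_mult\<close>)
  then show "integrable (count_space UNIV) (\<lambda>(i, j). f i * g j)"
    unfolding eq .
  show "(\<integral>(i, j). f i * g j \<partial>count_space UNIV) = (\<integral>i. f i \<partial>count_space UNIV) * (\<integral>j. g j \<partial>count_space UNIV)"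
    using IJ.integral_fst'[OF int] unfolding eq by simp
qed

lemma integral_count_space_triple:
  fixes f :: "'i::countable \<Rightarrow> complex" and g :: "'j::countable \<Rightarrow> complex" and h :: "'k::countable \<Rightarrow> complex"
  assumes "integrable (count_space UNIV) f" "integrable (count_space UNIV) g" "integrable (count_space UNIV) h"
  shows "(\<integral>(p, a, b). f p * (g a * h b) \<partial>count_space UNIV)
    = (\<integral>i. f i \<partial>count_space UNIV) * ((\<integral>j. g j \<partial>count_space UNIV) * (\<integral>k. h k \<partial>count_space UNIV))"
  using integral_count_space_prod(2)[OF assms(1) integral_count_space_prod(1)[OF assms(2,3)]]
  unfolding integral_count_space_prod(2)[OF assms(2,3)] by (simp add: case_prod_unfold)

text \<open>
  The number of batches before the cycle has a single possible value on a given path, while the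
  numbers of batches before and after a given moment of the cycle have Poisson weights.
\<close>

lemma
  fixes z1 z2 :: complex and p0 :: nat
  assumes t: "0 \<le> t" "0 \<le> t'" and z: "norm z1 \<le> 1" "norm z2 \<le> 1"
  defines "g \<equiv> \<lambda>(p, a, b). of_bool (p = p0)
    * ((of_real (poisson_weight t a) * z1 ^ a) * (of_real (poisson_weight t' b) * z2 ^ b))"
  shows nn_integral_poisson_pair: "(\<integral>\<^sup>+i. norm (g i) \<partial>count_space UNIV) \<le> 1"
    and integral_poisson_pair: "(\<integral>i. g i \<partial>count_space UNIV)
      = exp (- of_real t * (1 - z1)) * exp (- of_real t' * (1 - z2))"
proof -
  have norm: "norm (of_real (poisson_weight s k) * \<zeta> ^ k) \<le> poisson_weight s k"
    if "0 \<le> s" "norm \<zeta> \<le> 1" for s k and \<zeta> :: complex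
    using poisson_weight_nonneg[OF that(1), of k] that(2)
    by (simp add: norm_mult norm_power mult_left_le power_le_one)
  have "(\<integral>\<^sup>+i. norm (g i) \<partial>count_space UNIV) \<le> (\<integral>\<^sup>+(p, a, b). of_bool (p = p0)
      * (ennreal (poisson_weight t a) * ennreal (poisson_weight t' b)) \<partial>count_space UNIV)"
  proof (intro nn_integral_mono, clarify)
    fix p a b
    have "norm (g (p, a, b)) \<le> of_bool (p = p0) * (poisson_weight t a * poisson_weight t' b)"
      unfolding g_def using t norm[OF t(1) z(1), of a] norm[OF t(2) z(2), of b]
      by (auto simp: norm_mult[of "_ * _" "_ * _"] intro!: mult_mono poisson_weight_nonneg)
    then show "ennreal (norm (g (p, a, b)))
        \<le> of_bool (p = p0) * (ennreal (poisson_weight t a) * ennreal (poisson_weight t' b))"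
      using t by (auto simp: ennreal_mult[symmetric] poisson_weight_nonneg ennreal_leI)
  qed
  also have "\<dots> = 1"
    by (subst nn_integral_count_space_triple, subst nn_integral_count_space_single[where j = p0])
      (simp_all add: nn_integral_poisson_weight t)
  finally show "(\<integral>\<^sup>+i. norm (g i) \<partial>count_space UNIV) \<le> 1" .
  have "summable (\<lambda>p. norm (of_bool (p = p0) :: complex))"
    by (intro summable_finite[of "{p0}"]) auto
  then have single: "integrable (count_space UNIV) (\<lambda>p. of_bool (p = p0) :: complex)"
    by (simp only: integrable_count_space_nat_iff)
  have "(\<integral>p. of_bool (p = p0) \<partial>count_space UNIV) = (1 :: complex)"
    by (subst integral_count_space_single[where j = p0]) auto
  then show "(\<integral>i. g i \<partial>count_space UNIV) = exp (- of_real t * (1 - z1)) * exp (- of_real t' * (1 - z2))"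
    unfolding g_def
    by (subst integral_count_space_triple[OF single integrable_poisson_weight[OF t(1) z(1)] integrable_poisson_weight[OF t(2) z(2)]])
      (simp only: integral_poisson_weight[OF t(1) z(1)] integral_poisson_weight[OF t(2) z(2)] mult_1_left)
qed

text \<open>
  The sum of \<open>residual_kernel l \<omega> a b c * z1 ^ a * z2 ^ b\<close> over all \<open>a\<close> and
  \<open>b\<close>: the residual cycle at an arrival, integrated over its position \<open>u\<close>, when each
  earlier batch carries the factor \<open>z1\<close> and each later one \<open>z2\<close>.
\<close>

definition residual_transform :: "real \<Rightarrow> complex \<Rightarrow> complex \<Rightarrow> complex \<Rightarrow> real \<Rightarrow> complex" where
  "residual_transform l \<omega> z1 z2 c = (\<integral>u. (if 0 \<le> u \<and> u \<le> c then
     exp (- of_real (l * u) * (1 - z1)) * exp (- of_real (l * (c - u)) * (1 - z2))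
       * (of_real l * damp \<omega> (c - u)) else 0) \<partial>lborel)"

lemma residual_transform_closed_form:
  fixes l :: real and z1 z2 \<omega> :: complex
  defines "\<alpha> \<equiv> of_real l - of_real l * z1" and "\<beta> \<equiv> of_real l - of_real l * z2 + \<omega>"
  assumes ne: "\<alpha> \<noteq> \<beta>" and c: "0 \<le> c"
  shows "residual_transform l \<omega> z1 z2 c
    = of_real l * (damp \<alpha> c - damp \<beta> c) / (\<beta> - \<alpha>)"
proof -
  define f where "f u = of_real l * exp (- \<alpha> * of_real u - \<beta> * of_real (c - u))" for u
  define F where "F u = f u / (\<beta> - \<alpha>)" for u
  have "exp (- of_real (l * u) * (1 - z1)) * exp (- of_real (l * (c - u)) * (1 - z2))
       * (of_real l * damp \<omega> (c - u)) = f u" for u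
  proof -
    have "- \<alpha> * of_real u - \<beta> * of_real (c - u)
        = - of_real (l * u) * (1 - z1) + - of_real (l * (c - u)) * (1 - z2) + - \<omega> * of_real (c - u)"
      by (simp add: \<alpha>_def \<beta>_def algebra_simps)
    then show ?thesis
      unfolding f_def by (simp only: exp_add mult_ac)
  qed
  then have "residual_transform l \<omega> z1 z2 c = (\<integral>u. indicator {0..c} u *\<^sub>R f u \<partial>lborel)"
    unfolding residual_transform_def by (intro Bochner_Integration.integral_cong) (auto simp: indicator_def)
  also have "\<dots> = F c - F 0"
  proof (rule integral_FTC_Icc[OF c])
    show "(F has_vector_derivative f x) (at x within {0..c})" for x
    proof -
      let ?E = "\<lambda>v. exp (- \<alpha> * v - \<beta> * (of_real c - v))"
      have "((\<lambda>v. of_real l * ?E v / (\<beta> - \<alpha>)) has_field_derivative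
          of_real l * (?E (of_real x) * (\<beta> - \<alpha>)) / (\<beta> - \<alpha>)) (at (of_real x))"
        by (auto intro!: derivative_eq_intros simp: mult_ac)
      also have "of_real l * (?E (of_real x) * (\<beta> - \<alpha>)) / (\<beta> - \<alpha>) = f x"
        using ne by (simp add: f_def)
      finally show ?thesis
        using has_vector_derivative_real_field by (simp add: F_def[abs_def] f_def[abs_def])
    qed
    show "continuous_on {0..c} f"
      unfolding f_def by (intro continuous_intros)
  qed
  also have "\<dots> = of_real l * (damp \<alpha> c - damp \<beta> c) / (\<beta> - \<alpha>)"
    by (simp add: F_def f_def diff_divide_distrib right_diff_distrib)
  finally show ?thesis .
qed

lemma residual_transform_1:
  assumes "0 \<le> c"
  shows "residual_transform l 0 1 1 c = of_real (l * c)"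
proof -
  have "residual_transform l 0 1 1 c = (\<integral>u. indicator {0..c} u *\<^sub>R complex_of_real l \<partial>lborel)"
    unfolding residual_transform_def by (intro Bochner_Integration.integral_cong) (auto simp: indicator_def)
  also have "\<dots> = of_real (l * c)"
    using assms by (subst integral_scaleR_left) (auto simp: scaleR_conv_of_real)
  finally show ?thesis .
qed

context stationary_globally_gated
begin

text \<open>
  For a fixed path and a fixed position \<open>u\<close> in the cycle, the sum over \<open>p\<close> has a single
  term, and the sums over \<open>a\<close> and \<open>b\<close> are Poisson generating functions. Everything is
  dominated by \<open>rate P\<close> times the indicator of \<open>0 \<le> u \<le> C\<close>, which is integrable
  since the mean cycle length is finite.
\<close>

lemma has_sum_residual_kernels:
  assumes \<omega>: "0 \<le> Re \<omega>" and z: "norm z1 \<le> 1" "norm z2 \<le> 1"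
  shows "((\<lambda>(p, a, b). (\<integral>x. (if epoch P p x \<le> gate P m x \<and> gate P m x < epoch P (Suc p) x
        then residual_kernel (rate P) \<omega> a b (cycle_length P m x) else 0) \<partial>M) * z1 ^ a * z2 ^ b)
    has_sum (\<integral>x. residual_transform (rate P) \<omega> z1 z2 (cycle_length P m x) \<partial>M)) UNIV"
proof -
  let ?l = "rate P" and ?C = "cycle_length P m"
  let ?on = "\<lambda>p x. epoch P p x \<le> gate P m x \<and> gate P m x < epoch P (Suc p) x"
  let ?N = "M \<Otimes>\<^sub>M (lborel :: real measure)"
  interpret MR: pair_sigma_finite M "lborel :: real measure" ..
  have N: "sigma_finite_measure ?N"
    by (rule MR.sigma_finite_measure_axioms)
  define D where "D z = (if 0 \<le> snd z \<and> snd z \<le> ?C (fst z) then ?l else 0)" for z :: "'a \<times> real"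
  define g where "g i z = (case i of (p, a, b) \<Rightarrow> of_bool (?on p (fst z))
      * ((of_real (poisson_weight (?l * snd z) a) * z1 ^ a)
        * (of_real (poisson_weight (?l * (?C (fst z) - snd z)) b) * z2 ^ b)))" for i :: "nat \<times> nat \<times> nat" and z
  define e where "e z = of_real ?l * damp \<omega> (?C (fst z) - snd z)" for z
  define f where "f i z = (if 0 \<le> snd z \<and> snd z \<le> ?C (fst z) then g i z * e z else 0)" for i z
  have f_meas [measurable]: "f i \<in> borel_measurable ?N" for i
    unfolding f_def[abs_def] g_def e_def by (cases i) (simp only: prod.case, measurable)
  have [measurable]: "D \<in> borel_measurable ?N"
    unfolding D_def[abs_def] by measurable
  have regular: "AE z in ?N. regular_path P (fst z)"
    by (rule AE_pair_fst[OF sigma_finite_measure_axioms lborel.sigma_finite_measure_axioms AE_regular])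
  have single: "\<exists>p0. \<forall>p. ?on p x \<longleftrightarrow> p = p0" if "regular_path P x" for x
    using ex_epoch_interval[OF that, of "gate P m x"] gate_mono[OF that, of 0 m] epoch_interval_unique[OF that]
    by (metis gate.simps(1) zero_le)
  have cycle_pos: "0 \<le> ?l * u" "0 \<le> ?l * (?C x - u)" if "0 \<le> u" "u \<le> ?C x" for u x
    using that rate_pos by auto
  have e_norm: "norm (e z) \<le> ?l" if "snd z \<le> ?C (fst z)" for z
    using norm_exp_minus_le_1[OF \<omega>, of "?C (fst z) - snd z"] that rate_pos
    by (simp add: e_def norm_mult mult_left_le del: norm_exp_eq_Re)
  have g_eq: "\<exists>p0. \<forall>i. g i z = (\<lambda>(p, a, b). of_bool (p = p0)
      * ((of_real (poisson_weight (?l * snd z) a) * z1 ^ a)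
        * (of_real (poisson_weight (?l * (?C (fst z) - snd z)) b) * z2 ^ b))) i" if "regular_path P (fst z)" for z
    using single[OF that] unfolding g_def by auto
  have bound: "(\<integral>\<^sup>+i. norm (f i z) \<partial>count_space UNIV) \<le> ennreal (D z)" if reg: "regular_path P (fst z)" for z
  proof (cases "0 \<le> snd z \<and> snd z \<le> ?C (fst z)")
    case True
    have "(\<integral>\<^sup>+i. norm (f i z) \<partial>count_space UNIV) \<le> (\<integral>\<^sup>+i. ennreal ?l * ennreal (norm (g i z)) \<partial>count_space UNIV)"
    proof (rule nn_integral_mono)
      fix i
      have "norm (f i z) \<le> ?l * norm (g i z)"
        using e_norm[of z] True by (simp add: f_def norm_mult mult.commute mult_right_mono)
      then show "ennreal (norm (f i z)) \<le> ennreal ?l * ennreal (norm (g i z))"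
        using rate_pos by (simp add: ennreal_mult[symmetric] ennreal_leI)
    qed
    also have "\<dots> = ennreal ?l * (\<integral>\<^sup>+i. norm (g i z) \<partial>count_space UNIV)"
      by (rule nn_integral_cmult) simp
    also have "\<dots> \<le> ennreal ?l * 1"
    proof (rule mult_left_mono)
      obtain p0 where p0: "\<forall>i. g i z = (\<lambda>(p, a, b). of_bool (p = p0)
        * ((of_real (poisson_weight (?l * snd z) a) * z1 ^ a)
          * (of_real (poisson_weight (?l * (?C (fst z) - snd z)) b) * z2 ^ b))) i"
        using g_eq[OF reg] by blast
      show "(\<integral>\<^sup>+i. norm (g i z) \<partial>count_space UNIV) \<le> 1"
        unfolding p0[rule_format] using True cycle_pos z by (intro nn_integral_poisson_pair) auto
    qed simp
    finally show ?thesis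
      using True by (simp add: D_def)
  next
    case False
    then have "f i z = 0" for i
      by (auto simp: f_def)
    then show ?thesis
      by simp
  qed
  have D_total: "(\<integral>\<^sup>+z. ennreal (D z) \<partial>?N) < \<infinity>"
  proof -
    have "(\<integral>\<^sup>+z. ennreal (D z) \<partial>?N) = (\<integral>\<^sup>+x. (\<integral>\<^sup>+u. ennreal (D (x, u)) \<partial>lborel) \<partial>M)"
      by (rule lborel.nn_integral_fst[symmetric]) simp
    also have "\<dots> = (\<integral>\<^sup>+x. ennreal (?l * ?C x) \<partial>M)"
    proof (rule nn_integral_cong_AE)
      show "AE x in M. (\<integral>\<^sup>+u. ennreal (D (x, u)) \<partial>lborel) = ennreal (?l * ?C x)"
        using AE_cycle_length_nonneg[of m]
      proof eventually_elim
        case (elim x)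
        have "(\<integral>\<^sup>+u. ennreal (D (x, u)) \<partial>lborel) = (\<integral>\<^sup>+u. ennreal ?l * indicator {0..?C x} u \<partial>lborel)"
          by (intro nn_integral_cong) (auto simp: D_def indicator_def)
        also have "\<dots> = ennreal (?l * ?C x)"
          using elim rate_pos by (subst nn_integral_cmult_indicator) (auto simp: ennreal_mult)
        finally show ?case .
      qed
    qed
    also have "\<dots> < \<infinity>"
      using integrable_cycle[of m] AE_cycle_length_nonneg[of m] rate_pos
      by (subst nn_integral_eq_integral) (auto elim!: AE_mp)
    finally show ?thesis .
  qed
  have "(\<integral>\<^sup>+z. (\<integral>\<^sup>+i. norm (f i z) \<partial>count_space UNIV) \<partial>?N) \<le> (\<integral>\<^sup>+z. ennreal (D z) \<partial>?N)"
  proof (rule nn_integral_mono_AE)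
    show "AE z in ?N. (\<integral>\<^sup>+i. norm (f i z) \<partial>count_space UNIV) \<le> ennreal (D z)"
      using regular by eventually_elim (rule bound)
  qed
  then have total: "(\<integral>\<^sup>+z. (\<integral>\<^sup>+i. norm (f i z) \<partial>count_space UNIV) \<partial>?N) < \<infinity>"
    using D_total by (rule le_less_trans)
  have int_f: "integrable ?N (f i)" for i
  proof (rule integrableI_bounded)
    have "(\<integral>\<^sup>+z. norm (f i z) \<partial>?N) \<le> (\<integral>\<^sup>+z. (\<integral>\<^sup>+i. norm (f i z) \<partial>count_space UNIV) \<partial>?N)"
      by (intro nn_integral_mono nn_integral_ge_point[of i UNIV]) simp
    with total show "(\<integral>\<^sup>+z. norm (f i z) \<partial>?N) < \<infinity>"
      by simp
  qed simp
  have left: "(\<integral>z. f (p, a, b) z \<partial>?N) = (\<integral>x. (if ?on p x then residual_kernel ?l \<omega> a b (?C x) else 0) \<partial>M) * z1 ^ a * z2 ^ b" for p a b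
  proof -
    have "(\<integral>z. f (p, a, b) z \<partial>?N) = (\<integral>x. (\<integral>u. f (p, a, b) (x, u) \<partial>lborel) \<partial>M)"
      by (rule MR.integral_fst'[OF int_f, symmetric])
    also have "\<dots> = (\<integral>x. (if ?on p x then residual_kernel ?l \<omega> a b (?C x) else 0) * (z1 ^ a * z2 ^ b) \<partial>M)"
    proof (rule Bochner_Integration.integral_cong[OF refl])
      fix x
      have "f (p, a, b) (x, u) = of_bool (?on p x) * ((erlang_density a ?l u *\<^sub>R
          (if u \<le> ?C x then of_real (poisson_weight (?l * (?C x - u)) b) * damp \<omega> (?C x - u) else 0)) * (z1 ^ a * z2 ^ b))" for u
        by (simp add: f_def g_def e_def erlang_density_eq_poisson_weight scaleR_conv_of_real)
           (simp add: erlang_density_def)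
      then show "(\<integral>u. f (p, a, b) (x, u) \<partial>lborel) = (if ?on p x then residual_kernel ?l \<omega> a b (?C x) else 0) * (z1 ^ a * z2 ^ b)"
        by (simp only: integral_mult_right_zero integral_mult_left_zero residual_kernel_def[symmetric]) simp
    qed
    finally show ?thesis
      by (simp add: mult.assoc)
  qed
  have inner: "(\<integral>i. f i z \<partial>count_space UNIV) = (if 0 \<le> snd z \<and> snd z \<le> ?C (fst z) then
      exp (- of_real (?l * snd z) * (1 - z1)) * exp (- of_real (?l * (?C (fst z) - snd z)) * (1 - z2))
        * (of_real ?l * damp \<omega> (?C (fst z) - snd z)) else 0)" (is "_ = ?g z")
    if reg: "regular_path P (fst z)" for z
  proof (cases "0 \<le> snd z \<and> snd z \<le> ?C (fst z)")
    case True
    obtain p0 where p0: "\<forall>i. g i z = (\<lambda>(p, a, b). of_bool (p = p0)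
      * ((of_real (poisson_weight (?l * snd z) a) * z1 ^ a)
        * (of_real (poisson_weight (?l * (?C (fst z) - snd z)) b) * z2 ^ b))) i"
      using g_eq[OF reg] by blast
    have "(\<integral>i. f i z \<partial>count_space UNIV) = (\<integral>i. g i z \<partial>count_space UNIV) * e z"
      using True by (simp add: f_def)
    also have "(\<integral>i. g i z \<partial>count_space UNIV) = exp (- of_real (?l * snd z) * (1 - z1))
        * exp (- of_real (?l * (?C (fst z) - snd z)) * (1 - z2))"
      unfolding p0[rule_format] using True cycle_pos z by (intro integral_poisson_pair) auto
    also have "\<dots> * e z = ?g z"
      unfolding if_P[OF True] e_def ..
    finally show ?thesis .
  next
    case False
    then have "f i z = 0" for i
      by (auto simp: f_def)
    then show ?thesis
      unfolding if_not_P[OF False] by simp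
  qed
  have "((\<lambda>i. \<integral>z. f i z \<partial>?N) has_sum (\<integral>z. (\<integral>i. f i z \<partial>count_space UNIV) \<partial>?N)) UNIV"
    by (rule integral_has_sum[OF N _ f_meas total]) simp
  also have "(\<lambda>i. \<integral>z. f i z \<partial>?N) = (\<lambda>(p, a, b). (\<integral>x. (if ?on p x then residual_kernel ?l \<omega> a b (?C x) else 0) \<partial>M) * z1 ^ a * z2 ^ b)"
    by (auto simp: fun_eq_iff left)
  also have "(\<integral>z. (\<integral>i. f i z \<partial>count_space UNIV) \<partial>?N) = (\<integral>z. ?g z \<partial>?N)"
  proof (rule integral_cong_AE)
    have "(\<lambda>y. f (snd y) (fst y)) \<in> borel_measurable (?N \<Otimes>\<^sub>M count_space UNIV)"
      by (rule measurable_compose_countable[where f = "\<lambda>i y. f i (fst y)" and g = snd]) simp_all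
    then show "(\<lambda>z. \<integral>i. f i z \<partial>count_space UNIV) \<in> borel_measurable ?N"
      by (intro sigma_finite_measure.borel_measurable_lebesgue_integral sigma_finite_measure_count_space)
        (simp add: case_prod_unfold)
    show "AE z in ?N. (\<integral>i. f i z \<partial>count_space UNIV) = ?g z"
      using regular by eventually_elim (rule inner)
  qed measurable
  also have "(\<integral>z. ?g z \<partial>?N) = (\<integral>x. residual_transform ?l \<omega> z1 z2 (?C x) \<partial>M)"
  proof -
    have "integrable ?N ?g"
    proof (rule integrableI_bounded)
      have "(\<integral>\<^sup>+z. norm (?g z) \<partial>?N) \<le> (\<integral>\<^sup>+z. ennreal (D z) \<partial>?N)"
      proof (rule nn_integral_mono, rule ennreal_leI)
        fix z
        have 1: "norm (exp (- complex_of_real t * (1 - \<zeta>))) \<le> 1" if "0 \<le> t" "norm \<zeta> \<le> 1" for t \<zeta>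
        proof -
          have "0 \<le> Re (1 - \<zeta>)"
            using complex_Re_le_cmod[of \<zeta>] that(2) by simp
          then show ?thesis
            using norm_exp_minus_le_1[of "1 - \<zeta>" t] that(1) by (simp add: mult.commute)
        qed
        show "norm (?g z) \<le> D z"
        proof (cases "0 \<le> snd z \<and> snd z \<le> ?C (fst z)")
          case True
          have "norm (?g z) = norm (exp (- complex_of_real (?l * snd z) * (1 - z1)))
              * norm (exp (- complex_of_real (?l * (?C (fst z) - snd z)) * (1 - z2)))
              * norm (of_real ?l * damp \<omega> (?C (fst z) - snd z))"
            unfolding if_P[OF True] norm_mult by (rule refl)
          also have "\<dots> \<le> 1 * 1 * ?l"
            using True cycle_pos[of "snd z" "fst z"] z e_norm[of z, unfolded e_def] rate_pos
            by (intro mult_mono 1) (auto simp del: norm_exp_eq_Re)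
          finally show ?thesis
            unfolding D_def if_P[OF True] by (simp only: mult_1)
        next
          case False
          then show ?thesis
            unfolding D_def if_not_P[OF False] by simp
        qed
      qed
      with D_total show "(\<integral>\<^sup>+z. norm (?g z) \<partial>?N) < \<infinity>"
        by simp
    qed measurable
    from MR.integral_fst'[OF this, symmetric] show ?thesis
      by (simp only: residual_transform_def fst_conv snd_conv)
  qed
  finally show ?thesis .
qed

end

section \<open>The Palm measure of a cycle\<close>

context stationary_globally_gated
begin

abbreviation MN :: "('a \<times> nat) measure" where
  "MN \<equiv> M \<Otimes>\<^sub>M count_space UNIV"

lemma sigma_finite_count_nat: "sigma_finite_measure (count_space (UNIV :: nat set))"
  by (rule sigma_finite_measure_count_space)

lemma pair_sigma_finite_MN: "pair_sigma_finite M (count_space (UNIV :: nat set))"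
  using sigma_finite_measure_axioms sigma_finite_count_nat by (rule pair_sigma_finite.intro)

lemma sigma_finite_MN: "sigma_finite_measure MN"
proof -
  interpret MN: pair_sigma_finite M "count_space (UNIV :: nat set)"
    by (rule pair_sigma_finite_MN)
  show ?thesis
    by (rule MN.sigma_finite_measure_axioms)
qed

lemma AE_MN: "AE x in M. Q x \<Longrightarrow> AE z in MN. Q (fst z)"
  by (rule AE_pair_fst[OF sigma_finite_measure_axioms sigma_finite_count_nat])

lemma measurable_MN:
  assumes "\<And>n. f n \<in> measurable M A"
  shows "(\<lambda>z. f (snd z) (fst z)) \<in> measurable MN A"
  by (rule measurable_compose_countable[where f = "\<lambda>n z. f n (fst z)" and g = snd])
    (use assms in simp_all)

definition palm_event :: "nat \<Rightarrow> (nat \<Rightarrow> nat) set \<Rightarrow> ('a \<times> nat) set" where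
  "palm_event m Q = {(x, n). x \<in> space M \<and> n \<in> arrivals P m x \<and> batch_size P n x \<in> Q}"

text \<open>
  The batch in question is preceded by \<open>a\<close> and followed by \<open>b\<close> batches of its cycle,
  whose first batch has number \<open>p\<close>.
\<close>

definition window_event :: "nat \<Rightarrow> nat \<times> nat \<times> nat \<Rightarrow> ('a \<times> nat) set" where
  "window_event m = (\<lambda>(p, a, b). {(x, n). x \<in> space M \<and> window P m p (a + Suc b) x \<and> n = p + a})"

lemma measurable_arrivals [measurable]: "Measurable.pred M (\<lambda>x. n \<in> arrivals P m x)"
  unfolding arrivals_def batches_in_def arrival_epoch_eq mem_Collect_eq by measurable

lemma sets_palm_event [measurable]: "palm_event m Q \<in> sets MN"
proof -
  have size: "Measurable.pred M (\<lambda>x. batch_size P n x \<in> Q)" for n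
    by (rule measurable_compose[OF rv_batch_size]) simp
  have "Measurable.pred MN (\<lambda>z. snd z \<in> arrivals P m (fst z) \<and> batch_size P (snd z) (fst z) \<in> Q)"
    using measurable_MN[of "\<lambda>n x. n \<in> arrivals P m x \<and> batch_size P n x \<in> Q"] size by simp
  then have "{z\<in>space MN. snd z \<in> arrivals P m (fst z) \<and> batch_size P (snd z) (fst z) \<in> Q} \<in> sets MN"
    by (simp only: pred_def)
  also have "{z\<in>space MN. snd z \<in> arrivals P m (fst z) \<and> batch_size P (snd z) (fst z) \<in> Q} = palm_event m Q"
    by (auto simp: palm_event_def space_pair_measure)
  finally show ?thesis .
qed

lemma sets_window_event [measurable]: "window_event m i \<in> sets MN"
proof -
  obtain p a b where i: "i = (p, a, b)"
    by (cases i) auto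
  have "Measurable.pred MN (\<lambda>z. window P m p (a + Suc b) (fst z) \<and> snd z = p + a)"
    by measurable
  then have "{z\<in>space MN. window P m p (a + Suc b) (fst z) \<and> snd z = p + a} \<in> sets MN"
    by (simp only: pred_def)
  also have "{z\<in>space MN. window P m p (a + Suc b) (fst z) \<and> snd z = p + a} = window_event m i"
    by (auto simp: window_event_def i space_pair_measure)
  finally show ?thesis .
qed

lemma ex_window_event:
  assumes x: "regular_path P (fst z)" and z: "z \<in> palm_event m Q"
  shows "\<exists>i. z \<in> window_event m i \<and> (\<forall>j. z \<in> window_event m j \<longrightarrow> j = i)"
proof -
  obtain y n where yn: "z = (y, n)"
    by fastforce
  have y: "regular_path P y"
    using x yn by simp
  obtain p r where w: "window P m p r y"
    using ex_window[OF y] by blast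
  then have n: "p \<le> n" "n < p + r"
    using arrivals_window[of P y m p r] x z by (auto simp: palm_event_def yn)
  define a where "a = n - p"
  define b where "b = p + r - Suc n"
  have ab: "r = a + Suc b" "n = p + a"
    using n by (auto simp: a_def b_def)
  have "z \<in> window_event m (p, a, b)"
    using w z by (auto simp: window_event_def yn ab palm_event_def)
  moreover have "j = (p, a, b)" if "z \<in> window_event m j" for j
  proof -
    obtain p' a' b' where j: "j = (p', a', b')"
      by (cases j) auto
    have "window P m p' (a' + Suc b') y" "n = p' + a'"
      using that by (auto simp: window_event_def yn j)
    with window_unique[of P y m p r p' "a' + Suc b'"] x w ab show ?thesis
      by (auto simp: yn j)
  qed
  ultimately show ?thesis
    by blast
qed

lemma integral_window_event:
  fixes F :: "'a \<times> nat \<Rightarrow> complex"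
  assumes F: "integrable MN F"
  shows "(\<integral>z. indicator (window_event m (p, a, b)) z *\<^sub>R F z \<partial>MN)
    = (\<integral>x. (if window P m p (a + Suc b) x then F (x, p + a) else 0) \<partial>M)"
proof -
  interpret MN: pair_sigma_finite M "count_space (UNIV :: nat set)"
    by (rule pair_sigma_finite_MN)
  have "integrable MN (\<lambda>z. indicator (window_event m (p, a, b)) z *\<^sub>R F z)"
    by (rule integrable_mult_indicator[OF sets_window_event F])
  then have "(\<integral>z. indicator (window_event m (p, a, b)) z *\<^sub>R F z \<partial>MN)
      = (\<integral>x. (\<integral>n. indicator (window_event m (p, a, b)) (x, n) *\<^sub>R F (x, n) \<partial>count_space UNIV) \<partial>M)"
    by (rule MN.integral_fst'[symmetric])
  also have "\<dots> = (\<integral>x. (if window P m p (a + Suc b) x then F (x, p + a) else 0) \<partial>M)"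
  proof (rule Bochner_Integration.integral_cong[OF refl])
    fix x assume "x \<in> space M"
    then show "(\<integral>n. indicator (window_event m (p, a, b)) (x, n) *\<^sub>R F (x, n) \<partial>count_space UNIV)
        = (if window P m p (a + Suc b) x then F (x, p + a) else 0)"
      by (subst integral_count_space_single[where j = "p + a"]) (auto simp: window_event_def indicator_def)
  qed
  finally show ?thesis .
qed

lemma mean_residual_transform_1:
  "(\<integral>x. residual_transform (rate P) 0 1 1 (cycle_length P m x) \<partial>M) = complex_of_real (rate P * mean_cycle P)"
proof -
  have "(\<integral>x. residual_transform (rate P) 0 1 1 (cycle_length P m x) \<partial>M)
      = (\<integral>x. complex_of_real (rate P * cycle_length P m x) \<partial>M)"
  proof (rule Bochner_Integration.integral_cong_AE)
    show eq: "AE x in M. residual_transform (rate P) 0 1 1 (cycle_length P m x)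
        = complex_of_real (rate P * cycle_length P m x)"
      using AE_cycle_length_nonneg[of m] by eventually_elim (rule residual_transform_1)
    have "residual_transform (rate P) 0 1 1 \<in> borel_measurable borel"
      unfolding residual_transform_def[abs_def]
      by (rule lborel.borel_measurable_lebesgue_integral) (simp add: case_prod_unfold)
    then show "(\<lambda>x. residual_transform (rate P) 0 1 1 (cycle_length P m x)) \<in> borel_measurable M"
      by simp
  qed simp
  then show ?thesis
    using mean_cycle_eq[of m] by simp
qed

lemma has_sum_window_probabilities:
  "((\<lambda>(p, a, b). prob {x\<in>space M. window P m p (a + Suc b) x}) has_sum (rate P * mean_cycle P)) UNIV"
proof -
  have "(\<integral>x. (if epoch P p x \<le> gate P m x \<and> gate P m x < epoch P (Suc p) x
        then residual_kernel (rate P) 0 a b (cycle_length P m x) else 0) \<partial>M)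
      = complex_of_real (prob {x\<in>space M. window P m p (a + Suc b) x})" for p a b
  proof -
    have "(\<integral>x. (if window P m p (a + Suc b) x
        then damp 0 (truncated_gate P p (Suc m) x - epoch P (Suc (p + a)) x) else 0) \<partial>M)
      = (\<integral>x. complex_of_real (indicator {x\<in>space M. window P m p (a + Suc b) x} x) \<partial>M)"
      by (intro Bochner_Integration.integral_cong) (auto simp: indicator_def)
    then show ?thesis
      using integral_residual_window[of 0 m p a b] by simp
  qed
  moreover note mean_residual_transform_1[of m]
  ultimately have "((\<lambda>(p, a, b). complex_of_real (prob {x\<in>space M. window P m p (a + Suc b) x}))
      has_sum complex_of_real (rate P * mean_cycle P)) UNIV"
    using has_sum_residual_kernels[of 0 1 1 m] by simp
  then have "((\<lambda>i. complex_of_real (case i of (p, a, b) \<Rightarrow> prob {x\<in>space M. window P m p (a + Suc b) x}))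
      has_sum complex_of_real (rate P * mean_cycle P)) UNIV"
    by (simp add: case_prod_unfold)
  then show ?thesis
    by (simp only: has_sum_of_real_iff)
qed

text \<open>
  The windows are summed with weights that are known from the case \<open>\<omega> = 0\<close>: the mean number of
  batches in a cycle is \<open>rate P * mean_cycle P\<close>.
\<close>

lemma emeasure_palm_event_finite: "emeasure MN (palm_event m Q) < \<infinity>"
proof -
  interpret MN: pair_sigma_finite M "count_space (UNIV :: nat set)"
    by (rule pair_sigma_finite_MN)
  interpret N: sigma_finite_measure MN
    by (rule sigma_finite_MN)
  interpret I: sigma_finite_measure "count_space (UNIV :: (nat \<times> nat \<times> nat) set)"
    by (rule sigma_finite_measure_count_space)
  interpret NI: pair_sigma_finite MN "count_space (UNIV :: (nat \<times> nat \<times> nat) set)" ..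
  let ?q = "\<lambda>(p, a, b). prob {x\<in>space M. window P m p (a + Suc b) x}"
  have "emeasure MN (palm_event m Q) = (\<integral>\<^sup>+z. indicator (palm_event m Q) z \<partial>MN)"
    by simp
  also have "\<dots> \<le> (\<integral>\<^sup>+z. (\<integral>\<^sup>+i. indicator (window_event m i) z \<partial>count_space UNIV) \<partial>MN)"
  proof (rule nn_integral_mono_AE)
    show "AE z in MN. indicator (palm_event m Q) z \<le> (\<integral>\<^sup>+i. indicator (window_event m i) z \<partial>count_space UNIV)"
      using AE_MN[OF AE_regular]
    proof eventually_elim
      case (elim z)
      show ?case
      proof (cases "z \<in> palm_event m Q")
        case True
        then obtain i where "z \<in> window_event m i"
          using ex_window_event[OF elim] by blast
        then have "1 \<le> (\<integral>\<^sup>+i. indicator (window_event m i) z \<partial>count_space UNIV)"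
          using nn_integral_ge_point[of i UNIV "\<lambda>i. indicator (window_event m i) z"] by simp
        then show ?thesis
          using True by simp
      qed simp
    qed
  qed
  also have "\<dots> = (\<integral>\<^sup>+i. (\<integral>\<^sup>+z. indicator (window_event m i) z \<partial>MN) \<partial>count_space UNIV)"
  proof (rule NI.Fubini'[symmetric])
    have "(\<lambda>y. indicator (window_event m (snd y)) (fst y) :: ennreal) \<in> borel_measurable (MN \<Otimes>\<^sub>M count_space UNIV)"
      by (rule measurable_compose_countable[where f = "\<lambda>i y. indicator (window_event m i) (fst y)" and g = snd])
        simp_all
    then show "(\<lambda>(z, i). indicator (window_event m i) z :: ennreal) \<in> borel_measurable (MN \<Otimes>\<^sub>M count_space UNIV)"
      by (simp add: case_prod_unfold)
  qed
  also have "\<dots> = (\<integral>\<^sup>+i. ennreal (?q i) \<partial>count_space UNIV)"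
  proof (rule nn_integral_cong)
    fix i :: "nat \<times> nat \<times> nat"
    obtain p a b where i: "i = (p, a, b)"
      by (cases i) auto
    have "(\<integral>\<^sup>+z. indicator (window_event m i) z \<partial>MN)
        = (\<integral>\<^sup>+x. (\<integral>\<^sup>+n. indicator (window_event m i) (x, n) \<partial>count_space UNIV) \<partial>M)"
      by (rule MN.M2.nn_integral_fst[symmetric]) simp
    also have "\<dots> = (\<integral>\<^sup>+x. indicator {x\<in>space M. window P m p (a + Suc b) x} x \<partial>M)"
    proof (rule nn_integral_cong)
      fix x assume "x \<in> space M"
      then show "(\<integral>\<^sup>+n. indicator (window_event m i) (x, n) \<partial>count_space UNIV)
          = indicator {x\<in>space M. window P m p (a + Suc b) x} x"
        by (subst nn_integral_count_space_single[where j = "p + a"]) (auto simp: window_event_def i indicator_def)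
    qed
    also have "\<dots> = ennreal (?q i)"
      by (simp add: i emeasure_eq_measure)
    finally show "(\<integral>\<^sup>+z. indicator (window_event m i) z \<partial>MN) = ennreal (?q i)" .
  qed
  also have "\<dots> < \<infinity>"
  proof -
    have "?q summable_on UNIV"
      using has_sum_window_probabilities by (rule has_sum_imp_summable)
    moreover have "norm (?q i) = ?q i" for i
      by (simp add: case_prod_unfold)
    ultimately have "(\<lambda>i. norm (?q i)) summable_on UNIV"
      by (simp only:)
    then have "Infinite_Set_Sum.abs_summable_on ?q UNIV"
      by (simp only: abs_summable_equivalent)
    then show ?thesis
      by (subst nn_integral_conv_infsetsum) (auto simp: case_prod_unfold)
  qed
  finally show ?thesis .
qed

lemma integrable_palm:
  fixes F :: "'a \<times> nat \<Rightarrow> complex"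
  assumes "F \<in> borel_measurable MN" and "AE z in MN. z \<in> palm_event m Q \<longrightarrow> norm (F z) \<le> 1"
  shows "integrable MN (\<lambda>z. indicator (palm_event m Q) z *\<^sub>R F z)"
proof (rule integrableI_bounded_set[where A = "palm_event m Q" and B = 1])
  show "AE z\<in>palm_event m Q in MN. norm (indicator (palm_event m Q) z *\<^sub>R F z) \<le> 1"
    using assms(2) by eventually_elim auto
qed (use assms(1) emeasure_palm_event_finite in \<open>auto intro!: borel_measurable_scaleR\<close>)

text \<open>
  The marks are averaged for a fixed window; then the sum over all windows is the one of
  \<open>has_sum_residual_kernels\<close>. The three families of marks belong to the earlier batches of the cycle
  (\<open>fe\<close>), to the batch itself (\<open>fo\<close>) and to the later ones (\<open>fl\<close>).
\<close>

lemma integral_palm: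
  fixes F :: "'a \<times> nat \<Rightarrow> complex" and fe fo fl :: "nat \<Rightarrow> 'a \<Rightarrow> complex" and g :: "'a \<Rightarrow> complex"
  assumes \<omega>: "0 \<le> Re \<omega>" and z: "norm z1 \<le> 1" "norm z2 \<le> 1"
    and F: "integrable MN F" and supp: "\<And>z. F z \<noteq> 0 \<Longrightarrow> z \<in> palm_event m UNIV"
    and fe: "\<And>n. fe n \<in> borel_measurable (source_algebra P (batch_sources P n))" "\<And>n. integrable M (fe n)"
      "\<And>n. (\<integral>x. fe n x \<partial>M) = z1"
    and fo: "\<And>n. fo n \<in> borel_measurable (source_algebra P (batch_sources P n))" "\<And>n. integrable M (fo n)"
      "\<And>n. (\<integral>x. fo n x \<partial>M) = w"
    and fl: "\<And>n. fl n \<in> borel_measurable (source_algebra P (batch_sources P n))" "\<And>n. integrable M (fl n)"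
      "\<And>n. (\<integral>x. fl n x \<partial>M) = z2"
    and g: "g \<in> borel_measurable (source_algebra P (switch_sources P (Suc m)))" "integrable M g"
    and eq: "\<And>p a b x. regular_path P x \<Longrightarrow> x \<in> space M \<Longrightarrow> window P m p (a + Suc b) x \<Longrightarrow>
      F (x, p + a) = damp \<omega> (truncated_gate P p (Suc m) x - epoch P (Suc (p + a)) x)
        * ((\<Prod>n=p..<p+a. fe n x) * fo (p + a) x * (\<Prod>n=Suc (p+a)..<Suc (p+a)+b. fl n x)) * g x"
  shows "(\<integral>z. F z \<partial>MN) = (\<integral>x. residual_transform (rate P) \<omega> z1 z2 (cycle_length P m x) \<partial>M) * w * (\<integral>x. g x \<partial>M)"
proof -
  define Y where "Y p a b x = (if window P m p (a + Suc b) x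
      then damp \<omega> (truncated_gate P p (Suc m) x - epoch P (Suc (p + a)) x) else 0)" for p a b x
  define f where "f p a n = (if n < p + a then fe n else if n = p + a then fo n else fl n)" for p a n
  have prod: "(\<Prod>n=p..<p+(a + Suc b). h (f p a n))
      = (\<Prod>n=p..<p+a. h (fe n)) * h (fo (p + a)) * (\<Prod>n=Suc (p+a)..<Suc (p+a)+b. h (fl n))"
    for p a b and h :: "('a \<Rightarrow> complex) \<Rightarrow> complex"
  proof -
    have "{p..<p+(a + Suc b)} = {p..<p+a} \<union> ({p+a} \<union> {Suc (p+a)..<Suc (p+a)+b})"
      by auto
    then have "(\<Prod>n=p..<p+(a + Suc b). h (f p a n))
        = (\<Prod>n=p..<p+a. h (f p a n)) * (h (f p a (p + a)) * (\<Prod>n=Suc (p+a)..<Suc (p+a)+b. h (f p a n)))"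
      by (simp only:) (subst prod.union_disjoint; simp)+
    also have "(\<Prod>n=p..<p+a. h (f p a n)) = (\<Prod>n=p..<p+a. h (fe n))"
      by (rule prod.cong) (auto simp: f_def)
    also have "(\<Prod>n=Suc (p+a)..<Suc (p+a)+b. h (f p a n)) = (\<Prod>n=Suc (p+a)..<Suc (p+a)+b. h (fl n))"
      by (rule prod.cong) (auto simp: f_def)
    finally show ?thesis
      by (simp add: f_def mult.assoc)
  qed
  have Y_clock: "Y p a b \<in> borel_measurable (source_algebra P (clock_sources P m p))" for p a b
  proof -
    have [measurable]: "truncated_gate P p (Suc m) \<in> borel_measurable (source_algebra P (clock_sources P m p))"
      by (rule measurable_truncated_gate_source) (simp add: clock_sources_def)
    have [measurable]: "epoch P (Suc (p + a)) \<in> borel_measurable (source_algebra P (clock_sources P m p))"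
      by (rule measurable_epoch_source) (auto simp: clock_sources_def)
    note [measurable] = measurable_window_clock
    show ?thesis
      unfolding Y_def[abs_def] by measurable
  qed
  have Y_rv: "Y p a b \<in> borel_measurable M" for p a b
    by (rule measurable_source_algebra_imp[OF clock_sources_subset Y_clock])
  have Y_int: "integrable M (Y p a b)" for p a b
  proof (rule integrable_const_bound[OF _ Y_rv])
    show "AE x in M. norm (Y p a b x) \<le> 1"
      using AE_regular
    proof eventually_elim
      case (elim x)
      show ?case
      proof (cases "window P m p (a + Suc b) x")
        case True
        have "epoch P (Suc (p + a)) x \<le> epoch P (p + (a + Suc b)) x"
          by (simp add: epoch_le_iff[OF elim])
        also have "\<dots> \<le> truncated_gate P p (Suc m) x"
          using True by (simp only: window_def)
        finally show ?thesis
          unfolding Y_def if_P[OF True] by (intro norm_exp_minus_le_1[OF \<omega>]) simp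
      qed (simp add: Y_def)
    qed
  qed
  have each: "(\<integral>z. indicator (window_event m (p, a, b)) z *\<^sub>R F z \<partial>MN)
      = ((\<integral>x. (if epoch P p x \<le> gate P m x \<and> gate P m x < epoch P (Suc p) x
        then residual_kernel (rate P) \<omega> a b (cycle_length P m x) else 0) \<partial>M) * z1 ^ a * z2 ^ b) * (w * (\<integral>x. g x \<partial>M))"
    for p a b
  proof -
    have F_rv: "(\<lambda>x. F (x, p + a)) \<in> borel_measurable M"
      using F by (intro measurable_compose[of "\<lambda>x. (x, p + a)" M MN F]) auto
    have f_rv: "f p a n \<in> borel_measurable (source_algebra P (batch_sources P n))" "integrable M (f p a n)" for n
      using fe fo fl by (auto simp: f_def)
    have "(\<integral>z. indicator (window_event m (p, a, b)) z *\<^sub>R F z \<partial>MN)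
        = (\<integral>x. (if window P m p (a + Suc b) x then F (x, p + a) else 0) \<partial>M)"
      by (rule integral_window_event[OF F])
    also have "\<dots> = (\<integral>x. Y p a b x * (\<Prod>n=p..<p+(a + Suc b). f p a n x) * g x \<partial>M)"
    proof (rule integral_cong_AE)
      show "AE x in M. (if window P m p (a + Suc b) x then F (x, p + a) else 0)
          = Y p a b x * (\<Prod>n=p..<p+(a + Suc b). f p a n x) * g x"
        using AE_regular AE_space
      proof eventually_elim
        case (elim x)
        show ?case
          using eq[OF elim, of p a b] prod[of "\<lambda>h. h x"] by (auto simp: Y_def)
      qed
      have "f p a n \<in> borel_measurable M" "g \<in> borel_measurable M" for n
        using f_rv(2)[of n] g(2) by auto
      then show "(\<lambda>x. Y p a b x * (\<Prod>n=p..<p+(a + Suc b). f p a n x) * g x) \<in> borel_measurable M"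
        using Y_rv by (intro borel_measurable_times borel_measurable_prod) auto
    qed (use F_rv in measurable)
    also have "\<dots> = (\<integral>x. Y p a b x \<partial>M) * (\<Prod>n=p..<p+(a + Suc b). \<integral>x. f p a n x \<partial>M) * (\<integral>x. g x \<partial>M)"
      by (rule integral_marks[OF Y_clock Y_int f_rv g])
    also have "(\<integral>x. Y p a b x \<partial>M) = (\<integral>x. (if epoch P p x \<le> gate P m x \<and> gate P m x < epoch P (Suc p) x
        then residual_kernel (rate P) \<omega> a b (cycle_length P m x) else 0) \<partial>M)"
      unfolding Y_def by (rule integral_residual_window[OF \<omega>])
    also have "(\<Prod>n=p..<p+(a + Suc b). \<integral>x. f p a n x \<partial>M) = z1 ^ a * w * z2 ^ b"
      unfolding prod[of "\<lambda>h. \<integral>x. h x \<partial>M"] by (simp add: fe fo fl)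
    finally show ?thesis
      by (simp add: mult_ac)
  qed
  have "((\<lambda>i. \<integral>z. indicator (window_event m i) z *\<^sub>R F z \<partial>MN) has_sum (\<integral>z. F z \<partial>MN)) UNIV"
  proof (rule integral_countable_partition[OF sigma_finite_MN _ F])
    show "AE z in MN. F z \<noteq> 0 \<longrightarrow> (\<exists>i\<in>UNIV. z \<in> window_event m i \<and> (\<forall>j\<in>UNIV. z \<in> window_event m j \<longrightarrow> j = i))"
      using AE_MN[OF AE_regular] by eventually_elim (use ex_window_event supp in blast)
  qed simp_all
  moreover have "((\<lambda>i. \<integral>z. indicator (window_event m i) z *\<^sub>R F z \<partial>MN) has_sum
      (\<integral>x. residual_transform (rate P) \<omega> z1 z2 (cycle_length P m x) \<partial>M) * (w * (\<integral>x. g x \<partial>M))) UNIV"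
    using has_sum_cmult_left[OF has_sum_residual_kernels[OF \<omega> z, of m], of "w * (\<integral>x. g x \<partial>M)"]
    by (simp add: case_prod_unfold each[of "fst i" "fst (snd i)" "snd (snd i)" for i, simplified])
  ultimately have "(\<integral>z. F z \<partial>MN)
      = (\<integral>x. residual_transform (rate P) \<omega> z1 z2 (cycle_length P m x) \<partial>M) * (w * (\<integral>x. g x \<partial>M))"
    by (rule has_sum_unique)
  then show ?thesis
    by (simp only: mult.assoc)
qed

lemma integral_palm_event:
  "(\<integral>z. indicator (palm_event m Q) z *\<^sub>R (1::complex) \<partial>MN)
    = complex_of_real (rate P * mean_cycle P * measure_pmf.prob (batch_pmf P) Q)"
proof -
  have size: "batch_size P n \<in> measurable (source_algebra P (batch_sources P n)) (count_space UNIV)" for n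
    by (rule measurable_batch_size_source) (simp add: batch_sources_def)
  have "(\<integral>z. indicator (palm_event m Q) z *\<^sub>R (1::complex) \<partial>MN)
    = (\<integral>x. residual_transform (rate P) 0 1 1 (cycle_length P m x) \<partial>M)
      * complex_of_real (measure_pmf.prob (batch_pmf P) Q) * (\<integral>x. 1 \<partial>M)"
  proof (rule integral_palm[where fe = "\<lambda>_ _. 1" and fo = "\<lambda>n x. of_bool (batch_size P n x \<in> Q)"
        and fl = "\<lambda>_ _. 1"])
    show "integrable MN (\<lambda>z. indicator (palm_event m Q) z *\<^sub>R (1::complex))"
      by (rule integrable_palm) auto
    show "z \<in> palm_event m UNIV" if "indicator (palm_event m Q) z *\<^sub>R (1::complex) \<noteq> 0" for z
      using that by (auto simp: palm_event_def indicator_def split: if_splits)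
    show rv: "(\<lambda>x. of_bool (batch_size P n x \<in> Q) :: complex) \<in> borel_measurable (source_algebra P (batch_sources P n))" for n
      by (rule measurable_compose[OF size]) simp
    show "integrable M (\<lambda>x. of_bool (batch_size P n x \<in> Q) :: complex)" for n
      by (rule integrable_const_bound[where B = 1])
        (auto intro: measurable_source_algebra_imp[OF batch_sources_subset rv])
    show "(\<integral>x. of_bool (batch_size P n x \<in> Q) \<partial>M) = complex_of_real (measure_pmf.prob (batch_pmf P) Q)" for n
    proof -
      have "(\<integral>k. complex_of_real (indicator Q k) \<partial>distr M (count_space UNIV) (batch_size P n))
          = (\<integral>x. complex_of_real (indicator Q (batch_size P n x)) \<partial>M)"
        by (rule integral_distr) simp_all
      moreover have "complex_of_real (indicator Q k) = of_bool (k \<in> Q)" for k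
        by (simp add: indicator_def)
      ultimately have "(\<integral>x. of_bool (batch_size P n x \<in> Q) \<partial>M) = (\<integral>k. complex_of_real (indicator Q k) \<partial>batch_pmf P)"
        by (simp only: batch_size_distr)
      then show ?thesis
        by simp
    qed
    show "indicator (palm_event m Q) (x, p + a) *\<^sub>R (1::complex)
        = damp 0 (truncated_gate P p (Suc m) x - epoch P (Suc (p + a)) x)
          * ((\<Prod>n=p..<p+a. 1) * of_bool (batch_size P (p + a) x \<in> Q) * (\<Prod>n=Suc (p+a)..<Suc (p+a)+b. 1)) * 1"
      if "regular_path P x" "x \<in> space M" "window P m p (a + Suc b) x" for p a b x
      using arrivals_window[OF that(1,3)] that(2) by (auto simp: palm_event_def indicator_def)
  qed (simp_all add: prob_space)
  then show ?thesis
    by (simp add: prob_space mean_residual_transform_1)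
qed

end

section \<open>The transform of the sojourn time\<close>

context stationary_globally_gated
begin

lemma rv_batch_work: "i \<in> {1..nq P} \<Longrightarrow> batch_work P n i \<in> borel_measurable M"
  by (intro measurable_source_algebra_imp[OF order_refl] measurable_batch_work_source batch_sources_subset)

lemma rv_visit_start:
  assumes i: "i \<in> {1..nq P}"
  shows "visit_start P (Suc m) i \<in> borel_measurable M"
proof -
  have "(\<lambda>x. \<Sum>n\<in>arrivals P m x. batch_work P n l x) \<in> borel_measurable M" if "l \<in> {1..nq P}" for l
    using rv_batch_work[OF that] by (intro borel_measurable_random_sum) auto
  then have "(\<lambda>x. \<Sum>l\<in>{1..<i}. gated_work P (Suc m) l x + switchover P (Suc m) l x) \<in> borel_measurable M"
    unfolding gated_work_Suc using i
    by (intro borel_measurable_sum borel_measurable_add rv_switchover) auto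
  then show ?thesis
    unfolding visit_start_def[abs_def] by simp
qed

lemma rv_completion:
  assumes i: "i \<in> {1..nq P}"
  shows "completion P m n i c \<in> borel_measurable M"
proof -
  have "(\<lambda>x. \<Sum>n'\<in>{n'\<in>arrivals P m x. n' < n}. batch_work P n' i x) \<in> borel_measurable M"
    using rv_batch_work[OF i] by (intro borel_measurable_random_sum) auto
  then show ?thesis
    unfolding completion_def[abs_def] using rv_visit_start[OF i] rv_service[OF i]
    by (intro borel_measurable_add borel_measurable_sum) auto
qed

text \<open>
  The maximum runs over a random set of customers, which depends on the batch size through countably many values:
  its restriction to the existing queues.
\<close>

lemma rv_sojourn: "sojourn P m n \<in> borel_measurable M"
proof -
  define sizes where "sizes x = map (batch_size P n x) [0..<Suc (nq P)]" for x
  let ?I = "\<lambda>l :: nat list. SIGMA i:{1..nq P}. {..<l ! i}"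
  let ?f = "\<lambda>l x. Max ((\<lambda>ic. completion P m n (fst ic) (snd ic) x) ` ?I l) - arrival_epoch P n x"
  have sizes: "sizes \<in> measurable M (count_space UNIV)"
    unfolding sizes_def[abs_def] by (rule measurable_compose[OF rv_batch_size]) simp
  have "(\<lambda>x. ?f (sizes x) x) \<in> borel_measurable M"
  proof (rule measurable_compose_countable[OF _ sizes])
    fix l
    have "(\<lambda>x. Max ((\<lambda>ic. completion P m n (fst ic) (snd ic) x) ` ?I l)) \<in> borel_measurable M"
      by (rule borel_measurable_Max) (auto intro!: rv_completion)
    then show "?f l \<in> borel_measurable M"
      unfolding arrival_epoch_eq by simp
  qed
  moreover have "?f (sizes x) x = sojourn P m n x" for x
  proof -
    have "sizes x ! i = batch_size P n x i" if "i \<in> {1..nq P}" for i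
      using that unfolding sizes_def by (subst nth_map) (auto simp del: upt_Suc)
    then have "(\<lambda>ic. completion P m n (fst ic) (snd ic) x) ` ?I (sizes x)
        = {completion P m n i c x | i c. i \<in> {1..nq P} \<and> c < batch_size P n x i}"
      by (force simp: image_iff)
    then show ?thesis
      by (simp only: sojourn_def)
  qed
  ultimately show ?thesis
    by simp
qed

lemma rv_sojourn_MN [measurable]: "(\<lambda>z. sojourn P m (snd z) (fst z)) \<in> borel_measurable MN"
  by (rule measurable_MN) (rule rv_sojourn)

lemma ex_last_queue:
  assumes "k \<in> set_pmf (batch_pmf P)"
  shows "\<exists>i\<in>{1..nq P}. 0 < k i \<and> (\<forall>l\<in>{i<..nq P}. k l = 0)"
proof -
  let ?S = "{i\<in>{1..nq P}. 0 < k i}"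
  have fin: "finite ?S" and ne: "?S \<noteq> {}"
    using batch_nonempty[OF assms] by auto
  have "Max ?S \<in> ?S"
    by (rule Max_in[OF fin ne])
  moreover have "k l = 0" if "l \<in> {Max ?S<..nq P}" for l
  proof (rule ccontr)
    assume "k l \<noteq> 0"
    then have "l \<in> ?S"
      using that by auto
    then have "l \<le> Max ?S"
      by (rule Max_ge[OF fin])
    with that show False
      by simp
  qed
  ultimately show ?thesis
    by blast
qed

lemma sojourn_nonneg:
  assumes x: "regular_path P x" and n: "n \<in> arrivals P m x"
  shows "0 \<le> sojourn P m n x"
proof -
  have "batch_size P n x \<in> set_pmf (batch_pmf P)"
    using x by (simp add: regular_path_def)
  then obtain i where i: "i \<in> {1..nq P}" "0 < batch_size P n x i"
    and last: "\<And>l. l \<in> {i<..nq P} \<Longrightarrow> batch_size P n x l = 0"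
    using ex_last_queue by blast
  have "sojourn P m n x = visit_start P (Suc m) i x
    + (\<Sum>n'\<in>{n'\<in>arrivals P m x. n' < n}. batch_work P n' i x) + batch_work P n i x - arrival_epoch P n x"
    by (rule sojourn_last_queue[OF x n i]) (rule last)
  moreover have "0 \<le> (\<Sum>n'\<in>{n'\<in>arrivals P m x. n' < n}. batch_work P n' i x)" "0 \<le> batch_work P n i x"
    using batch_work_nonneg[OF x i(1)] by (auto intro!: sum_nonneg)
  moreover have "arrival_epoch P n x \<le> gate P (Suc m) x"
    using n by (simp add: arrivals_def batches_in_def)
  moreover have "0 \<le> (\<Sum>l\<in>{1..<i}. gated_work P (Suc m) l x + switchover P (Suc m) l x)"
    using i(1) by (intro sum_nonneg add_nonneg_nonneg gated_work_nonneg[OF x] switchover_nonneg[OF x]) auto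
  ultimately show ?thesis
    by (simp add: visit_start_def)
qed

abbreviation damped_sojourn :: "nat \<Rightarrow> complex \<Rightarrow> 'a \<times> nat \<Rightarrow> complex" where
  "damped_sojourn m \<omega> z \<equiv> damp \<omega> (sojourn P m (snd z) (fst z))"

lemma integrable_damped_sojourn:
  assumes \<omega>: "0 \<le> Re \<omega>"
  shows "integrable MN (\<lambda>z. indicator (palm_event m Q) z *\<^sub>R damped_sojourn m \<omega> z)"
proof (rule integrable_palm)
  show "AE z in MN. z \<in> palm_event m Q \<longrightarrow> norm (damped_sojourn m \<omega> z) \<le> 1"
    using AE_MN[OF AE_regular]
  proof eventually_elim
    case (elim z)
    show ?case
    proof
      assume "z \<in> palm_event m Q"
      then have "snd z \<in> arrivals P m (fst z)"
        by (auto simp: palm_event_def)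
      then show "norm (damped_sojourn m \<omega> z) \<le> 1"
        by (intro norm_exp_minus_le_1[OF \<omega>] sojourn_nonneg[OF elim])
    qed
  qed
qed measurable

lemma measure_palm_event: "measure MN (palm_event m Q) = rate P * mean_cycle P * measure_pmf.prob (batch_pmf P) Q"
proof -
  have "integrable MN (indicat_real (palm_event m Q))"
    using emeasure_palm_event_finite by (intro integrable_real_indicator) auto
  then have "(\<integral>z. indicator (palm_event m Q) z *\<^sub>R (1::complex) \<partial>MN) = complex_of_real (measure MN (palm_event m Q))"
    using sets.Int_space_eq2[OF sets_palm_event[of m Q]]
    by (subst integral_scaleR_left) (simp_all add: scaleR_conv_of_real)
  then show ?thesis
    unfolding integral_palm_event using of_real_eq_iff by metis
qed

text \<open>
  The normalisation of the Palm measure is the mean number of batches of the given sizes in a cycle, \<open>rate P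
  * mean_cycle P * P(K \<in> Q)\<close>.
\<close>

lemma lst_sojourn_law:
  assumes Q: "0 < measure_pmf.prob (batch_pmf P) Q"
  shows "complex_of_real (measure_pmf.prob (batch_pmf P) Q) * lst (sojourn_law P m Q) \<omega>
    = (\<integral>z. indicator (palm_event m Q) z *\<^sub>R damped_sojourn m \<omega> z \<partial>MN) / complex_of_real (rate P * mean_cycle P)"
proof -
  let ?A = "palm_event m Q" and ?c = "rate P * mean_cycle P * measure_pmf.prob (batch_pmf P) Q"
  have c: "0 < ?c"
    using Q rate_pos mean_cycle_pos by simp
  have em: "emeasure MN ?A = ennreal ?c"
    using emeasure_eq_ennreal_measure[of MN ?A] emeasure_palm_event_finite[of m Q]
    by (simp add: measure_palm_event)
  have batch: "arbitrary_batch P m Q = uniform_measure MN ?A"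
    by (simp add: arbitrary_batch_def palm_event_def)
  also have "\<dots> = density MN (\<lambda>z. ennreal (indicator ?A z / ?c))"
    unfolding uniform_measure_def em
    by (intro density_cong AE_I2) (use c in \<open>auto simp: divide_ennreal[symmetric] indicator_def\<close>)
  finally have dens: "arbitrary_batch P m Q = density MN (\<lambda>z. ennreal (indicator ?A z / ?c))" .
  have "lst (sojourn_law P m Q) \<omega> = (\<integral>z. damped_sojourn m \<omega> z \<partial>arbitrary_batch P m Q)"
    unfolding lst_def sojourn_law_def dens by (subst integral_distr) (simp_all add: case_prod_unfold)
  also have "\<dots> = (\<integral>z. (indicator ?A z / ?c) *\<^sub>R damped_sojourn m \<omega> z \<partial>MN)"
    unfolding dens using c by (intro integral_density) auto
  also have "\<dots> = (\<integral>z. (1 / ?c) *\<^sub>R (indicator ?A z *\<^sub>R damped_sojourn m \<omega> z) \<partial>MN)"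
    by (intro Bochner_Integration.integral_cong) auto
  also have "\<dots> = (1 / ?c) *\<^sub>R (\<integral>z. indicator ?A z *\<^sub>R damped_sojourn m \<omega> z \<partial>MN)"
    by (rule integral_scaleR_right)
  finally show ?thesis
    using Q by (simp add: scaleR_conv_of_real)
qed

lemma service_vec_eq: "service_vec P \<omega> 1 i = (\<lambda>l. if l \<in> {1..i} then lst (service_law P l) \<omega> else 1)"
  by (auto simp: service_vec_def)

lemma norm_batch_pgf_service_vec:
  assumes \<omega>: "0 \<le> Re \<omega>" and i: "i \<le> nq P"
  shows "norm (batch_pgf P (service_vec P \<omega> 1 i)) \<le> 1"
proof -
  have L: "{1..i} \<subseteq> {1..nq P}"
    using i by auto
  have "(\<lambda>x. \<Sum>l=1..i. batch_work P 0 l x) \<in> borel_measurable M"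
    using L by (intro borel_measurable_sum rv_batch_work) auto
  moreover have "AE x in M. 0 \<le> (\<Sum>l=1..i. batch_work P 0 l x)"
    using AE_regular by eventually_elim (use L in \<open>auto intro!: sum_nonneg batch_work_nonneg\<close>)
  ultimately show ?thesis
    unfolding service_vec_eq integral_batch_work[OF \<omega> L, of 0, symmetric]
    by (rule norm_integral_damped[OF \<omega>])
qed

text \<open>
  Here the law of the cycle length enters: its transform at \<open>\<alpha>\<close> and \<open>\<beta>\<close> is
  independent of the cycle number.
\<close>

lemma mean_residual_transform:
  assumes \<omega>: "0 \<le> Re \<omega>" "\<omega> \<noteq> 0" and i: "i \<in> {1..nq P}"
  shows "(\<integral>x. residual_transform (rate P) \<omega> (batch_pgf P (service_vec P \<omega> 1 i))
      (batch_pgf P (service_vec P \<omega> 1 (i - 1))) (cycle_length P m x) \<partial>M)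
    = complex_of_real (rate P) * cycle_term P \<omega> i"
proof -
  let ?l = "complex_of_real (rate P)"
  let ?z1 = "batch_pgf P (service_vec P \<omega> 1 i)" and ?z2 = "batch_pgf P (service_vec P \<omega> 1 (i - 1))"
  define \<alpha> where "\<alpha> = ?l - ?l * ?z1"
  define \<beta> where "\<beta> = ?l - ?l * ?z2 + \<omega>"
  have diff: "\<beta> - \<alpha> = \<omega> - ?l * (?z2 - ?z1)"
    by (simp add: \<alpha>_def \<beta>_def algebra_simps)
  have ne: "\<alpha> \<noteq> \<beta>"
    using cycle_term_denominator_nonzero[OF \<omega> i] diff by auto
  have Re_pos: "0 \<le> Re (?l - ?l * z)" if "norm z \<le> 1" for z
  proof -
    have "Re z \<le> 1"
      using complex_Re_le_cmod[of z] that by simp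
    then show ?thesis
      using rate_pos by simp
  qed
  have Re: "0 \<le> Re \<alpha>" "0 \<le> Re \<beta>"
    unfolding \<alpha>_def \<beta>_def using Re_pos norm_batch_pgf_service_vec[OF \<omega>(1)] i \<omega>(1) by (auto intro!: add_nonneg_nonneg)
  have "(\<integral>x. residual_transform (rate P) \<omega> ?z1 ?z2 (cycle_length P m x) \<partial>M)
      = (\<integral>x. ?l * (damp \<alpha> (cycle_length P m x) - damp \<beta> (cycle_length P m x)) / (\<beta> - \<alpha>) \<partial>M)"
  proof (rule integral_cong_AE)
    show "AE x in M. residual_transform (rate P) \<omega> ?z1 ?z2 (cycle_length P m x)
        = ?l * (damp \<alpha> (cycle_length P m x) - damp \<beta> (cycle_length P m x)) / (\<beta> - \<alpha>)"
      using AE_cycle_length_nonneg[of m]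
      by eventually_elim (unfold \<alpha>_def \<beta>_def, rule residual_transform_closed_form, use ne in \<open>auto simp: \<alpha>_def \<beta>_def\<close>)
    have "residual_transform (rate P) \<omega> ?z1 ?z2 \<in> borel_measurable borel"
      unfolding residual_transform_def[abs_def]
      by (rule lborel.borel_measurable_lebesgue_integral) (simp add: case_prod_unfold)
    then show "(\<lambda>x. residual_transform (rate P) \<omega> ?z1 ?z2 (cycle_length P m x)) \<in> borel_measurable M"
      by simp
  qed simp
  also have "\<dots> = ?l * (cycle_lst P \<alpha> - cycle_lst P \<beta>) / (\<beta> - \<alpha>)"
    using integrable_damped_cycle[OF Re(1), of m] integrable_damped_cycle[OF Re(2), of m]
    unfolding cycle_lst_eq[of _ m] by simp
  also have "\<dots> = ?l * cycle_term P \<omega> i"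
    unfolding cycle_term_def Let_def diff by (simp add: \<alpha>_def \<beta>_def)
  finally show ?thesis .
qed

text \<open>
  By \<open>sojourn_window\<close> the damped sojourn time is a product of a damped residual cycle, of one mark
  per batch and of a function of the switch-over times, as required by \<open>integral_palm\<close>.
\<close>

lemma integral_sojourn_single_size:
  assumes \<omega>: "0 \<le> Re \<omega>" "\<omega> \<noteq> 0" and i: "i \<in> {1..nq P}" "0 < k i"
    and last: "\<And>l. l \<in> {i<..nq P} \<Longrightarrow> k l = 0"
  shows "(\<integral>z. indicator (palm_event m {k}) z *\<^sub>R damped_sojourn m \<omega> z \<partial>MN)
    = complex_of_real (rate P) * cycle_term P \<omega> i
      * (complex_of_real (pmf (batch_pmf P) k) * (\<Prod>l=1..i. lst (service_law P l) \<omega> ^ k l))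
      * (\<Prod>l=1..i-1. lst (switch_law P l) \<omega>)"
proof -
  let ?L = "{1..i}" and ?L' = "{1..i-1}"
  have L: "?L \<subseteq> {1..nq P}" "?L' \<subseteq> {1..nq P}"
    using i by auto
  let ?E = "\<lambda>L n x. damp \<omega> (\<Sum>l\<in>L. batch_work P n l x)"
  let ?S = "\<lambda>x. damp \<omega> (\<Sum>l\<in>?L'. switchover P (Suc m) l x)"
  have E: "?E L n \<in> borel_measurable (source_algebra P (batch_sources P n))" if "L \<subseteq> {1..nq P}" for L n
  proof -
    note [measurable] = measurable_batch_work_sum_source[OF that]
    show ?thesis
      by measurable
  qed
  have size: "indicator {x\<in>space M. batch_size P n x = k} \<in> borel_measurable (source_algebra P (batch_sources P n))" for n
  proof (rule borel_measurable_indicator)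
    have "{x\<in>space M. batch_size P n x = k} \<in> source_events P (Batch_Size n)"
      by (auto intro!: exI[of _ "{k}"])
    then show "{x\<in>space M. batch_size P n x = k} \<in> sets (source_algebra P (batch_sources P n))"
      by (rule source_event_in_algebra[rotated]) (simp add: batch_sources_def)
  qed
  have S: "?S \<in> borel_measurable (source_algebra P (switch_sources P (Suc m)))"
  proof -
    note [measurable] = rv_switchover_sum[OF L(2), of "Suc m"]
    show ?thesis
      by measurable
  qed
  have "(\<integral>z. indicator (palm_event m {k}) z *\<^sub>R damped_sojourn m \<omega> z \<partial>MN)
    = (\<integral>x. residual_transform (rate P) \<omega> (batch_pgf P (service_vec P \<omega> 1 i))
        (batch_pgf P (service_vec P \<omega> 1 (i - 1))) (cycle_length P m x) \<partial>M)
      * (complex_of_real (pmf (batch_pmf P) k) * (\<Prod>l=1..i. lst (service_law P l) \<omega> ^ k l)) * (\<integral>x. ?S x \<partial>M)"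
  proof (rule integral_palm[where fe = "?E ?L" and fl = "?E ?L'"
        and fo = "\<lambda>n x. indicator {x\<in>space M. batch_size P n x = k} x * ?E ?L n x"])
    show "norm (batch_pgf P (service_vec P \<omega> 1 i)) \<le> 1" "norm (batch_pgf P (service_vec P \<omega> 1 (i - 1))) \<le> 1"
    proof -
      have "i \<le> nq P" "i - 1 \<le> nq P"
        using i by auto
      then show "norm (batch_pgf P (service_vec P \<omega> 1 i)) \<le> 1" "norm (batch_pgf P (service_vec P \<omega> 1 (i - 1))) \<le> 1"
        using norm_batch_pgf_service_vec[OF \<omega>(1)] by blast+
    qed
    show "integrable MN (\<lambda>z. indicator (palm_event m {k}) z *\<^sub>R damped_sojourn m \<omega> z)"
      by (rule integrable_damped_sojourn[OF \<omega>(1)])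
    show "z \<in> palm_event m UNIV" if "indicator (palm_event m {k}) z *\<^sub>R damped_sojourn m \<omega> z \<noteq> 0" for z
      using that by (auto simp: palm_event_def indicator_def split: if_splits)
    show "(\<integral>x. ?E ?L n x \<partial>M) = batch_pgf P (service_vec P \<omega> 1 i)" for n
      unfolding service_vec_eq by (rule integral_batch_work[OF \<omega>(1) L(1)])
    show "(\<integral>x. ?E ?L' n x \<partial>M) = batch_pgf P (service_vec P \<omega> 1 (i - 1))" for n
      unfolding service_vec_eq by (rule integral_batch_work[OF \<omega>(1) L(2)])
    show "(\<integral>x. indicator {x\<in>space M. batch_size P n x = k} x * ?E ?L n x \<partial>M)
        = complex_of_real (pmf (batch_pmf P) k) * (\<Prod>l=1..i. lst (service_law P l) \<omega> ^ k l)" for n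
      by (rule integral_batch_size_services[OF \<omega>(1) L(1)])
    show "?E ?L n \<in> borel_measurable (source_algebra P (batch_sources P n))"
      "?E ?L' n \<in> borel_measurable (source_algebra P (batch_sources P n))" for n
      by (rule E[OF L(1)], rule E[OF L(2)])
    show "(\<lambda>x. indicator {x\<in>space M. batch_size P n x = k} x * ?E ?L n x)
        \<in> borel_measurable (source_algebra P (batch_sources P n))" for n
      by (rule borel_measurable_times[OF size E[OF L(1)]])
    show "integrable M (?E ?L n)" "integrable M (?E ?L' n)" for n
      by (rule integrable_batch_work[OF \<omega>(1) L(1)], rule integrable_batch_work[OF \<omega>(1) L(2)])
    show "integrable M (\<lambda>x. indicator {x\<in>space M. batch_size P n x = k} x * ?E ?L n x)" for n
    proof -
      have "{x\<in>space M. batch_size P n x = k} \<in> events"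
        by measurable
      from integrable_mult_indicator[OF this integrable_batch_work[OF \<omega>(1) L(1), of n]] show ?thesis
        by (rule back_subst[where P = "integrable M"]) (auto simp: indicator_def)
    qed
    show "?S \<in> borel_measurable (source_algebra P (switch_sources P (Suc m)))"
      by (rule S)
    show "integrable M ?S"
      by (rule integrable_switchovers[OF \<omega>(1) L(2)])
    show "indicator (palm_event m {k}) (x, p + a) *\<^sub>R damped_sojourn m \<omega> (x, p + a)
        = damp \<omega> (truncated_gate P p (Suc m) x - epoch P (Suc (p + a)) x)
          * ((\<Prod>n=p..<p+a. ?E ?L n x) * (indicator {x\<in>space M. batch_size P (p + a) x = k} x * ?E ?L (p + a) x)
            * (\<Prod>n=Suc (p+a)..<Suc (p+a)+b. ?E ?L' n x)) * ?S x"
      if x: "regular_path P x" "x \<in> space M" and w: "window P m p (a + Suc b) x" for p a b x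
    proof (cases "batch_size P (p + a) x = k")
      case False
      then show ?thesis
        by (simp add: palm_event_def)
    next
      case True
      have "(x, p + a) \<in> palm_event m {k}"
        using arrivals_window[OF x(1) w] x(2) True by (simp add: palm_event_def)
      moreover have "sojourn P m (p + a) x = (truncated_gate P p (Suc m) x - epoch P (Suc (p + a)) x)
          + (\<Sum>n=p..<p+a. \<Sum>l=1..i. batch_work P n l x)
          + (\<Sum>l=1..i. batch_work P (p + a) l x)
          + (\<Sum>n=Suc (p+a)..<Suc (p+a)+b. \<Sum>l=1..i-1. batch_work P n l x)
          + (\<Sum>l=1..i-1. switchover P (Suc m) l x)"
        using i last True by (intro sojourn_window[OF x(1) w]) auto
      moreover have "damp \<omega> (\<Sum>n\<in>A. h n) = (\<Prod>n\<in>A. damp \<omega> (h n))"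
        if "finite A" for A :: "nat set" and h
        using that by (simp add: exp_sum[symmetric] sum_distrib_left sum_negf)
      ultimately show ?thesis
        using True x(2)
        by (simp only: indicator_simps scaleR_one fst_conv snd_conv mem_Collect_eq simp_thms of_real_add
            distrib_left exp_add finite_atLeastLessThan mult_1_left mult_ac)
    qed
  qed (rule \<omega>(1))
  then show ?thesis
    unfolding integral_switchovers[OF \<omega>(1) L(2)] mean_residual_transform[OF \<omega> i(1)] .
qed

lemma sojourn_transform_single_size:
  assumes \<omega>: "0 \<le> Re \<omega>" "\<omega> \<noteq> 0" and k: "k \<in> set_pmf (batch_pmf P)" and i: "i \<in> {1..nq P}" "0 < k i"
    and last: "\<And>l. l \<in> {i<..nq P} \<Longrightarrow> k l = 0"
  shows "lst (sojourn_law P m {k}) \<omega> = 1 / complex_of_real (mean_cycle P) * cycle_term P \<omega> i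
    * (\<Prod>j=1..i-1. lst (switch_law P j) \<omega>) * (\<Prod>j=1..i. lst (service_law P j) \<omega> ^ k j)"
proof -
  have pos: "0 < pmf (batch_pmf P) k"
    using k by (rule pmf_positive)
  then have "complex_of_real (pmf (batch_pmf P) k) * lst (sojourn_law P m {k}) \<omega>
      = complex_of_real (rate P) * cycle_term P \<omega> i
      * (complex_of_real (pmf (batch_pmf P) k) * (\<Prod>l=1..i. lst (service_law P l) \<omega> ^ k l))
      * (\<Prod>l=1..i-1. lst (switch_law P l) \<omega>) / complex_of_real (rate P * mean_cycle P)"
    using lst_sojourn_law[of "{k}" m \<omega>] integral_sojourn_single_size[where k = k and m = m, OF \<omega> i last]
    by (simp add: measure_pmf_single)
  also have "\<dots> = complex_of_real (pmf (batch_pmf P) k) * (1 / complex_of_real (mean_cycle P) * cycle_term P \<omega> i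
    * (\<Prod>j=1..i-1. lst (switch_law P j) \<omega>) * (\<Prod>j=1..i. lst (service_law P j) \<omega> ^ k j))"
    using rate_pos by (simp add: field_simps)
  finally show ?thesis
    using pos unfolding mult_cancel_left by auto
qed

text \<open>
  The Palm events of the single batch sizes partition the Palm event of all batches.
\<close>

lemma has_sum_sojourn_transforms:
  assumes \<omega>: "0 \<le> Re \<omega>"
  shows "((\<lambda>k. complex_of_real (pmf (batch_pmf P) k) * lst (sojourn_law P m {k}) \<omega>)
    has_sum lst (sojourn_law P m UNIV) \<omega>) (set_pmf (batch_pmf P))"
proof -
  let ?F = "\<lambda>Q z. indicator (palm_event m Q) z *\<^sub>R damped_sojourn m \<omega> z"
  let ?B = "\<lambda>k. {z\<in>space MN. batch_size P (snd z) (fst z) = k}"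
  have B: "?B k \<in> sets MN" for k
  proof -
    have "Measurable.pred M (\<lambda>x. batch_size P n x = k)" for n
      by measurable
    then have "Measurable.pred MN (\<lambda>z. batch_size P (snd z) (fst z) = k)"
      by (rule measurable_MN)
    then show ?thesis
      by (simp only: pred_def)
  qed
  have "((\<lambda>k. \<integral>z. indicator (?B k) z *\<^sub>R ?F UNIV z \<partial>MN) has_sum (\<integral>z. ?F UNIV z \<partial>MN)) (set_pmf (batch_pmf P))"
  proof (rule integral_countable_partition[OF sigma_finite_MN _ integrable_damped_sojourn[OF \<omega>] B])
    show "AE z in MN. ?F UNIV z \<noteq> 0 \<longrightarrow> (\<exists>k\<in>set_pmf (batch_pmf P). z \<in> ?B k
        \<and> (\<forall>j\<in>set_pmf (batch_pmf P). z \<in> ?B j \<longrightarrow> j = k))"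
      using AE_MN[OF AE_regular] AE_space
    proof eventually_elim
      case (elim z)
      have "batch_size P (snd z) (fst z) \<in> set_pmf (batch_pmf P)"
        using elim(1) unfolding regular_path_def by blast
      then show ?case
        using elim(2) by blast
    qed
  qed simp
  moreover have "(\<integral>z. indicator (?B k) z *\<^sub>R ?F UNIV z \<partial>MN) = (\<integral>z. ?F {k} z \<partial>MN)" for k
  proof (rule Bochner_Integration.integral_cong[OF refl])
    fix z assume "z \<in> space MN"
    then have "z \<in> palm_event m {k} \<longleftrightarrow> z \<in> ?B k \<and> z \<in> palm_event m UNIV"
      by (auto simp: palm_event_def)
    then show "indicator (?B k) z *\<^sub>R ?F UNIV z = ?F {k} z"
      by (simp add: indicator_def)
  qed
  ultimately have scaled: "((\<lambda>k. (\<integral>z. ?F {k} z \<partial>MN) * inverse (complex_of_real (rate P * mean_cycle P)))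
      has_sum (\<integral>z. ?F UNIV z \<partial>MN) * inverse (complex_of_real (rate P * mean_cycle P))) (set_pmf (batch_pmf P))"
    by (intro has_sum_cmult_left) simp
  have total: "(\<integral>z. ?F UNIV z \<partial>MN) * inverse (complex_of_real (rate P * mean_cycle P)) = lst (sojourn_law P m UNIV) \<omega>"
    using lst_sojourn_law[of UNIV m \<omega>] by (simp add: divide_inverse)
  have each: "(\<integral>z. ?F {k} z \<partial>MN) * inverse (complex_of_real (rate P * mean_cycle P))
      = complex_of_real (pmf (batch_pmf P) k) * lst (sojourn_law P m {k}) \<omega>" if "k \<in> set_pmf (batch_pmf P)" for k
    using lst_sojourn_law[of "{k}" m \<omega>] pmf_positive[OF that] by (simp add: divide_inverse measure_pmf_single)
  show ?thesis
    using scaled unfolding total by (rule has_sum_cong[THEN iffD1, rotated]) (rule each)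
qed

lemma set_pmf_batches_up_to: "set_pmf (batch_pmf P) = (\<Union>i\<in>{1..nq P}. batches_up_to P i)"
  using ex_last_queue by (fastforce simp: batches_up_to_def)

lemma batches_up_to_disjoint:
  assumes "i \<in> {1..nq P}" "j \<in> {1..nq P}" "i \<noteq> j"
  shows "batches_up_to P i \<inter> batches_up_to P j = {}"
proof -
  have "False" if "k \<in> batches_up_to P i" "k \<in> batches_up_to P j" "i < j" "j \<le> nq P" for i j k
    using that by (auto simp: batches_up_to_def)
  then show ?thesis
    using assms by (metis atLeastAtMost_iff disjoint_iff linorder_neqE_nat)
qed

text \<open>
  If the probability is 0, then no batch size of positive probability is left, and both sides are 0.
\<close>

lemma prob_times_cond_batch_pgf:
  "complex_of_real (measure_pmf.prob (batch_pmf P) (batches_up_to P i)) * cond_batch_pgf P i z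
    = (\<Sum>\<^sub>\<infinity>k\<in>batches_up_to P i. complex_of_real (pmf (batch_pmf P) k) * (\<Prod>l=1..i. z l ^ k l))"
proof (cases "measure_pmf.prob (batch_pmf P) (batches_up_to P i) = 0")
  case True
  then have "set_pmf (batch_pmf P) \<inter> batches_up_to P i = {}"
    by (simp only: measure_pmf_zero_iff)
  then have "batches_up_to P i = {}"
    by (auto simp: batches_up_to_def)
  then show ?thesis
    by simp
next
  case False
  show ?thesis
    unfolding cond_batch_pgf_def infsum_cmult_right'[symmetric]
    by (rule infsum_cong) (use False in simp)
qed

lemma sojourn_transform_by_last_queue:
  assumes \<omega>: "0 \<le> Re \<omega>" "\<omega> \<noteq> 0"
  shows "lst (sojourn_law P m UNIV) \<omega> = 1 / complex_of_real (mean_cycle P) *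
    (\<Sum>i=1..nq P. cycle_term P \<omega> i * (\<Prod>j=1..i-1. lst (switch_law P j) \<omega>)
      * complex_of_real (measure_pmf.prob (batch_pmf P) (batches_up_to P i))
      * cond_batch_pgf P i (service_vec P \<omega> 1 i))"
proof -
  let ?f = "\<lambda>k. complex_of_real (pmf (batch_pmf P) k) * lst (sojourn_law P m {k}) \<omega>"
  let ?G = "\<lambda>i. 1 / complex_of_real (mean_cycle P) * cycle_term P \<omega> i * (\<Prod>j=1..i-1. lst (switch_law P j) \<omega>)"
  have summable: "?f summable_on set_pmf (batch_pmf P)"
    using has_sum_sojourn_transforms[OF \<omega>(1)] by (rule has_sum_imp_summable)
  have "lst (sojourn_law P m UNIV) \<omega> = infsum ?f (\<Union>i\<in>{1..nq P}. batches_up_to P i)"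
    unfolding set_pmf_batches_up_to[symmetric] using has_sum_sojourn_transforms[OF \<omega>(1)] by (rule infsumI[symmetric])
  also have "\<dots> = (\<Sum>i=1..nq P. infsum ?f (batches_up_to P i))"
  proof (rule sum_infsum[symmetric])
    show "?f summable_on batches_up_to P i" for i
      by (rule summable_on_subset_banach[OF summable]) (auto simp: batches_up_to_def)
  qed (use batches_up_to_disjoint in auto)
  also have "\<dots> = (\<Sum>i=1..nq P. ?G i * (complex_of_real (measure_pmf.prob (batch_pmf P) (batches_up_to P i))
      * cond_batch_pgf P i (service_vec P \<omega> 1 i)))"
  proof (rule sum.cong[OF refl])
    fix i assume i: "i \<in> {1..nq P}"
    have "infsum ?f (batches_up_to P i)
        = (\<Sum>\<^sub>\<infinity>k\<in>batches_up_to P i. ?G i * (complex_of_real (pmf (batch_pmf P) k) * (\<Prod>l=1..i. service_vec P \<omega> 1 i l ^ k l)))"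
    proof (rule infsum_cong)
      fix k assume k: "k \<in> batches_up_to P i"
      have "(\<Prod>l=1..i. service_vec P \<omega> 1 i l ^ k l) = (\<Prod>l=1..i. lst (service_law P l) \<omega> ^ k l)"
        by (rule prod.cong) (auto simp: service_vec_def)
      moreover have "lst (sojourn_law P m {k}) \<omega> = ?G i * (\<Prod>j=1..i. lst (service_law P j) \<omega> ^ k j)"
        using k i by (intro sojourn_transform_single_size \<omega>) (auto simp: batches_up_to_def)
      ultimately show "?f k = ?G i * (complex_of_real (pmf (batch_pmf P) k) * (\<Prod>l=1..i. service_vec P \<omega> 1 i l ^ k l))"
        by (simp only: mult_ac)
    qed
    also have "\<dots> = ?G i * (\<Sum>\<^sub>\<infinity>k\<in>batches_up_to P i. complex_of_real (pmf (batch_pmf P) k) * (\<Prod>l=1..i. service_vec P \<omega> 1 i l ^ k l))"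
      by (rule infsum_cmult_right')
    finally show "infsum ?f (batches_up_to P i)
        = ?G i * (complex_of_real (measure_pmf.prob (batch_pmf P) (batches_up_to P i)) * cond_batch_pgf P i (service_vec P \<omega> 1 i))"
      unfolding prob_times_cond_batch_pgf .
  qed
  finally show ?thesis
    by (simp only: sum_distrib_left mult.assoc)
qed

end

theorem theorem4:
  fixes P :: "'a polling" and \<omega> :: complex and m :: nat
  assumes "stationary_globally_gated P"
    and "0 \<le> Re \<omega>" and "\<omega> \<noteq> 0"
  shows
    "((\<lambda>k. complex_of_real (pmf (batch_pmf P) k) * lst (sojourn_law P m {k}) \<omega>)
        has_sum lst (sojourn_law P m UNIV) \<omega>) (set_pmf (batch_pmf P))
     \<and> (\<forall>k\<in>set_pmf (batch_pmf P). \<forall>i\<in>{1..nq P}.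
          k i > 0 \<and> (\<forall>l\<in>{i<..nq P}. k l = 0) \<longrightarrow>
          lst (sojourn_law P m {k}) \<omega> =
            1 / complex_of_real (mean_cycle P) * cycle_term P \<omega> i
            * (\<Prod>j=1..i-1. lst (switch_law P j) \<omega>)
            * (\<Prod>j=1..i. lst (service_law P j) \<omega> ^ k j))
     \<and> lst (sojourn_law P m UNIV) \<omega> =
          1 / complex_of_real (mean_cycle P) *
          (\<Sum>i=1..nq P. cycle_term P \<omega> i
             * (\<Prod>j=1..i-1. lst (switch_law P j) \<omega>)
             * complex_of_real (measure_pmf.prob (batch_pmf P) (batches_up_to P i))
             * cond_batch_pgf P i (service_vec P \<omega> 1 i))"
proof -
  interpret stationary_globally_gated P
    by fact
  show ?thesis
    using has_sum_sojourn_transforms[OF assms(2)] sojourn_transform_by_last_queue[OF assms(2,3)]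
      sojourn_transform_single_size[OF assms(2,3)]
    by simp
qed

end
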